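(* Let $\psi:\mathbb{R}\to\mathbb{R}$ be an even continuous strictly positive function that is monotone increasing for $x\ge0$, with $\int_{-\infty}^\infty e^{-\psi^2(t)}dt<\infty$, and assume that $$V_m=\int_{-\infty}^{\infty}\big(1+\psi^2(s)\big)^m e^{-\psi^2(s)}\,ds<\infty\qquad\text{for all } m\in\mathbb{N}.$$ Let $q\ge1$ be an integer and let $Y^{(1,q)}=Y^{(1,q)}_{N,c,R}$ be the random variable defined in the context. Then the following limits exist for any $k\in\mathbb{N}$, where $(N,c,R)_0\to\infty$ denotes the limiting transition $N,c,R\to\infty$ with $R=o(N)$, $c=o(N)$: (i) if $cR/N\gg1$, then $$\lim_{(N,c,R)_0\to\infty}\frac1{cR}\,\mathrm{Cum}_k\left(\frac{N^{q-1}}{(cR)^{q-1}}Y^{(1,q)}\right)=\Xi_k^{(q,1)};$$ (ii) if $cR/N=s$ ($s>0$ fixed), then there is a finite number $\Xi_k^{(q,2)}(s)$ such that $$\lim_{(N,c,R)_0\to\infty}\frac1{cR}\,\mathrm{Cum}_k\big(Y^{(1,q)}\big)=\Xi_k^{(q,2)}(s);$$ (iii) if $cR/N\ll1$, then $$\lim_{(N,c,R)_0\to\infty}\frac1{cR}\,\mathrm{Cum}_k\big(Y^{(1,q)}\big)=\Xi_k^{(q,3)}=2^{k-1}V_{kq}.$$ In (i), $$\Xi_k^{(q,1)}=\frac{2^{k-1}q^k(k-1)!}{k(q-1)+1}\sum_{u=0}^{k-1}u!\binom{k(q-1)+1}{u}\sum_{\substack{\sigma_k=(s_1,\dots,s_{k-1})\\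 |\sigma_k|=u,\ \|\sigma_k\|=k-1}}V_1^{s_0}\prod_{i=1}^{k-1}\frac1{s_i!}\left(\frac{V_{i+1}}{i!}\right)^{s_i},$$ where $s_i\ge0$ are integers, $|\sigma_k|=s_1+\dots+s_{k-1}$, $\|\sigma_k\|=\sum_{i=1}^{k-1}i\,s_i$ and $s_0=k(q-1)+1-|\sigma_k|$.
   Context: Let $N=2n+1$, $L_N=\{-n,\dots,n\}$, and let $c,R>0$ be parameters with $c\le N$. Let $a_{ij}=a_{ij}^{(N,c,R)}$, $-n\le i<j\le n$, be jointly independent random variables with values in $\{0,1\}$ and $P(a_{ij}=1)=\frac{c}{N}e^{-\psi^2((i-j)/R)}$. For $\alpha\in\{0,1\}$ let $A^{(\alpha)}_{N,c,R}$ be the real symmetric $N\times N$ matrix (indexed by $L_N$) with zero diagonal and entries $\big(1+\alpha\psi^2(\tfrac{i-j}{R})\big)a_{ij}$ for $i<j$. Define $Y^{(\alpha,q)}_{N,c,R}=\sum_{i,j\in L_N}\big((A^{(\alpha)}_{N,c,R})^q\big)_{ij}$. $\mathrm{Cum}_k(\xi)$ denotes the $k$-th cumulant of the random variable $\xi$. The notation $x\gg1$ ($x\ll1$) means $x\to\infty$ ($x\to0$) along the limiting transition. For $k=1$ the only sequence $\sigma_1$ is the empty one, with $|\sigma_1|=\|\sigma_1\|=0$, and empty products equal $1$. *)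

theory Defs
  imports "HOL-Probability.Probability" "Jordan_Normal_Form.Matrix"
begin

text \<open>
  Throughout, the matrix size is \<open>N = 2 * n + 1\<close>, so the limit parameters are
  triples \<open>(n, c, R)\<close>.
\<close>

definition edge_pairs :: "nat \<Rightarrow> (int \<times> int) set" where
  "edge_pairs n = {(i, j). - int n \<le> i \<and> i < j \<and> j \<le> int n}"

definition edge_ensemble ::
  "(real \<Rightarrow> real) \<Rightarrow> nat \<Rightarrow> real \<Rightarrow> real \<Rightarrow> 'w measure \<Rightarrow> (int \<Rightarrow> int \<Rightarrow> 'w \<Rightarrow> real) \<Rightarrow> bool" where
  "edge_ensemble \<psi> n c R M a \<longleftrightarrow>
     prob_space M \<and>
     prob_space.indep_vars M (\<lambda>_. borel) (\<lambda>(i, j). a i j) (edge_pairs n) \<and>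
     (\<forall>(i, j) \<in> edge_pairs n.
        (\<forall>\<omega>\<in>space M. a i j \<omega> \<in> {0, 1}) \<and>
        measure M {\<omega> \<in> space M. a i j \<omega> = 1} =
          c / real (2 * n + 1) * exp (- (\<psi> (real_of_int (i - j) / R))\<^sup>2))"

definition weighted_entry ::
  "(real \<Rightarrow> real) \<Rightarrow> real \<Rightarrow> real \<Rightarrow> (int \<Rightarrow> int \<Rightarrow> 'w \<Rightarrow> real) \<Rightarrow> 'w \<Rightarrow> int \<Rightarrow> int \<Rightarrow> real" where
  "weighted_entry \<psi> \<alpha> R a \<omega> i j =
     (if i < j then (1 + \<alpha> * (\<psi> (real_of_int (i - j) / R))\<^sup>2) * a i j \<omega>
      else if j < i then (1 + \<alpha> * (\<psi> (real_of_int (j - i) / R))\<^sup>2) * a j i \<omega>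
      else 0)"

text \<open>
  Library matrices are indexed by \<open>{0..<N}\<close>; the row and column index \<open>i\<close> stands for
  the site \<open>i - n\<close> in \<open>{-n..n}\<close>.
\<close>

definition weighted_adjacency ::
  "(real \<Rightarrow> real) \<Rightarrow> real \<Rightarrow> nat \<Rightarrow> real \<Rightarrow> (int \<Rightarrow> int \<Rightarrow> 'w \<Rightarrow> real) \<Rightarrow> 'w \<Rightarrow> real mat" where
  "weighted_adjacency \<psi> \<alpha> n R a \<omega> =
     Matrix.mat (2 * n + 1) (2 * n + 1)
       (\<lambda>(i, j). weighted_entry \<psi> \<alpha> R a \<omega> (int i - int n) (int j - int n))"

definition walk_sum ::
  "(real \<Rightarrow> real) \<Rightarrow> real \<Rightarrow> nat \<Rightarrow> nat \<Rightarrow> real \<Rightarrow> (int \<Rightarrow> int \<Rightarrow> 'w \<Rightarrow> real) \<Rightarrow> 'w \<Rightarrow> real" where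
  "walk_sum \<psi> \<alpha> q n R a \<omega> =
     (\<Sum>i<2 * n + 1. \<Sum>j<2 * n + 1. (weighted_adjacency \<psi> \<alpha> n R a \<omega> ^\<^sub>m q) $$ (i, j))"

text \<open>
  The cumulant is meaningful for random variables whose moment generating function is
  finite near \<open>0\<close>, in particular for those with finitely many values.
\<close>

definition cumulant :: "'w measure \<Rightarrow> nat \<Rightarrow> ('w \<Rightarrow> real) \<Rightarrow> real" where
  "cumulant M k \<xi> = (deriv ^^ k) (\<lambda>t. ln (prob_space.expectation M (\<lambda>\<omega>. exp (t * \<xi> \<omega>)))) 0"

definition V_int :: "(real \<Rightarrow> real) \<Rightarrow> nat \<Rightarrow> real" where
  "V_int \<psi> m = (LINT s|lborel. (1 + (\<psi> s)\<^sup>2) ^ m * exp (- (\<psi> s)\<^sup>2))"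

definition NcR_limit :: "(nat \<times> real \<times> real) filter" where
  "NcR_limit = Inf {
     principal {(n, c, R). 0 < c \<and> c \<le> real (2 * n + 1) \<and> 0 < R},
     filtercomap (\<lambda>(n, c, R). real (2 * n + 1)) at_top,
     filtercomap (\<lambda>(n, c, R). c) at_top,
     filtercomap (\<lambda>(n, c, R). R) at_top,
     filtercomap (\<lambda>(n, c, R). R / real (2 * n + 1)) (nhds 0),
     filtercomap (\<lambda>(n, c, R). c / real (2 * n + 1)) (nhds 0)}"

definition link_density :: "nat \<times> real \<times> real \<Rightarrow> real" where
  "link_density = (\<lambda>(n, c, R). c * R / real (2 * n + 1))"

definition NcR_limit_dense :: "(nat \<times> real \<times> real) filter" where
  "NcR_limit_dense = inf NcR_limit (filtercomap link_density at_top)"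

definition NcR_limit_fixed :: "real \<Rightarrow> (nat \<times> real \<times> real) filter" where
  "NcR_limit_fixed s = inf NcR_limit (principal {p. link_density p = s})"

definition NcR_limit_dilute :: "(nat \<times> real \<times> real) filter" where
  "NcR_limit_dilute = inf NcR_limit (filtercomap link_density (nhds 0))"

definition cum_seqs :: "nat \<Rightarrow> nat \<Rightarrow> (nat \<Rightarrow> nat) set" where
  "cum_seqs k u =
     {s \<in> {1..k - 1} \<rightarrow>\<^sub>E UNIV. (\<Sum>i = 1..k - 1. s i) = u \<and> (\<Sum>i = 1..k - 1. i * s i) = k - 1}"

lemma finite_cum_seqs: "finite (cum_seqs k u)"
proof (rule finite_subset)
  show "cum_seqs k u \<subseteq> {1..k - 1} \<rightarrow>\<^sub>E {..u}"
  proof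
    fix s assume s: "s \<in> cum_seqs k u"
    have "s i \<le> u" if "i \<in> {1..k - 1}" for i
      using s member_le_sum[OF that, of s] by (auto simp: cum_seqs_def)
    with s show "s \<in> {1..k - 1} \<rightarrow>\<^sub>E {..u}"
      by (auto simp: cum_seqs_def PiE_iff)
  qed
qed (auto intro: finite_PiE)

text \<open>
  The exponent \<open>s\<^sub>0\<close> is an integer; it is negative only when the binomial coefficient
  vanishes.
\<close>

definition Xi_dense :: "(real \<Rightarrow> real) \<Rightarrow> nat \<Rightarrow> nat \<Rightarrow> real" where
  "Xi_dense \<psi> q k =
     2 ^ (k - 1) * real q ^ k * fact (k - 1) / real (k * (q - 1) + 1) *
     (\<Sum>u = 0..k - 1. fact u * real ((k * (q - 1) + 1) choose u) *
       (\<Sum>s \<in> cum_seqs k u.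
          V_int \<psi> 1 powi (int (k * (q - 1) + 1) - int u) *
          (\<Prod>i = 1..k - 1. 1 / fact (s i) * (V_int \<psi> (i + 1) / fact i) ^ s i)))"

end

theory Submission
  imports Defs
begin

text \<open>
  The walk sum is a polynomial in independent indicators, so its \<open>k\<close>-th cumulant is a sum of joint
  cumulants over \<open>k\<close>-tuples of walks. These vanish unless the walks are linked by shared edges, and
  otherwise equal the joint moment up to a relative error \<open>O(c / N)\<close>. Grouping the linked tuples by
  their coincidence pattern with \<open>v\<close> vertices, each pattern contributes \<open>cR (cR / N)\<^sup>v\<^sup>-\<^sup>2\<close> times a
  product of the integrals \<open>V\<^sub>m\<close> if it is a tree, and is negligible otherwise. In the dilute regime only
  the single edge survives, in the dense regime only the trees with the maximal number
  \<open>k(q - 1) + 1\<close> of edges.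

  The weighted number of the maximal trees does not depend on the model, so it is computed for the
  complete graph, where vertex transitivity makes the decomposition at the first step of a walk
  multiplicative. The resulting recursion over subsets of walks is solved by an identity of
  Hurwitz type, equivalent to Lagrange inversion.
\<close>

section \<open>Joint cumulants of monomials in independent indicators\<close>

text \<open>Indicators are idempotent, so a joint moment is the product of the edge probabilities
  over the union of the supports. If the walks are linked, every splitting into two blocks counts a
  shared edge twice, at the price of a factor at most c / N; this is the source of the relative
  error. An edge used m times carries the m-th power of its link weight times its probability, and
  the position of a leaf ranges over a window of order R; this is why trees produce products of the
  V_m. Each surplus edge over a spanning tree costs c / N without giving a new vertex to sum over.

  The obstacle is the count of the maximal trees: the two pieces of a cut walk may share edges, and
  then a tuple of walks can be split in several ways. On the complete graph, pairs of pieces glued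
  at a vertex are summed without any restriction, so the factorisation is exact. Shared edges and
  ambiguous splittings occur only for configurations with fewer than the maximal number of edges,
  and these are of lower order in the number of vertices.\<close>

definition linked :: "'i set \<Rightarrow> ('i \<Rightarrow> 'e set) \<Rightarrow> bool" where
  "linked I S \<longleftrightarrow> (\<forall>A. A \<noteq> {} \<and> A \<subset> I \<longrightarrow> (\<exists>i\<in>A. \<exists>j\<in>I - A. S i \<inter> S j \<noteq> {}))"

lemma linkedD:
  assumes "linked I S" "A \<noteq> {}" "A \<subset> I"
  obtains i j where "i \<in> A" "j \<in> I - A" "S i \<inter> S j \<noteq> {}"
proof -
  have "\<exists>i\<in>A. \<exists>j\<in>I - A. S i \<inter> S j \<noteq> {}"
    using assms unfolding linked_def by simp
  then show ?thesis using that by (elim bexE)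
qed

lemma linked_cong:
  assumes "\<And>i. i \<in> I \<Longrightarrow> S i = S' i"
  shows "linked I S = linked I S'"
proof -
  have "(\<exists>i\<in>A. \<exists>j\<in>I - A. S i \<inter> S j \<noteq> {}) = (\<exists>i\<in>A. \<exists>j\<in>I - A. S' i \<inter> S' j \<noteq> {})" 
    if "A \<noteq> {} \<and> A \<subset> I" for A
  proof (intro bex_cong refl)
    fix i j assume "i \<in> A" "j \<in> I - A"
    then have "i \<in> I" "j \<in> I" using that by auto
    then show "(S i \<inter> S j \<noteq> {}) = (S' i \<inter> S' j \<noteq> {})" by (simp only: assms)
  qed
  then show ?thesis unfolding linked_def by (intro all_cong1 imp_cong refl)
qed

text \<open>Connectivity of the intersection graph is phrased by cuts, and a cut is crossed by the
  same pairs as its complement; hence only the sides that avoid a chosen root \<open>r\<close> have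
  to be examined.\<close>

lemma linkedI_root:
  assumes r: "r \<in> I"
    and cut: "\<And>A. A \<noteq> {} \<Longrightarrow> A \<subseteq> I \<Longrightarrow> r \<notin> A \<Longrightarrow> \<exists>i\<in>A. \<exists>j\<in>I - A. S i \<inter> S j \<noteq> {}"
  shows "linked I S"
  unfolding linked_def
proof (intro allI impI)
  fix A assume A: "A \<noteq> {} \<and> A \<subset> I"
  show "\<exists>i\<in>A. \<exists>j\<in>I - A. S i \<inter> S j \<noteq> {}"
  proof (cases "r \<in> A")
    case True
    then have "\<exists>i\<in>I - A. \<exists>j\<in>I - (I - A). S i \<inter> S j \<noteq> {}" using A by (intro cut) auto
    then obtain i j where ij: "i \<in> I - A" "j \<in> I - (I - A)" "S i \<inter> S j \<noteq> {}" by (elim bexE)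
    show ?thesis by (rule bexI[of _ j], rule bexI[of _ i]) (use ij in auto)
  next
    case False
    then show ?thesis using A by (intro cut) auto
  qed
qed

lemma linked_singleton [simp]: "linked {r} S"
  by (rule linkedI_root[of r]) auto

lemma linked_insert:
  assumes "linked J S" and j: "j \<in> J" "S i \<inter> S j \<noteq> {}"
  shows "linked (insert i J) S"
proof (rule linkedI_root[of j])
  fix A assume A: "A \<noteq> {}" "A \<subseteq> insert i J" "j \<notin> A"
  show "\<exists>i'\<in>A. \<exists>j'\<in>insert i J - A. S i' \<inter> S j' \<noteq> {}"
  proof (cases "i \<in> A")
    case True
    show ?thesis by (rule bexI[of _ i], rule bexI[of _ j]) (use j A True in auto)
  next
    case False
    with A j have "A \<subset> J" by auto
    from assms(1) A(1) this obtain i' j' where ij: "i' \<in> A" "j' \<in> J - A" "S i' \<inter> S j' \<noteq> {}"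
      by (rule linkedD)
    show ?thesis by (rule bexI[of _ i'], rule bexI[of _ j']) (use ij in auto)
  qed
qed (use j in simp)

text \<open>A linked family can be built up so that each new set meets the union of the earlier
  ones; after the first, set \<open>j\<close> then adds at most \<open>l j - 1\<close> elements. For
  walks this bounds the number of distinct edges.\<close>

lemma card_UN_linked_le:
  fixes S :: "'i \<Rightarrow> 'e set"
  assumes fin: "finite I" "\<And>i. i \<in> I \<Longrightarrow> finite (S i)" and "I \<noteq> {}" and lk: "linked I S"
    and le: "\<And>i. i \<in> I \<Longrightarrow> card (S i) \<le> l i"
  shows "card (\<Union>i\<in>I. S i) + card I \<le> (\<Sum>i\<in>I. l i) + 1"
proof -
  \<comment> \<open>A largest subfamily satisfying the bound replaces an explicit ordering:
    linkedness would extend any proper one.\<close>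
  define P where "P A \<longleftrightarrow> A \<subseteq> I \<and> A \<noteq> {} \<and> card (\<Union>i\<in>A. S i) + card A \<le> (\<Sum>i\<in>A. l i) + 1" for A
  obtain i0 where "i0 \<in> I" using \<open>I \<noteq> {}\<close> by blast
  then have "P {i0}" using le by (simp add: P_def)
  then obtain A where A: "P A" and max: "\<And>B. P B \<Longrightarrow> card B \<le> card A"
  proof -
    have "\<forall>B. P B \<longrightarrow> card B \<le> card I" unfolding P_def using fin(1) by (blast intro: card_mono)
    with \<open>P {i0}\<close> show ?thesis using that ex_has_greatest_nat[of P "{i0}" card "Suc (card I)"] by (metis le_imp_less_Suc)
  qed
  have finA: "finite A" using A fin(1) by (auto simp: P_def intro: finite_subset)
  have "A = I"
  proof (rule ccontr)
    assume "A \<noteq> I"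
    with A have "A \<noteq> {}" "A \<subset> I" unfolding P_def by auto
    with lk obtain i j where ij: "i \<in> A" "j \<in> I - A" "S i \<inter> S j \<noteq> {}"
      by (rule linkedD)
    have fU: "finite (\<Union>i\<in>A. S i)" using A fin finA by (auto simp: P_def)
    have ne: "(\<Union>i\<in>A. S i) \<inter> S j \<noteq> {}" using ij by blast
    have fj: "finite (S j)" using ij fin by auto
    have c1: "card ((\<Union>i\<in>A. S i) \<inter> S j) \<ge> 1"
      using ne fj by (simp add: Suc_leI card_gt_0_iff)
    have "card (\<Union>i\<in>insert j A. S i) + card ((\<Union>i\<in>A. S i) \<inter> S j) = card (\<Union>i\<in>A. S i) + card (S j)"
      using card_Un_Int[OF fU fj] by (simp add: Un_commute)
    then have "card (\<Union>i\<in>insert j A. S i) + 1 \<le> card (\<Union>i\<in>A. S i) + l j"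
      using c1 le[of j] ij by simp
    then have "P (insert j A)"
      using A ij finA by (auto simp: P_def)
    from max[OF this] show False using finA ij by simp
  qed
  with A show ?thesis by (simp add: P_def)
qed

text \<open>
  The joint cumulant of the variables indexed by \<open>I\<close>, where \<open>F B\<close> is the joint moment of those indexed
  by \<open>B\<close>: moments are sums over the block of the least index.
\<close>

function jcum :: "(nat set \<Rightarrow> real) \<Rightarrow> nat set \<Rightarrow> real" where
  "jcum F I = (if finite I then F I - (\<Sum>B | B \<subset> I \<and> Min I \<in> B. jcum F B * F (I - B)) else 0)"
  by auto
termination
  by (relation "Wellfounded.measure (\<lambda>(F, I). card I)") (auto intro: psubset_card_mono)

declare jcum.simps [simp del]

lemma jcum_rec:
  "finite I \<Longrightarrow> jcum F I = F I - (\<Sum>B | B \<subset> I \<and> Min I \<in> B. jcum F B * F (I - B))"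
  by (subst jcum.simps) simp

lemma jcum_cong:
  assumes "\<And>B. B \<subseteq> I \<Longrightarrow> F B = G B"
  shows "jcum F I = jcum G I"
  using assms
proof (induction "card I" arbitrary: I rule: less_induct)
  case less
  show ?case
  proof (cases "finite I")
    case True
    have "jcum F B * F (I - B) = jcum G B * G (I - B)" if "B \<subset> I" for B
      using less.hyps[of B] less.prems that psubset_card_mono[OF True that] by auto
    then have "(\<Sum>B | B \<subset> I \<and> Min I \<in> B. jcum F B * F (I - B)) = (\<Sum>B | B \<subset> I \<and> Min I \<in> B. jcum G B * G (I - B))"
      by (intro sum.cong) auto
    with less.prems[of I] show ?thesis
      by (simp add: jcum_rec[OF True])
  qed (simp add: jcum.simps)
qed

lemma finite_Min_subsets: "finite I \<Longrightarrow> finite {B. B \<subset> I \<and> Min I \<in> B}"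
  by (rule finite_subset[of _ "Pow I"]) auto

text \<open>The case distinction at \<open>B = I\<close> stands in for \<open>F {} = 1\<close>,
  which is not assumed of a general \<open>F\<close>.\<close>

lemma jcum_sum:
  assumes "finite I" "I \<noteq> {}"
  shows "F I = (\<Sum>B | B \<subseteq> I \<and> Min I \<in> B. jcum F B * (if B = I then 1 else F (I - B)))"
proof -
  have "Min I \<in> I" using assms by simp
  then have "{B. B \<subseteq> I \<and> Min I \<in> B} = insert I {B. B \<subset> I \<and> Min I \<in> B}"
    by auto
  moreover have "(\<Sum>B | B \<subset> I \<and> Min I \<in> B. jcum F B * (if B = I then 1 else F (I - B)))
      = (\<Sum>B | B \<subset> I \<and> Min I \<in> B. jcum F B * F (I - B))"
    by (intro sum.cong) auto
  ultimately show ?thesis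
    using jcum_rec[OF assms(1), of F] finite_Min_subsets[OF assms(1)] by simp
qed

text \<open>Mixed cumulants of independent groups vanish. With the least index in \<open>A\<close>,
  the blocks that also meet \<open>B\<close> drop out by induction, and the blocks inside
  \<open>A\<close> resum to \<open>F A * F B\<close> by the recursion for \<open>A\<close>, which
  cancels the moment of the union.\<close>

lemma jcum_split_eq_0:
  fixes F :: "nat set \<Rightarrow> real"
  assumes "finite A" "finite B" "A \<noteq> {}" "B \<noteq> {}" "A \<inter> B = {}"
    and mult: "\<And>A' B'. A' \<subseteq> A \<Longrightarrow> B' \<subseteq> B \<Longrightarrow> F (A' \<union> B') = F A' * F B'"
  shows "jcum F (A \<union> B) = 0"
  using assms
proof (induction "card (A \<union> B)" arbitrary: A B rule: less_induct)
  case less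
  have main: "jcum F (A \<union> B) = 0" 
    if min: "Min (A \<union> B) \<in> A" and A: "finite A" "finite B" "A \<noteq> {}" "B \<noteq> {}" "A \<inter> B = {}"
    and mult: "\<And>A' B'. A' \<subseteq> A \<Longrightarrow> B' \<subseteq> B \<Longrightarrow> F (A' \<union> B') = F A' * F B'"
    and IH: "\<And>A' B'. card (A' \<union> B') < card (A \<union> B) \<Longrightarrow> A' \<noteq> {} \<Longrightarrow> B' \<noteq> {} \<Longrightarrow> A' \<subseteq> A \<Longrightarrow> B' \<subseteq> B
      \<Longrightarrow> jcum F (A' \<union> B') = 0" for A B
  proof -
    have mA: "Min (A \<union> B) = Min A"
      using min A by (intro antisym Min.boundedI Min_le) auto
    have "(\<Sum>C | C \<subset> A \<union> B \<and> Min (A \<union> B) \<in> C. jcum F C * F (A \<union> B - C))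
        = (\<Sum>C | C \<subseteq> A \<and> Min A \<in> C. jcum F C * F (A \<union> B - C))"
    proof (rule sum.mono_neutral_right)
      show "\<forall>C\<in>{C. C \<subset> A \<union> B \<and> Min (A \<union> B) \<in> C} - {C. C \<subseteq> A \<and> Min A \<in> C}.
        jcum F C * F (A \<union> B - C) = 0"
      proof
        fix C assume C: "C \<in> {C. C \<subset> A \<union> B \<and> Min (A \<union> B) \<in> C} - {C. C \<subseteq> A \<and> Min A \<in> C}"
        then have *: "C = (C \<inter> A) \<union> (C \<inter> B)" "C \<inter> A \<noteq> {}" "C \<inter> B \<noteq> {}" "C \<subset> A \<union> B"
          using min mA by auto
        moreover have "card C < card (A \<union> B)"
          using A *(4) by (intro psubset_card_mono) auto
        ultimately have "jcum F ((C \<inter> A) \<union> (C \<inter> B)) = 0"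
          by (intro IH) auto
        with *(1) show "jcum F C * F (A \<union> B - C) = 0" by simp
      qed
    qed (use finite_Min_subsets[of "A \<union> B"] A mA in auto)
    also have "\<dots> = (\<Sum>C | C \<subseteq> A \<and> Min A \<in> C. jcum F C * (if C = A then 1 else F (A - C)) * F B)"
    proof (rule sum.cong)
      fix C assume C: "C \<in> {C. C \<subseteq> A \<and> Min A \<in> C}"
      then have "A \<union> B - C = (A - C) \<union> B" using A by auto
      then show "jcum F C * F (A \<union> B - C) = jcum F C * (if C = A then 1 else F (A - C)) * F B"
        using mult[of "A - C" B] by auto
    qed simp
    also have "\<dots> = F A * F B"
      using jcum_sum[of A F] A by (simp add: sum_distrib_right)
    finally show ?thesis
      using mult[of A B] A by (subst jcum_rec) auto
  qed
  note IH = less.hyps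
  have sub: "jcum F (A' \<union> B') = 0" 
    if "card (A' \<union> B') < card (A \<union> B)" "A' \<noteq> {}" "B' \<noteq> {}" "A' \<subseteq> A" "B' \<subseteq> B" for A' B'
  proof (rule less.hyps[OF that(1)])
    show "finite A'" using \<open>A' \<subseteq> A\<close> less.prems(1) by (rule finite_subset)
    show "finite B'" using \<open>B' \<subseteq> B\<close> less.prems(2) by (rule finite_subset)
    show "A' \<inter> B' = {}" using that(4,5) less.prems(5) by auto
    show "F (C \<union> D) = F C * F D" if "C \<subseteq> A'" "D \<subseteq> B'" for C D
      using that \<open>A' \<subseteq> A\<close> \<open>B' \<subseteq> B\<close> by (intro less.prems(6)) auto
  qed (use that in simp_all)
  have "Min (A \<union> B) \<in> A \<union> B" using less.prems by (intro Min_in) auto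
  then show ?case
  proof
    assume "Min (A \<union> B) \<in> A"
    then show ?thesis by (rule main) (fact less.prems sub)+
  next
    assume "Min (A \<union> B) \<in> B"
    then have min: "Min (B \<union> A) \<in> B" by (simp add: Un_commute)
    have "jcum F (B \<union> A) = 0" using min
    proof (rule main)
      show "F (B' \<union> A') = F B' * F A'" if "B' \<subseteq> B" "A' \<subseteq> A" for A' B'
        using less.prems(6)[OF that(2,1)] by (simp add: Un_commute mult.commute)
      show "jcum F (B' \<union> A') = 0" 
        if "card (B' \<union> A') < card (B \<union> A)" "B' \<noteq> {}" "A' \<noteq> {}" "B' \<subseteq> B" "A' \<subseteq> A" for A' B'
        using sub[of A' B'] that by (simp add: Un_commute)
      show "B \<inter> A = {}" using less.prems(5) by auto
    qed (fact less.prems)+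
    then show ?thesis by (simp add: Un_commute)
  qed
qed

text \<open>\<open>F B\<close> is the joint moment of monomials in independent indicators with
  success probabilities \<open>p e\<close>; an indicator that occurs repeatedly is counted once. In
  the model \<open>\<epsilon>\<close> is c / N.\<close>

context
  fixes S :: "nat \<Rightarrow> 'e set" and p :: "'e \<Rightarrow> real" and \<epsilon> :: real and F :: "nat set \<Rightarrow> real"
  assumes finS: "\<And>i. finite (S i)" and p: "\<And>e. 0 \<le> p e" "\<And>e. p e \<le> \<epsilon>" and eps: "\<epsilon> \<le> 1"
  defines "F \<equiv> \<lambda>B. \<Prod>e\<in>(\<Union>i\<in>B. S i). p e"
begin

lemma p_le_1: "p e \<le> 1" using p eps order_trans by blast

lemma eps_nonneg: "0 \<le> \<epsilon>" using p order_trans by blast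

lemma moment_nonneg: "0 \<le> F B" by (simp add: F_def prod_nonneg p)

lemma moment_split:
  assumes "finite A" "finite B"
  shows "F A * F B = F (A \<union> B) * (\<Prod>e\<in>(\<Union>i\<in>A. S i) \<inter> (\<Union>i\<in>B. S i). p e)"
proof -
  have "F (A \<union> B) * (\<Prod>e\<in>(\<Union>i\<in>A. S i) \<inter> (\<Union>i\<in>B. S i). p e) = F A * F B"
    unfolding F_def UN_Un by (rule prod.union_inter) (use assms finS in auto)
  then show ?thesis by simp
qed

lemma moment_split_le:
  assumes "finite A" "finite B"
  shows "F A * F B \<le> F (A \<union> B)"
  unfolding moment_split[OF assms]
  using prod_le_1[of "(\<Union>i\<in>A. S i) \<inter> (\<Union>i\<in>B. S i)" p] p p_le_1 moment_nonneg
  by (intro mult_left_le) auto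

lemma moment_split_le_eps:
  assumes "finite A" "finite B" and ne: "(\<Union>i\<in>A. S i) \<inter> (\<Union>i\<in>B. S i) \<noteq> {}"
  shows "F A * F B \<le> \<epsilon> * F (A \<union> B)"
proof -
  let ?D = "(\<Union>i\<in>A. S i) \<inter> (\<Union>i\<in>B. S i)"
  obtain e where e: "e \<in> ?D" using ne by blast
  have "finite ?D" using assms finS by auto
  then have "prod p ?D = p e * prod p (?D - {e})" using e by (rule prod.remove)
  also have "\<dots> \<le> p e" using p_le_1 p by (intro mult_left_le prod_le_1) auto
  also have "\<dots> \<le> \<epsilon>" by (rule p)
  finally show ?thesis
    unfolding moment_split[OF assms(1,2)] using moment_nonneg[of "A \<union> B"]
    by (metis mult.commute mult_right_mono)
qed

text \<open>The factor \<open>2 ^ (n - 1) - 1\<close> bounds the number of proper blocks that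
  contain the least index. The estimate is used with \<open>\<delta> = 1\<close> for a crude bound
  and with \<open>\<delta> = \<epsilon>\<close> for linked families.\<close>

lemma abs_jcum_sum_le:
  assumes I: "finite I" "I \<noteq> {}" and n: "card I \<le> n" and \<delta>: "0 \<le> \<delta>"
    and IH: "\<And>B. B \<subset> I \<Longrightarrow> Min I \<in> B \<Longrightarrow> \<bar>jcum F B\<bar> \<le> b * F B"
    and D: "\<And>B. B \<subset> I \<Longrightarrow> Min I \<in> B \<Longrightarrow> F B * F (I - B) \<le> \<delta> * F I" and b: "0 \<le> b"
  shows "\<bar>jcum F I - F I\<bar> \<le> (2 ^ (n - 1) - 1) * b * \<delta> * F I"
proof -
  let ?M = "{B. B \<subset> I \<and> Min I \<in> B}"
  have "card ?M + 1 = card (insert I ?M)" using finite_Min_subsets[OF I(1)] by simp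
  also have "\<dots> = card ((\<lambda>C. insert (Min I) C) ` Pow (I - {Min I}))"
  proof (rule arg_cong[where f = card])
    have mi: "Min I \<in> I" using I by simp
    show "insert I ?M = insert (Min I) ` Pow (I - {Min I})"
    proof (intro Set.set_eqI iffI)
      fix C assume "C \<in> insert I ?M"
      then have "C = insert (Min I) (C - {Min I})" "C - {Min I} \<in> Pow (I - {Min I})" using mi by auto
      then show "C \<in> insert (Min I) ` Pow (I - {Min I})" by blast
    qed (use mi in auto)
  qed
  also have "\<dots> = card (Pow (I - {Min I}))"
    by (rule card_image) (auto simp: inj_on_def)
  also have "\<dots> = 2 ^ (card I - 1)" using I by (simp add: card_Pow)
  also have "\<dots> \<le> 2 ^ (n - 1)" using n by (intro power_increasing) auto
  finally have "real (card ?M + 1) \<le> real (2 ^ (n - 1))" by (simp only: of_nat_le_iff)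
  then have cM: "real (card ?M) \<le> 2 ^ (n - 1) - 1" by simp
  have "\<bar>jcum F I - F I\<bar> \<le> (\<Sum>B\<in>?M. \<bar>jcum F B * F (I - B)\<bar>)"
    unfolding jcum_rec[OF I(1)] by (simp add: sum_abs)
  also have "\<dots> \<le> (\<Sum>B\<in>?M. b * (\<delta> * F I))"
  proof (rule sum_mono)
    fix B assume B: "B \<in> ?M"
    then have "\<bar>jcum F B * F (I - B)\<bar> \<le> b * F B * F (I - B)"
      using IH[of B] moment_nonneg by (simp add: abs_mult mult_right_mono)
    also have "\<dots> \<le> b * (\<delta> * F I)"
      using D[of B] B b by (simp add: mult.assoc mult_left_mono)
    finally show "\<bar>jcum F B * F (I - B)\<bar> \<le> b * (\<delta> * F I)" .
  qed
  also have "\<dots> \<le> (2 ^ (n - 1) - 1) * (b * (\<delta> * F I))"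
    using cM b \<delta> moment_nonneg[of I] by (simp add: mult_right_mono)
  finally show ?thesis by (simp add: mult.assoc)
qed

text \<open>The exponent solves the recursion for the constants: passing from n - 1 to n indices
  multiplies by at most \<open>2 ^ (n - 1)\<close>, and n - 1 + (n - 1)^2 is at most n^2.\<close>

lemma abs_jcum_le:
  assumes "finite I" "I \<noteq> {}"
  shows "\<bar>jcum F I\<bar> \<le> 2 ^ (card I ^ 2) * F I"
  using assms
proof (induction "card I" arbitrary: I rule: less_induct)
  case less
  let ?n = "card I"
  have n: "?n \<ge> 1" using less.prems by (simp add: Suc_leI card_gt_0_iff)
  have "\<bar>jcum F I - F I\<bar> \<le> (2 ^ (?n - 1) - 1) * 2 ^ ((?n - 1)\<^sup>2) * 1 * F I"
  proof (rule abs_jcum_sum_le)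
    fix B assume B: "B \<subset> I" "Min I \<in> B"
    have fB: "finite B" using B less.prems by (auto intro: finite_subset)
    have c: "card B < card I" using B less.prems by (intro psubset_card_mono) auto
    have "\<bar>jcum F B\<bar> \<le> 2 ^ (card B ^ 2) * F B"
      using less.hyps[OF c fB] B by auto
    also have "\<dots> \<le> 2 ^ ((?n - 1)\<^sup>2) * F B"
      using c moment_nonneg by (intro mult_right_mono power_increasing power_mono) auto
    finally show "\<bar>jcum F B\<bar> \<le> 2 ^ ((?n - 1)\<^sup>2) * F B" .
    show "F B * F (I - B) \<le> 1 * F I"
      using moment_split_le[of B "I - B"] fB less.prems B by (simp add: Un_absorb1 less_imp_le)
  qed (use less.prems in auto)
  moreover have "\<bar>jcum F I\<bar> \<le> \<bar>jcum F I - F I\<bar> + F I"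
    using moment_nonneg[of I] by linarith
  ultimately have "\<bar>jcum F I\<bar> \<le> (1 + (2 ^ (?n - 1) - 1) * 2 ^ ((?n - 1)\<^sup>2)) * F I"
    by (simp add: algebra_simps)
  also have "\<dots> \<le> 2 ^ (?n ^ 2) * F I"
  proof (rule mult_right_mono)
    have "1 + (2 ^ (?n - 1) - 1) * 2 ^ ((?n - 1)\<^sup>2) \<le> 2 ^ (?n - 1) * (2::real) ^ ((?n - 1)\<^sup>2)"
      using one_le_power[of "2::real" "(?n - 1)\<^sup>2"] by (simp add: algebra_simps)
    also have "\<dots> = 2 ^ (?n - 1 + (?n - 1)\<^sup>2)" by (simp add: power_add)
    also have "\<dots> \<le> 2 ^ (?n ^ 2)"
    proof (rule power_increasing)
      obtain m where "?n = Suc m" using n by (cases ?n) auto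
      then show "?n - 1 + (?n - 1)\<^sup>2 \<le> ?n ^ 2" by (simp add: power2_eq_square)
    qed simp
    finally show "1 + (2 ^ (?n - 1) - 1) * 2 ^ ((?n - 1)\<^sup>2) \<le> (2::real) ^ (?n ^ 2)" .
  qed (rule moment_nonneg)
  finally show ?case .
qed

lemma jcum_not_linked:
  assumes "finite I" "\<not> linked I S"
  shows "jcum F I = 0"
proof -
  obtain A where A: "A \<noteq> {}" "A \<subset> I" "\<And>i j. i \<in> A \<Longrightarrow> j \<in> I - A \<Longrightarrow> S i \<inter> S j = {}"
    using assms(2) unfolding linked_def by auto
  have "jcum F (A \<union> (I - A)) = 0"
  proof (rule jcum_split_eq_0)
    fix A' B' assume AB: "A' \<subseteq> A" "B' \<subseteq> I - A"
    have d: "(\<Union>i\<in>A'. S i) \<inter> (\<Union>i\<in>B'. S i) = {}"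
    proof (rule equals0I)
      fix e assume "e \<in> (\<Union>i\<in>A'. S i) \<inter> (\<Union>i\<in>B'. S i)"
      then obtain i j where "i \<in> A'" "e \<in> S i" "j \<in> B'" "e \<in> S j" by auto
      with A(3)[of i j] AB show False by auto
    qed
    have "finite A'" "finite B'"
      using AB A(2) assms(1) by (meson finite_Diff psubset_imp_subset rev_finite_subset)+
    then show "F (A' \<union> B') = F A' * F B'"
      by (simp add: moment_split d)
  next
    show "finite A" using A(2) assms(1) by (meson psubset_imp_subset rev_finite_subset)
  qed (use A assms in auto)
  moreover have "A \<union> (I - A) = I" using A by blast
  ultimately show ?thesis by simp
qed

text \<open>Every proper block of a linked family shares an indicator with its complement, so each
  correction term of the recursion counts that indicator twice and gains a factor
  \<open>\<epsilon>\<close>.\<close>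

lemma jcum_linked_approx:
  assumes I: "finite I" "I \<noteq> {}" and lk: "linked I S"
  shows "\<bar>jcum F I - F I\<bar> \<le> 2 ^ (card I + card I ^ 2) * \<epsilon> * F I"
proof -
  have "\<bar>jcum F I - F I\<bar> \<le> (2 ^ (card I - 1) - 1) * 2 ^ (card I ^ 2) * \<epsilon> * F I"
  proof (rule abs_jcum_sum_le)
    fix B assume B: "B \<subset> I" "Min I \<in> B"
    have fB: "finite B" using B I by (auto intro: finite_subset)
    have "\<bar>jcum F B\<bar> \<le> 2 ^ (card B ^ 2) * F B" using abs_jcum_le[OF fB] B by auto
    also have "\<dots> \<le> 2 ^ ((card I)\<^sup>2) * F B"
      using moment_nonneg card_mono[of I B] B I by (intro mult_right_mono power_increasing power_mono) auto
    finally show "\<bar>jcum F B\<bar> \<le> 2 ^ ((card I)\<^sup>2) * F B" .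
    have "B \<noteq> {}" using B by auto
    with lk obtain i j where "i \<in> B" "j \<in> I - B" "S i \<inter> S j \<noteq> {}"
      using B(1) by (rule linkedD)
    then have "(\<Union>i\<in>B. S i) \<inter> (\<Union>i\<in>I - B. S i) \<noteq> {}" by auto
    then show "F B * F (I - B) \<le> \<epsilon> * F I"
      using moment_split_le_eps[of B "I - B"] fB I B by (simp add: Un_absorb1 less_imp_le)
  qed (use I eps_nonneg in auto)
  also have "\<dots> \<le> 2 ^ (card I) * 2 ^ (card I ^ 2) * \<epsilon> * F I"
  proof -
    have "(2::real) ^ (card I - 1) \<le> 2 ^ card I" by (intro power_increasing) auto
    then have "(2::real) ^ (card I - 1) - 1 \<le> 2 ^ card I" by linarith
    then show ?thesis
      using eps_nonneg moment_nonneg by (intro mult_right_mono) auto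
  qed
  finally show ?thesis by (simp add: power_add)
qed

end

section \<open>Cumulants and moments\<close>

text \<open>Index shift: the value at \<open>j\<close> is the cumulant of order j + 1. In a moment
  of order j + 1 the block of a distinguished element has i further elements, chosen in
  \<open>j choose i\<close> ways.\<close>

function cumulant_rec :: "(nat \<Rightarrow> real) \<Rightarrow> nat \<Rightarrow> real" where
  "cumulant_rec m j = m (Suc j) - (\<Sum>i<j. real (j choose i) * cumulant_rec m i * m (j - i))"
  by auto
termination
  by (relation "Wellfounded.measure (\<lambda>(m, j). j)") auto

declare cumulant_rec.simps [simp del]

lemma cumulant_rec_scale:
  "cumulant_rec (\<lambda>i. a ^ i * m i) j = a ^ Suc j * cumulant_rec m j"
proof (induction j rule: less_induct)
  case (less j)
  have "(\<Sum>i<j. real (j choose i) * cumulant_rec (\<lambda>i. a ^ i * m i) i * (a ^ (j - i) * m (j - i)))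
      = (\<Sum>i<j. a ^ Suc j * (real (j choose i) * cumulant_rec m i * m (j - i)))"
  proof (rule sum.cong)
    fix i assume "i \<in> {..<j}"
    then have "a ^ Suc j = a ^ Suc i * a ^ (j - i)" by (simp flip: power_add)
    then show "real (j choose i) * cumulant_rec (\<lambda>i. a ^ i * m i) i * (a ^ (j - i) * m (j - i))
      = a ^ Suc j * (real (j choose i) * cumulant_rec m i * m (j - i))"
      using less.IH[of i] \<open>i \<in> {..<j}\<close> by auto
  qed simp
  then show ?case
    by (subst (1 2) cumulant_rec.simps) (simp add: sum_distrib_left right_diff_distrib)
qed

text \<open>The moments of an exponentially tilted law satisfy \<open>\<mu>\<^sub>i' = \<mu>\<^sub>i\<^sub>+\<^sub>1 - \<mu>\<^sub>i \<mu>\<^sub>1\<close>.\<close>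

lemma has_derivative_cumulant_rec:
  fixes \<mu> :: "real \<Rightarrow> nat \<Rightarrow> real"
  assumes 0: "\<mu> t 0 = 1"
    and d: "\<And>i. ((\<lambda>t. \<mu> t i) has_real_derivative \<mu> t (Suc i) - \<mu> t i * \<mu> t 1) (at t)"
  shows "((\<lambda>t. cumulant_rec (\<mu> t) j) has_real_derivative cumulant_rec (\<mu> t) (Suc j)) (at t)"
proof (induction j rule: less_induct)
  case (less j)
  let ?\<kappa> = "\<lambda>t. cumulant_rec (\<mu> t)"
  have "((\<lambda>t. \<mu> t (Suc j) - (\<Sum>i<j. real (j choose i) * ?\<kappa> t i * \<mu> t (j - i))) has_real_derivative
      (\<mu> t (Suc (Suc j)) - \<mu> t (Suc j) * \<mu> t 1) -
        (\<Sum>i<j. real (j choose i) * (?\<kappa> t (Suc i) * \<mu> t (j - i) +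
            ?\<kappa> t i * (\<mu> t (Suc (j - i)) - \<mu> t (j - i) * \<mu> t 1)))) (at t)"
    by (rule derivative_eq_intros d less.IH refl | simp)+ (simp add: algebra_simps)
  moreover have "(\<mu> t (Suc (Suc j)) - \<mu> t (Suc j) * \<mu> t 1) -
        (\<Sum>i<j. real (j choose i) * (?\<kappa> t (Suc i) * \<mu> t (j - i) +
            ?\<kappa> t i * (\<mu> t (Suc (j - i)) - \<mu> t (j - i) * \<mu> t 1))) = ?\<kappa> t (Suc j)"
  proof -
    define A where "A = (\<Sum>i<j. real (j choose i) * ?\<kappa> t (Suc i) * \<mu> t (j - i))"
    define B where "B = (\<Sum>i<j. real (j choose i) * ?\<kappa> t i * \<mu> t (Suc (j - i)))"
    define C where "C = (\<Sum>i<j. real (j choose i) * ?\<kappa> t i * \<mu> t (j - i))"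
    have C: "C = \<mu> t (Suc j) - ?\<kappa> t j"
      using cumulant_rec.simps[of "\<mu> t" j] by (simp add: C_def)
    \<comment> \<open>Pascal's rule: \<open>B\<close> and the last term carry
      \<open>j choose i\<close>, and \<open>A\<close> carries the remaining part after a shift of
      the index.\<close>
    have "(\<Sum>i<Suc j. real (Suc j choose i) * ?\<kappa> t i * \<mu> t (Suc j - i)) = A + B + ?\<kappa> t j * \<mu> t 1"
    proof (cases j)
      case 0
      then show ?thesis by (simp add: A_def B_def)
    next
      case (Suc l)
      have "(\<Sum>i<Suc j. real (Suc j choose i) * ?\<kappa> t i * \<mu> t (Suc j - i)) =
          (\<Sum>i<Suc j. real (j choose i) * ?\<kappa> t i * \<mu> t (Suc j - i)) +
          (\<Sum>i<Suc j. (real (Suc j choose i) - real (j choose i)) * ?\<kappa> t i * \<mu> t (Suc j - i))"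
        by (simp add: algebra_simps flip: sum.distrib)
      also have "(\<Sum>i<Suc j. real (j choose i) * ?\<kappa> t i * \<mu> t (Suc j - i)) = B + ?\<kappa> t j * \<mu> t 1"
        unfolding B_def by (simp add: Suc_diff_le)
      also have "(\<Sum>i<Suc j. (real (Suc j choose i) - real (j choose i)) * ?\<kappa> t i * \<mu> t (Suc j - i)) = A"
        unfolding A_def by (subst sum.lessThan_Suc_shift) simp
      finally show ?thesis by simp
    qed
    then have "?\<kappa> t (Suc j) = \<mu> t (Suc (Suc j)) - (A + B + ?\<kappa> t j * \<mu> t 1)"
      by (subst cumulant_rec.simps) simp
    moreover have "(\<Sum>i<j. real (j choose i) * (?\<kappa> t (Suc i) * \<mu> t (j - i) +
            ?\<kappa> t i * (\<mu> t (Suc (j - i)) - \<mu> t (j - i) * \<mu> t 1))) = A + B - C * \<mu> t 1"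
      unfolding A_def B_def C_def
      by (simp add: algebra_simps sum_distrib_left sum_distrib_right flip: sum.distrib sum_subtractf)
    ultimately show ?thesis using C by (simp add: algebra_simps)
  qed
  ultimately show ?case
    by (subst cumulant_rec.simps) simp
qed

lemma higher_deriv_cumulant_rec:
  fixes \<mu> :: "real \<Rightarrow> nat \<Rightarrow> real"
  assumes "\<And>t. \<mu> t 0 = 1"
    and "\<And>t i. ((\<lambda>t. \<mu> t i) has_real_derivative \<mu> t (Suc i) - \<mu> t i * \<mu> t 1) (at t)"
    and f: "\<And>t. (f has_real_derivative \<mu> t 1) (at t)"
  shows "(deriv ^^ Suc j) f = (\<lambda>t. cumulant_rec (\<mu> t) j)"
proof (induction j)
  case 0
  show ?case using f by (auto simp: cumulant_rec.simps[of _ 0] intro!: ext DERIV_imp_deriv)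
next
  case (Suc j)
  then show ?case
    using has_derivative_cumulant_rec[OF assms(1,2), of j]
    by (auto intro!: ext DERIV_imp_deriv)
qed

lemma (in prob_space) expectation_finite_range:
  fixes Y :: "'a \<Rightarrow> real"
  assumes Y: "Y \<in> borel_measurable M" and fin: "finite (Y ` space M)"
  shows "expectation (\<lambda>\<omega>. g (Y \<omega>)) = (\<Sum>v\<in>Y ` space M. g v * prob (Y -` {v} \<inter> space M))"
proof -
  have "expectation (\<lambda>\<omega>. g (Y \<omega>)) =
      expectation (\<lambda>\<omega>. \<Sum>v\<in>Y ` space M. g v * indicator (Y -` {v} \<inter> space M) \<omega>)"
  proof (rule Bochner_Integration.integral_cong[OF refl])
    fix \<omega> assume \<omega>: "\<omega> \<in> space M"
    have "(\<Sum>v\<in>Y ` space M. g v * indicator (Y -` {v} \<inter> space M) \<omega>) =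
        (\<Sum>v\<in>Y ` space M. if v = Y \<omega> then g v else 0)"
      using \<omega> by (intro sum.cong) (auto simp: indicator_def)
    then show "g (Y \<omega>) = (\<Sum>v\<in>Y ` space M. g v * indicator (Y -` {v} \<inter> space M) \<omega>)"
      using fin \<omega> by simp
  qed
  also have "\<dots> = (\<Sum>v\<in>Y ` space M. g v * prob (Y -` {v} \<inter> space M))"
  proof -
    have "Y -` {v} \<inter> space M \<in> events" for v using Y by (rule measurable_sets) simp
    then have "integrable M (indicat_real (Y -` {v} \<inter> space M))" for v
      by (intro integrable_real_indicator) (auto simp: emeasure_eq_measure)
    then show ?thesis by (subst Bochner_Integration.integral_sum) auto
  qed
  finally show ?thesis .
qed

text \<open>A finite range makes the moment generating function a positive finite sum of
  exponentials, so the tilted moments are smooth in t everywhere; at t = 0 they are the moments of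
  \<open>Y\<close>.\<close>

lemma (in prob_space) cumulant_eq_cumulant_rec:
  fixes Y :: "'a \<Rightarrow> real"
  assumes Y: "Y \<in> borel_measurable M" and fin: "finite (Y ` space M)"
  shows "(deriv ^^ Suc j) (\<lambda>t. ln (expectation (\<lambda>\<omega>. exp (t * Y \<omega>)))) 0 =
    cumulant_rec (\<lambda>i. expectation (\<lambda>\<omega>. Y \<omega> ^ i)) j"
proof -
  define P where "P v = prob (Y -` {v} \<inter> space M)" for v
  define D where "D t i = (\<Sum>v\<in>Y ` space M. v ^ i * exp (t * v) * P v)" for t i
  have mgf: "expectation (\<lambda>\<omega>. exp (t * Y \<omega>)) = D t 0" for t
    using expectation_finite_range[OF assms, of "\<lambda>v. exp (t * v)"] by (simp add: D_def P_def)
  have mom: "expectation (\<lambda>\<omega>. Y \<omega> ^ i) = D 0 i" for i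
    using expectation_finite_range[OF assms, of "\<lambda>v. v ^ i"] by (simp add: D_def P_def)
  have sumP: "(\<Sum>v\<in>Y ` space M. P v) = 1"
    using mom[of 0] prob_space by (simp add: D_def)
  have P0: "P v \<ge> 0" for v by (simp add: P_def)
  have pos: "D t 0 > 0" for t
  proof -
    obtain v where v: "v \<in> Y ` space M" "P v \<noteq> 0"
      using sumP by (metis sum.neutral zero_neq_one)
    have "0 < exp (t * v) * P v" using v P0[of v] by simp
    also have "\<dots> \<le> D t 0"
      unfolding D_def using member_le_sum[OF v(1), of "\<lambda>v. exp (t * v) * P v"] P0 fin by simp
    finally show ?thesis .
  qed
  have dD: "((\<lambda>t. D t i) has_real_derivative D t (Suc i)) (at t)" for t i
    unfolding D_def by (auto intro!: derivative_eq_intros sum.cong)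
  define \<mu> where "\<mu> t i = D t i / D t 0" for t i
  have "(deriv ^^ Suc j) (\<lambda>t. ln (D t 0)) = (\<lambda>t. cumulant_rec (\<mu> t) j)"
  proof (rule higher_deriv_cumulant_rec)
    show "\<mu> t 0 = 1" for t using pos[of t] by (simp add: \<mu>_def)
    show "((\<lambda>t. \<mu> t i) has_real_derivative \<mu> t (Suc i) - \<mu> t i * \<mu> t 1) (at t)" for t i
      unfolding \<mu>_def using pos[of t]
      by (auto intro!: derivative_eq_intros dD simp: field_simps)
    show "((\<lambda>t. ln (D t 0)) has_real_derivative \<mu> t 1) (at t)" for t
      unfolding \<mu>_def using pos[of t] dD[of 0 t] by (auto intro!: derivative_eq_intros dD)
  qed
  moreover have "\<mu> 0 = D 0" using sumP by (auto simp: \<mu>_def D_def)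
  ultimately show ?thesis using mom by (simp add: mgf)
qed

section \<open>Configurations of walks and their patterns\<close>

text \<open>Position t of walk \<open>i\<close> is the pair (i, t). A walk of \<open>l i\<close>
  steps has \<open>l i + 1\<close> positions, hence the closed range here and the half-open one in
  \<open>steps\<close>, where a step is named by its starting position.\<close>

definition points :: "'i set \<Rightarrow> ('i \<Rightarrow> nat) \<Rightarrow> ('i \<times> nat) set" where
  "points I l = (SIGMA i:I. {..l i})"

definition steps :: "'i set \<Rightarrow> ('i \<Rightarrow> nat) \<Rightarrow> ('i \<times> nat) set" where
  "steps I l = (SIGMA i:I. {..<l i})"

definition edge :: "('i \<times> nat \<Rightarrow> 'v) \<Rightarrow> 'i \<times> nat \<Rightarrow> 'v set" where
  "edge x p = {x p, x (fst p, Suc (snd p))}"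

definition walk_edges :: "('i \<Rightarrow> nat) \<Rightarrow> ('i \<times> nat \<Rightarrow> 'v) \<Rightarrow> 'i \<Rightarrow> 'v set set" where
  "walk_edges l x i = (\<lambda>t. edge x (i, t)) ` {..<l i}"

definition edges :: "'i set \<Rightarrow> ('i \<Rightarrow> nat) \<Rightarrow> ('i \<times> nat \<Rightarrow> 'v) \<Rightarrow> 'v set set" where
  "edges I l x = edge x ` steps I l"

definition edge_count :: "'i set \<Rightarrow> ('i \<Rightarrow> nat) \<Rightarrow> ('i \<times> nat \<Rightarrow> 'v) \<Rightarrow> 'v set \<Rightarrow> nat" where
  "edge_count I l x e = card {p \<in> steps I l. edge x p = e}"

definition proper :: "'i set \<Rightarrow> ('i \<Rightarrow> nat) \<Rightarrow> ('i \<times> nat \<Rightarrow> 'v) \<Rightarrow> bool" where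
  "proper I l x \<longleftrightarrow> (\<forall>p\<in>steps I l. x p \<noteq> x (fst p, Suc (snd p)))"

definition configs :: "'i set \<Rightarrow> ('i \<Rightarrow> nat) \<Rightarrow> 'v set \<Rightarrow> ('i \<times> nat \<Rightarrow> 'v) set" where
  "configs I l L = {x \<in> points I l \<rightarrow>\<^sub>E L. proper I l x \<and> linked I (walk_edges l x)}"

definition weight :: "(nat \<Rightarrow> 'v set \<Rightarrow> real) \<Rightarrow> 'i set \<Rightarrow> ('i \<Rightarrow> nat) \<Rightarrow> ('i \<times> nat \<Rightarrow> 'v) \<Rightarrow> real" where
  "weight \<phi> I l x = (\<Prod>e\<in>edges I l x. \<phi> (edge_count I l x e) e)"

definition link_sum :: "(nat \<Rightarrow> 'v set \<Rightarrow> real) \<Rightarrow> 'i set \<Rightarrow> ('i \<Rightarrow> nat) \<Rightarrow> 'v set \<Rightarrow> real" where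
  "link_sum \<phi> I l L = (\<Sum>x\<in>configs I l L. weight \<phi> I l x)"

text \<open>The pattern of a configuration records which of its points coincide: every point is sent to a
  representative that depends only on the partition of the points into fibres.\<close>

definition pattern :: "'i set \<Rightarrow> ('i \<Rightarrow> nat) \<Rightarrow> ('i \<times> nat \<Rightarrow> 'v) \<Rightarrow> 'i \<times> nat \<Rightarrow> 'i \<times> nat" where
  "pattern I l x = (\<lambda>p\<in>points I l. SOME p'. p' \<in> points I l \<and> x p' = x p)"

text \<open>The maps that are their own pattern serve as normal forms, one for each partition of the
  points that arises from a configuration.\<close>

definition patterns :: "'i set \<Rightarrow> ('i \<Rightarrow> nat) \<Rightarrow> ('i \<times> nat \<Rightarrow> 'i \<times> nat) set" where
  "patterns I l = {r \<in> configs I l (points I l). pattern I l r = r}"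

abbreviation pat_verts :: "'i set \<Rightarrow> ('i \<Rightarrow> nat) \<Rightarrow> ('i \<times> nat \<Rightarrow> 'i \<times> nat) \<Rightarrow> ('i \<times> nat) set" where
  "pat_verts I l r \<equiv> r ` points I l"

definition embeddings :: "'a set \<Rightarrow> 'v set \<Rightarrow> ('a \<Rightarrow> 'v) set" where
  "embeddings U L = {y \<in> U \<rightarrow>\<^sub>E L. inj_on y U}"

lemma finite_points [simp]: "finite I \<Longrightarrow> finite (points I l)"
  by (simp add: points_def)

lemma finite_steps [simp]: "finite I \<Longrightarrow> finite (steps I l)"
  by (simp add: steps_def)

lemma steps_points: "p \<in> steps I l \<Longrightarrow> p \<in> points I l"
  and steps_points_Suc: "p \<in> steps I l \<Longrightarrow> (fst p, Suc (snd p)) \<in> points I l"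
  by (auto simp: steps_def points_def)

lemma finite_walk_edges [simp]: "finite (walk_edges l x i)"
  by (simp add: walk_edges_def)

lemma card_walk_edges_le: "card (walk_edges l x i) \<le> l i"
  unfolding walk_edges_def using card_image_le[of "{..<l i}"] by simp

lemma edges_UN: "edges I l x = (\<Union>i\<in>I. walk_edges l x i)"
  by (auto simp: edges_def walk_edges_def steps_def)

lemma finite_edges [simp]: "finite I \<Longrightarrow> finite (edges I l x)"
  by (simp add: edges_def)

lemma finite_configs [simp]: "finite I \<Longrightarrow> finite L \<Longrightarrow> finite (configs I l L)"
  unfolding configs_def
  by (rule finite_subset[of _ "points I l \<rightarrow>\<^sub>E L"]) (auto intro: finite_PiE)

lemma finite_patterns [simp]: "finite I \<Longrightarrow> finite (patterns I l)"
  unfolding patterns_def by simp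

lemma finite_embeddings [simp]: "finite U \<Longrightarrow> finite L \<Longrightarrow> finite (embeddings U L)"
  unfolding embeddings_def
  by (rule finite_subset[of _ "U \<rightarrow>\<^sub>E L"]) (auto intro: finite_PiE)

lemma edge_subset: "p \<in> steps I l \<Longrightarrow> edge r p \<subseteq> r ` points I l"
  by (auto simp: edge_def steps_points steps_points_Suc)

lemma edges_subset: "e \<in> edges I l r \<Longrightarrow> e \<subseteq> r ` points I l"
  unfolding edges_def using edge_subset by fastforce

text \<open>Everything here is invariance under an injective renaming \<open>y\<close> of the
  vertices: coincidences of points, and therefore of edges, are the same for \<open>x\<close> and
  for \<open>r\<close>.\<close>

context
  fixes I :: "'i set" and l :: "'i \<Rightarrow> nat" and x :: "'i \<times> nat \<Rightarrow> 'v" and y :: "'a \<Rightarrow> 'v" and r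
  assumes xyr: "\<And>p. p \<in> points I l \<Longrightarrow> x p = y (r p)" and inj: "inj_on y (r ` points I l)"
begin

lemma edge_image: "p \<in> steps I l \<Longrightarrow> edge x p = y ` edge r p"
  by (simp add: edge_def steps_points steps_points_Suc xyr)

lemma edge_eq_iff_inj:
  assumes "p \<in> steps I l" "p' \<in> steps I l"
  shows "edge x p = edge x p' \<longleftrightarrow> edge r p = edge r p'"
  using inj_on_image_eq_iff[OF inj edge_subset edge_subset] assms edge_image by simp

lemma edges_inj: "edges I l x = (`) y ` edges I l r"
  unfolding edges_def image_image using edge_image by (intro image_cong) auto

lemma inj_on_edges: "inj_on ((`) y) (edges I l r)"
  by (meson edges_subset inj inj_on_image_eq_iff inj_onI)

lemma proper_inj: "proper I l x \<longleftrightarrow> proper I l r"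
  unfolding proper_def
proof (intro ball_cong refl)
  fix p assume "p \<in> steps I l"
  then have "p \<in> points I l" "(fst p, Suc (snd p)) \<in> points I l"
    by (auto simp: steps_points steps_points_Suc)
  then show "(x p \<noteq> x (fst p, Suc (snd p))) = (r p \<noteq> r (fst p, Suc (snd p)))"
    using inj by (simp add: xyr inj_on_eq_iff)
qed

lemma walk_edges_inj: "i \<in> I \<Longrightarrow> walk_edges l x i = (`) y ` walk_edges l r i"
  unfolding walk_edges_def image_image
  using edge_image by (intro image_cong) (auto simp: steps_def)

lemma linked_inj: "linked I (walk_edges l x) \<longleftrightarrow> linked I (walk_edges l r)"
proof -
  have *: "(walk_edges l x i \<inter> walk_edges l x j \<noteq> {}) = (walk_edges l r i \<inter> walk_edges l r j \<noteq> {})"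
    if "i \<in> I" "j \<in> I" for i j
  proof -
    have "walk_edges l r i \<subseteq> edges I l r" "walk_edges l r j \<subseteq> edges I l r"
      using that by (auto simp: edges_UN)
    from inj_on_image_Int[OF inj_on_edges this] show ?thesis
      by (metis image_is_empty walk_edges_inj that)
  qed
  have "(\<exists>i\<in>A. \<exists>j\<in>I - A. walk_edges l x i \<inter> walk_edges l x j \<noteq> {})
      = (\<exists>i\<in>A. \<exists>j\<in>I - A. walk_edges l r i \<inter> walk_edges l r j \<noteq> {})" if "A \<noteq> {} \<and> A \<subset> I" for A
  proof (intro bex_cong refl)
    fix i j assume "i \<in> A" "j \<in> I - A"
    then have "i \<in> I" "j \<in> I" using that by auto
    then show "(walk_edges l x i \<inter> walk_edges l x j \<noteq> {}) = (walk_edges l r i \<inter> walk_edges l r j \<noteq> {})"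
      by (rule *)
  qed
  then show ?thesis unfolding linked_def by (intro all_cong1 imp_cong refl)
qed

lemma edge_count_inj:
  assumes "e \<in> edges I l r"
  shows "edge_count I l x (y ` e) = edge_count I l r e"
proof -
  obtain p0 where p0: "p0 \<in> steps I l" "e = edge r p0" using assms by (auto simp: edges_def)
  have "{p \<in> steps I l. edge x p = y ` e} = {p \<in> steps I l. edge r p = e}"
    using edge_eq_iff_inj[OF _ p0(1)] edge_image[OF p0(1)] p0(2) by auto
  then show ?thesis by (simp add: edge_count_def)
qed

lemma weight_inj: "weight \<phi> I l x = (\<Prod>e\<in>edges I l r. \<phi> (edge_count I l r e) (y ` e))"
  unfolding weight_def edges_inj
  by (subst prod.reindex[OF inj_on_edges]) (simp add: edge_count_inj)

end

lemma pattern_props: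
  assumes "p \<in> points I l"
  shows "pattern I l x p \<in> points I l" "x (pattern I l x p) = x p"
proof -
  have "pattern I l x p \<in> points I l \<and> x (pattern I l x p) = x p"
    unfolding pattern_def restrict_apply'[OF assms]
    by (rule someI[of "\<lambda>p'. p' \<in> points I l \<and> x p' = x p" p]) (simp add: assms)
  then show "pattern I l x p \<in> points I l" "x (pattern I l x p) = x p" by auto
qed

lemma pattern_eq_iff:
  assumes "p \<in> points I l" "p' \<in> points I l"
  shows "pattern I l x p = pattern I l x p' \<longleftrightarrow> x p = x p'"
proof
  assume "pattern I l x p = pattern I l x p'"
  then show "x p = x p'"
    using pattern_props(2)[OF assms(1), of x] pattern_props(2)[OF assms(2), of x] by simp
next
  assume "x p = x p'"
  then show "pattern I l x p = pattern I l x p'" using assms by (simp add: pattern_def)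
qed

lemma pattern_cong:
  assumes "\<And>p p'. p \<in> points I l \<Longrightarrow> p' \<in> points I l \<Longrightarrow> x p = x p' \<longleftrightarrow> y p = y p'"
  shows "pattern I l x = pattern I l y"
  unfolding pattern_def
proof (rule restrict_ext)
  fix p assume "p \<in> points I l"
  then have "(\<lambda>p'. p' \<in> points I l \<and> x p' = x p) = (\<lambda>p'. p' \<in> points I l \<and> y p' = y p)"
  proof (intro ext conj_cong refl)
    fix p' assume "p' \<in> points I l"
    then show "(x p' = x p) = (y p' = y p)" using \<open>p \<in> points I l\<close> by (rule assms)
  qed
  then show "(SOME p'. p' \<in> points I l \<and> x p' = x p) = (SOME p'. p' \<in> points I l \<and> y p' = y p)"
    by (simp only:)
qed

lemma inj_on_pattern_verts: "inj_on x (pattern I l x ` points I l)"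
proof (intro inj_onI; elim imageE)
  fix v w p q
  assume *: "x v = x w" "v = pattern I l x p" "p \<in> points I l" "w = pattern I l x q" "q \<in> points I l"
  then have "x p = x q" by (simp add: pattern_props)
  with * show "v = w" by (simp add: pattern_eq_iff)
qed

text \<open>A configuration is the same as its pattern together with an injective labelling of the
  representatives: the pattern decides which points coincide, the labelling where they lie.\<close>

lemma sum_configs:
  fixes I :: "'i set" and L :: "'v set"
  assumes "finite I" "finite L"
  shows "(\<Sum>x\<in>configs I l L. g x) =
    (\<Sum>r\<in>patterns I l. \<Sum>y\<in>embeddings (pat_verts I l r) L. g (restrict (y \<circ> r) (points I l)))"
proof -
  let ?P = "points I l"
  have "(\<Sum>r\<in>patterns I l. \<Sum>y\<in>embeddings (pat_verts I l r) L. g (restrict (y \<circ> r) ?P)) =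
      (\<Sum>(r, y)\<in>(SIGMA r:patterns I l. embeddings (pat_verts I l r) L). g (restrict (y \<circ> r) ?P))"
    using assms by (intro sum.Sigma) auto
  also have "\<dots> = (\<Sum>x\<in>configs I l L. g x)"
  proof (rule sum.reindex_bij_witness[where
        j = "\<lambda>(r, y). restrict (y \<circ> r) ?P" and
        i = "\<lambda>x. (pattern I l x, restrict x (pattern I l x ` ?P))"])
    fix a assume "a \<in> (SIGMA r:patterns I l. embeddings (pat_verts I l r) L)"
    then obtain r y where a: "a = (r, y)" and r: "r \<in> patterns I l" 
      and y: "y \<in> pat_verts I l r \<rightarrow>\<^sub>E L" "inj_on y (pat_verts I l r)"
      by (auto simp: embeddings_def)
    let ?x = "restrict (y \<circ> r) ?P"
    have xyr: "?x p = y (r p)" if "p \<in> ?P" for p using that by simp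
    have "r p = r p' \<longleftrightarrow> ?x p = ?x p'" if "p \<in> ?P" "p' \<in> ?P" for p p'
      using that y(2) by (simp add: inj_on_eq_iff)
    then have pat: "pattern I l ?x = r"
      using pattern_cong[of I l r ?x] r by (simp add: patterns_def)
    have "restrict ?x (r ` ?P) = y"
    proof
      fix v show "restrict ?x (r ` ?P) v = y v"
      proof (cases "v \<in> r ` ?P")
        case True
        then obtain p where p: "p \<in> ?P" "v = r p" by auto
        have "r p \<in> ?P" using r p by (auto simp: patterns_def configs_def)
        \<comment> \<open>Representatives represent themselves, so the labelling is recovered from
          its values at them.\<close>
        moreover have "r (r p) = r p"
          using pattern_props(2)[OF p(1), of r] r by (simp add: patterns_def)
        ultimately show ?thesis using True p by simp
      qed (use y(1) in auto)
    qed
    with pat show "(case (case a of (r, y) \<Rightarrow> restrict (y \<circ> r) ?P) of x \<Rightarrow>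
        (pattern I l x, restrict x (pattern I l x ` ?P))) = a"
      by (simp add: a)
    have "?x \<in> ?P \<rightarrow>\<^sub>E L" using y(1) by auto
    moreover have "proper I l ?x" "linked I (walk_edges l ?x)"
      using proper_inj[where I = I and l = l and x = ?x and y = y and r = r, OF xyr y(2)]
        linked_inj[where I = I and l = l and x = ?x and y = y and r = r, OF xyr y(2)] r by (auto simp: patterns_def configs_def)
    ultimately show "(case a of (r, y) \<Rightarrow> restrict (y \<circ> r) ?P) \<in> configs I l L"
      by (simp add: a configs_def)
  next
    fix x assume x: "x \<in> configs I l L"
    let ?r = "pattern I l x" 
    let ?y = "restrict x (?r ` ?P)"
    have rP: "?r ` ?P \<subseteq> ?P" by (intro image_subsetI pattern_props)
    have eq: "restrict (?y \<circ> ?r) ?P = x"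
    proof
      fix p show "restrict (?y \<circ> ?r) ?P p = x p"
        using x pattern_props[of p I l x] by (cases "p \<in> ?P") (auto simp: configs_def)
    qed
    then show "(case (?r, ?y) of (r, y) \<Rightarrow> restrict (y \<circ> r) ?P) = x" by simp
    have xyr: "x p = ?y (?r p)" if "p \<in> ?P" for p
      using that pattern_props[OF that, of x] by simp
    have inj: "inj_on ?y (?r ` ?P)"
      using inj_on_pattern_verts by (simp add: inj_on_restrict_eq)
    have "pattern I l ?r = ?r"
      by (rule pattern_cong) (simp add: pattern_eq_iff)
    moreover have "?r \<in> ?P \<rightarrow>\<^sub>E ?P"
      by (rule PiE_I, rule pattern_props(1), assumption) (simp add: pattern_def)
    ultimately have "?r \<in> patterns I l"
      using x proper_inj[where I = I and l = l and x = x and y = ?y and r = ?r, OF xyr inj]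
        linked_inj[where I = I and l = l and x = x and y = ?y and r = ?r, OF xyr inj]
      by (simp add: patterns_def configs_def)
    moreover have "?y \<in> embeddings (?r ` ?P) L"
    proof -
      have "x \<in> ?P \<rightarrow>\<^sub>E L" using x by (simp add: configs_def)
      then have "?y \<in> ?r ` ?P \<rightarrow>\<^sub>E L" using rP by (intro restrict_PiE_iff[THEN iffD2] ballI) (auto dest: PiE_mem)
      then show ?thesis using inj by (simp add: embeddings_def)
    qed
    ultimately show "(?r, ?y) \<in> (SIGMA r:patterns I l. embeddings (pat_verts I l r) L)" by simp
  qed auto
  finally show ?thesis ..
qed

lemma link_sum_patterns:
  assumes "finite I" "finite L"
  shows "link_sum \<phi> I l L =
    (\<Sum>r\<in>patterns I l. \<Sum>y\<in>embeddings (pat_verts I l r) L. \<Prod>e\<in>edges I l r. \<phi> (edge_count I l r e) (y ` e))"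
  unfolding link_sum_def sum_configs[OF assms]
proof (intro sum.cong refl)
  fix r y assume "y \<in> embeddings (pat_verts I l r) L"
  then show "weight \<phi> I l (restrict (y \<circ> r) (points I l)) = (\<Prod>e\<in>edges I l r. \<phi> (edge_count I l r e) (y ` e))"
    by (intro weight_inj) (auto simp: embeddings_def)
qed

section \<open>Trees and the homogeneous model\<close>

text \<open>Trees are generated by attaching leaves, so that sums over the positions of the vertices
  can be evaluated one leaf at a time.\<close>

inductive utree :: "'a set \<Rightarrow> 'a set set \<Rightarrow> bool" where
  singleton: "utree {v} {}"
| extend: "utree U E \<Longrightarrow> u \<in> U \<Longrightarrow> v \<notin> U \<Longrightarrow> utree (insert v U) (insert {u, v} E)"

lemma utree_props:
  assumes "utree U E"
  shows "finite U" "U \<noteq> {}" "finite E" "\<And>e. e \<in> E \<Longrightarrow> e \<subseteq> U" "card U = Suc (card E)"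
  using assms
proof (induction rule: utree.induct)
  case (extend U E u v)
  { case 5
    have "{u, v} \<notin> E" using extend by auto
    then show ?case using extend by simp }
qed auto

lemma image_pointsE:
  assumes "v \<in> x ` points I l"
  obtains i t where "i \<in> I" "t \<le> l i" "v = x (i, t)"
proof -
  from assms obtain p where p: "p \<in> points I l" "v = x p" by (elim imageE)
  then show ?thesis using that[of "fst p" "snd p"] by (simp add: points_def mem_Sigma_iff [of "fst p" "snd p", simplified])
qed

text \<open>A largest tree made of configuration edges spans: if no step left its vertex set, each
  walk would lie entirely inside or outside, while linkedness forces some walk inside to share an
  edge with one outside.\<close>

lemma spanning_tree:
  fixes x :: "'i \<times> nat \<Rightarrow> 'v"
  assumes fin: "finite I" and "I \<noteq> {}" and lk: "linked I (walk_edges l x)"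
    and l: "\<forall>i\<in>I. 1 \<le> l i"
  obtains E where "utree (x ` points I l) E" "E \<subseteq> edges I l x"
proof -
  define X where "X = x ` points I l"
  have finX: "finite X" using fin by (simp add: X_def)
  define P where "P = (\<lambda>(U, E). utree U E \<and> U \<subseteq> X \<and> E \<subseteq> edges I l x)"
  obtain i0 where "i0 \<in> I" using \<open>I \<noteq> {}\<close> by auto
  then have "x (i0, 0) \<in> X" by (auto simp: X_def points_def)
  then have P0: "P ({x (i0, 0)}, {})" by (auto simp: P_def utree.singleton)
  have "\<forall>a. P a \<longrightarrow> card (fst a) < Suc (card X)"
    using finX by (auto simp: P_def less_Suc_eq_le intro: card_mono)
  from ex_has_greatest_nat[of P, OF P0 this] obtain a where
    a: "P a \<and> (\<forall>b. P b \<longrightarrow> card (fst b) \<le> card (fst a))" by (elim exE)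
  obtain U E where "a = (U, E)" by (cases a)
  with a have UE: "utree U E" "U \<subseteq> X" "E \<subseteq> edges I l x"
    and max: "\<And>U' E'. P (U', E') \<Longrightarrow> card U' \<le> card U"
    by (auto simp: P_def)
  have "U = X"
  proof (rule ccontr)
    assume ne: "U \<noteq> X"
    have "\<exists>p\<in>steps I l. (x p \<in> U) \<noteq> (x (fst p, Suc (snd p)) \<in> U)"
    proof (rule ccontr)
      assume "\<not> ?thesis"
      then have step: "x (i, t) \<in> U \<longleftrightarrow> x (i, Suc t) \<in> U" if "i \<in> I" "t < l i" for i t
        using that by (force simp: steps_def)
      have walk: "x (i, t) \<in> U \<longleftrightarrow> x (i, 0) \<in> U" if "i \<in> I" "t \<le> l i" for i t
        using that(2) by (induction t) (use step[OF that(1)] in auto)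
      define A where "A = {i\<in>I. x (i, 0) \<in> U}"
      obtain v where "v \<in> U" using utree_props(2)[OF UE(1)] by auto
      then have "v \<in> x ` points I l" using UE(2) by (auto simp: X_def)
      then obtain i t where it: "i \<in> I" "t \<le> l i" "v = x (i, t)" by (rule image_pointsE)
      then have "i \<in> A" using walk[OF it(1,2)] \<open>v \<in> U\<close> by (simp add: A_def)
      then have "A \<noteq> {}" by auto
      obtain w where "w \<in> X" "w \<notin> U" using ne UE(2) by auto
      then have "w \<in> x ` points I l" by (simp add: X_def)
      then obtain j t where jt: "j \<in> I" "t \<le> l j" "w = x (j, t)" by (rule image_pointsE)
      then have "j \<in> I - A" using walk[OF jt(1,2)] \<open>w \<notin> U\<close> by (simp add: A_def)
      then have "A \<subset> I" by (auto simp: A_def)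
      from lk \<open>A \<noteq> {}\<close> this obtain i j where ij: "i \<in> A" "j \<in> I - A"
        and sh: "walk_edges l x i \<inter> walk_edges l x j \<noteq> {}" by (rule linkedD)
      then obtain e where "e \<in> walk_edges l x i" "e \<in> walk_edges l x j" by auto
      then obtain t t' where t: "t < l i" "t' < l j" "edge x (i, t) = edge x (j, t')"
        unfolding walk_edges_def by (elim imageE) (simp add: that)
      have "x (i, t) \<in> U" using walk[of i t] ij t by (auto simp: A_def)
      moreover have "x (j, t') \<notin> U" "x (j, Suc t') \<notin> U"
        using walk[of j t'] walk[of j "Suc t'"] ij t by (auto simp: A_def)
      ultimately show False using t(3) by (auto simp: edge_def doubleton_eq_iff)
    qed
    then obtain p where p: "p \<in> steps I l" "(x p \<in> U) \<noteq> (x (fst p, Suc (snd p)) \<in> U)" by auto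
    then obtain u v where uv: "edge x p = {u, v}" "u \<in> U" "v \<notin> U"
      by (cases "x p \<in> U") (auto simp: edge_def insert_commute)
    have "v \<in> X" using edge_subset[OF p(1), of x] uv(1) by (auto simp: X_def)
    moreover have "edge x p \<in> edges I l x" using p(1) by (auto simp: edges_def)
    ultimately have "P (insert v U, insert {u, v} E)"
      using UE utree.extend[OF UE(1) uv(2,3)] uv(1) by (simp add: P_def)
    from max[OF this] show False using utree_props(1)[OF UE(1)] uv(3) by simp
  qed
  with UE that show ?thesis by (simp add: X_def)
qed

lemma card_verts_le:
  assumes "finite I" "I \<noteq> {}" "linked I (walk_edges l x)" "\<forall>i\<in>I. 1 \<le> l i"
  shows "card (x ` points I l) \<le> Suc (card (edges I l x))"
proof -
  obtain E where E: "utree (x ` points I l) E" "E \<subseteq> edges I l x"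
    using spanning_tree[OF assms] .
  then show ?thesis
    using utree_props(5)[OF E(1)] card_mono[OF finite_edges[OF assms(1)] E(2)] by simp
qed

text \<open>The largest possible number of distinct edges of a linked configuration: every walk but
  one has to reuse an edge.\<close>

definition top_edges :: "'i set \<Rightarrow> ('i \<Rightarrow> nat) \<Rightarrow> nat" where
  "top_edges I l = Suc (\<Sum>i\<in>I. l i - 1)"

lemma card_edges_le:
  assumes "finite I" "I \<noteq> {}" "linked I (walk_edges l x)" "\<forall>i\<in>I. 1 \<le> l i"
  shows "card (edges I l x) \<le> top_edges I l"
proof -
  have "card (edges I l x) + card I \<le> (\<Sum>i\<in>I. l i) + 1"
    unfolding edges_UN using assms by (intro card_UN_linked_le card_walk_edges_le) auto
  moreover have "(\<Sum>i\<in>I. l i) = (\<Sum>i\<in>I. (l i - 1) + 1)"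
  proof (intro sum.cong refl)
    fix i assume "i \<in> I"
    from bspec[OF assms(4) this] show "l i = l i - 1 + 1" by simp
  qed
  ultimately show ?thesis by (simp add: top_edges_def sum_Suc)
qed

lemma card_verts_ge_2:
  assumes "finite I" "I \<noteq> {}" "proper I l x" "\<forall>i\<in>I. 1 \<le> l i"
  shows "2 \<le> card (x ` points I l)"
proof -
  obtain i where i: "i \<in> I" using assms by auto
  then have "l i \<ge> 1" using assms(4) by simp
  then have "x (i, 0) \<noteq> x (i, Suc 0)"
    using assms(3) i unfolding proper_def steps_def by (auto dest: bspec[of _ _ "(i, 0)"])
  then have "card {x (i, 0), x (i, Suc 0)} = 2" by simp
  moreover have "{x (i, 0), x (i, Suc 0)} \<subseteq> x ` points I l"
    using i \<open>l i \<ge> 1\<close> by (auto simp: points_def)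
  ultimately show ?thesis using card_mono[of "x ` points I l"] assms(1) by (metis finite_imageI finite_points)
qed

lemma patternsD:
  assumes "r \<in> patterns I l"
  shows "proper I l r" "linked I (walk_edges l r)"
  using assms by (auto simp: patterns_def configs_def)

section \<open>Leading order of the sums over complete graphs\<close>

lemma card_embeddings_limit:
  assumes "finite U"
  shows "(\<lambda>N. real (card (embeddings U {..<N})) / real N ^ card U) \<longlonglongrightarrow> 1"
proof -
  let ?m = "card U"
  have "eventually (\<lambda>N. real (card (embeddings U {..<N})) / real N ^ ?m =
      (\<Prod>i<?m. 1 - real i / real N)) sequentially"
    using eventually_ge_at_top[of ?m] eventually_gt_at_top[of 0]
  proof eventually_elim
    case (elim N)
    have "card (embeddings U {..<N}) = (\<Prod>i<?m. N - i)"
      unfolding embeddings_def using card_inj_on_subset_funcset[OF assms, of "{..<N}" U]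
      by (simp add: atLeast0LessThan)
    then have "real (card (embeddings U {..<N})) = (\<Prod>i<?m. real (N - i))" by simp
    also have "\<dots> = (\<Prod>i<?m. real N - real i)"
      using elim by (intro prod.cong) (auto simp: of_nat_diff)
    also have "\<dots> = (\<Prod>i<?m. real N * (1 - real i / real N))"
      using elim by (intro prod.cong) (auto simp: field_simps)
    finally show ?case using elim by (simp add: prod.distrib)
  qed
  moreover have "(\<lambda>N. \<Prod>i<?m. 1 - real i / real N) \<longlonglongrightarrow> (\<Prod>i<?m. 1 - 0)"
    by (intro tendsto_prod tendsto_diff tendsto_const lim_const_over_n)
  ultimately show ?thesis by (simp add: tendsto_cong)
qed

text \<open>There is at most one vertex more than edges, and there are at most
  \<open>top_edges I l\<close> edges, so the condition on the vertices selects exactly the trees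
  with the maximal number of edges.\<close>

definition lead_sum :: "(nat \<Rightarrow> real) \<Rightarrow> 'i set \<Rightarrow> ('i \<Rightarrow> nat) \<Rightarrow> real" where
  "lead_sum V I l = (\<Sum>r | r \<in> patterns I l \<and> card (pat_verts I l r) = Suc (top_edges I l).
     \<Prod>e\<in>edges I l r. V (edge_count I l r e))"

abbreviation mean_field :: "(nat \<Rightarrow> real) \<Rightarrow> 'i set \<Rightarrow> ('i \<Rightarrow> nat) \<Rightarrow> nat \<Rightarrow> real" where
  "mean_field V I l N \<equiv> link_sum (\<lambda>m _. V m) I l {..<N}"

text \<open>A pattern with v vertices has about N^v embeddings into N sites. Hence
  \<open>lead_sum\<close>, a sum over patterns only, is the leading coefficient of a sum with full
  vertex symmetry, and can be computed there.\<close>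

lemma mean_field_limit:
  assumes "finite I" "I \<noteq> {}" "\<forall>i\<in>I. 1 \<le> l i"
  shows "(\<lambda>N. mean_field V I l N / real N ^ Suc (top_edges I l)) \<longlonglongrightarrow> lead_sum V I l"
proof -
  let ?n = "Suc (top_edges I l)"
  let ?w = "\<lambda>r. \<Prod>e\<in>edges I l r. V (edge_count I l r e)"
  have "mean_field V I l N / real N ^ ?n = (\<Sum>r\<in>patterns I l. ?w r *
      (real (card (embeddings (pat_verts I l r) {..<N})) / real N ^ ?n))" for N
    using assms(1) by (simp add: link_sum_patterns sum_divide_distrib mult.commute)
  moreover have "(\<lambda>N. \<Sum>r\<in>patterns I l. ?w r *
      (real (card (embeddings (pat_verts I l r) {..<N})) / real N ^ ?n)) \<longlonglongrightarrow>
      (\<Sum>r\<in>patterns I l. ?w r * (if card (pat_verts I l r) = ?n then 1 else 0))"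
  proof (intro tendsto_sum tendsto_mult tendsto_const)
    fix r assume r: "r \<in> patterns I l"
    let ?m = "card (pat_verts I l r)"
    have "?m \<le> ?n"
      using card_verts_le[OF assms(1,2) patternsD(2)[OF r] assms(3)]
        card_edges_le[OF assms(1,2) patternsD(2)[OF r] assms(3)] by auto
    have fin: "finite (pat_verts I l r)" using assms by simp
    have "(\<lambda>N. real (card (embeddings (pat_verts I l r) {..<N})) / real N ^ ?m * (1 / real N) ^ (?n - ?m))
       \<longlonglongrightarrow> 1 * 0 ^ (?n - ?m)"
      by (intro tendsto_mult card_embeddings_limit[OF fin] tendsto_power lim_const_over_n)
    moreover have "eventually (\<lambda>N. real (card (embeddings (pat_verts I l r) {..<N})) / real N ^ ?m *
        (1 / real N) ^ (?n - ?m) = real (card (embeddings (pat_verts I l r) {..<N})) / real N ^ ?n) sequentially"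
      using eventually_gt_at_top[of 0]
    proof eventually_elim
      case (elim N)
      have "real N ^ ?n = real N ^ ?m * real N ^ (?n - ?m)"
        using \<open>?m \<le> ?n\<close> by (simp flip: power_add)
      then show ?case using elim by (simp add: power_divide)
    qed
    moreover have "1 * 0 ^ (?n - ?m) = (if ?m = ?n then 1 else (0::real))"
      using \<open>?m \<le> ?n\<close> by auto
    ultimately show "(\<lambda>N. real (card (embeddings (pat_verts I l r) {..<N})) / real N ^ ?n)
      \<longlonglongrightarrow> (if ?m = ?n then 1 else 0)"
      by (simp only: tendsto_cong)
  qed
  moreover have "(\<Sum>r\<in>patterns I l. ?w r * (if card (pat_verts I l r) = ?n then 1 else 0)) = lead_sum V I l"
    unfolding lead_sum_def using assms(1) by (intro sum.mono_neutral_cong_right) auto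
  ultimately show ?thesis by simp
qed

text \<open>On two vertices there is a single edge; every walk alternates, so a configuration
  amounts to the choice of a starting vertex for each walk, and linking is automatic.\<close>

lemma link_sum_two_vertices:
  assumes "finite I" "I \<noteq> {}" and l: "\<forall>i\<in>I. 1 \<le> l i"
  shows "mean_field V I l 2 = 2 ^ card I * V (\<Sum>i\<in>I. l i)"
proof -
  have edge: "edge x p = {0, 1}" if "p \<in> steps I l" "proper I l x" "x \<in> points I l \<rightarrow>\<^sub>E {..<2}"
    for x :: "'a \<times> nat \<Rightarrow> nat" and p
  proof -
    have "x p < 2" "x (fst p, Suc (snd p)) < 2" "x p \<noteq> x (fst p, Suc (snd p))"
      using that steps_points[OF that(1)] steps_points_Suc[OF that(1)] unfolding proper_def
      by (auto simp: PiE_iff)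
    then show ?thesis unfolding edge_def by auto
  qed
  have ex: "\<exists>p. p \<in> steps I l"
  proof -
    obtain i where "i \<in> I" using assms(2) by auto
    then have "(i, 0) \<in> steps I l" using l by (auto simp: steps_def)
    then show ?thesis by blast
  qed
  have edges: "edges I l x = {{0, 1::nat}}" if "proper I l x" "x \<in> points I l \<rightarrow>\<^sub>E {..<2}"
    for x :: "'a \<times> nat \<Rightarrow> nat"
    using edge[OF _ that] ex by (auto simp: edges_def)
  have "weight (\<lambda>m _. V m) I l x = V (\<Sum>i\<in>I. l i)" if "x \<in> configs I l {..<2}"
    for x :: "'a \<times> nat \<Rightarrow> nat"
  proof -
    have x: "proper I l x" "x \<in> points I l \<rightarrow>\<^sub>E {..<2}" using that by (auto simp: configs_def)
    have "{p \<in> steps I l. edge x p = {0, 1}} = steps I l" using edge[OF _ x] by auto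
    then have "edge_count I l x {0, 1} = (\<Sum>i\<in>I. l i)"
      using assms(1) by (simp add: edge_count_def steps_def)
    then show ?thesis by (simp add: weight_def edges[OF x])
  qed
  then have "mean_field V I l 2 = card (configs I l {..<2::nat}) * V (\<Sum>i\<in>I. l i)"
    by (simp add: link_sum_def)
  also have "card (configs I l {..<2::nat}) = card (I \<rightarrow>\<^sub>E {..<2::nat})"
  proof (rule bij_betw_same_card)
    define f where "f x = (\<lambda>i\<in>I. x (i, 0::nat) :: nat)" for x
    \<comment> \<open>The parity of the time determines the walk that starts at
      \<open>s i\<close>.\<close>
    define g where "g s = (\<lambda>(i, t)\<in>points I l. (s i + t) mod 2 :: nat)" for s
    show "bij_betw f (configs I l {..<2}) (I \<rightarrow>\<^sub>E {..<2})"
    proof (rule bij_betw_byWitness[where f' = g])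
      show "\<forall>x\<in>configs I l {..<2}. g (f x) = x"
      proof
        fix x assume x: "x \<in> configs I l {..<2::nat}"
        have lt: "x (i, t) < 2" if "i \<in> I" "t \<le> l i" for i t
          using x that by (auto simp: configs_def points_def PiE_iff)
        have ne: "x (i, t) \<noteq> x (i, Suc t)" if "i \<in> I" "t < l i" for i t
          using x that by (auto simp: configs_def proper_def steps_def dest: bspec[of _ _ "(i, t)"])
        have "(x (i, 0) + t) mod 2 = x (i, t)" if "i \<in> I" "t \<le> l i" for i t
          using that(2)
        proof (induction t)
          case 0 then show ?case using lt[OF that(1), of 0] by simp
        next
          case (Suc t)
          then have "(x (i, 0) + Suc t) mod 2 = (x (i, t) + 1) mod 2"
            by (metis Suc_eq_plus1 Suc_leD add.assoc mod_add_left_eq)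
          also have "\<dots> = x (i, Suc t)"
            using lt[OF that(1), of t] lt[OF that(1), of "Suc t"] ne[OF that(1), of t] Suc.prems
            by (auto simp: less_2_cases_iff)
          finally show ?case .
        qed
        moreover have "x p = undefined" if "p \<notin> points I l" for p
        proof -
          have "x \<in> points I l \<rightarrow>\<^sub>E {..<2}" using x by (simp add: configs_def)
          then show ?thesis using that by (rule PiE_arb)
        qed
        ultimately show "g (f x) = x"
          by (auto simp: g_def f_def points_def)
      qed
      show "\<forall>s\<in>I \<rightarrow>\<^sub>E {..<2}. f (g s) = s"
        by (auto simp: f_def g_def points_def PiE_iff extensional_def fun_eq_iff)
      show "f ` configs I l {..<2} \<subseteq> I \<rightarrow>\<^sub>E {..<2}"
        by (auto simp: f_def configs_def points_def PiE_iff)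
      show "g ` (I \<rightarrow>\<^sub>E {..<2}) \<subseteq> configs I l {..<2}"
      proof (intro image_subsetI)
        fix s assume s: "s \<in> I \<rightarrow>\<^sub>E {..<2::nat}"
        have P: "g s \<in> points I l \<rightarrow>\<^sub>E {..<2}" by (auto simp: g_def)
        have "(s i + t) mod 2 \<noteq> Suc (s i + t) mod 2" for i t by presburger
        then have pr: "proper I l (g s)" 
          by (auto simp: proper_def g_def steps_def points_def)
        have we: "{0, 1} \<in> walk_edges l (g s) i" if "i \<in> I" for i
        proof -
          have "(i, 0) \<in> steps I l" using that l by (auto simp: steps_def)
          from this pr P have "edge (g s) (i, 0) = {0, 1}" by (rule edge)
          then show ?thesis
            unfolding walk_edges_def by (intro image_eqI[of _ _ 0]) (use l that in auto)
        qed
        have "linked I (walk_edges l (g s))"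
          unfolding linked_def
        proof (intro allI impI)
          fix A assume A: "A \<noteq> {} \<and> A \<subset> I"
          then obtain i j where ij: "i \<in> A" "j \<in> I - A" by auto
          then have "{0, 1} \<in> walk_edges l (g s) i \<inter> walk_edges l (g s) j" using we A by auto
          then have "walk_edges l (g s) i \<inter> walk_edges l (g s) j \<noteq> {}" by auto
          then show "\<exists>i\<in>A. \<exists>j\<in>I - A. walk_edges l (g s) i \<inter> walk_edges l (g s) j \<noteq> {}"
            using ij by (intro bexI)
        qed
        with P pr show "g s \<in> configs I l {..<2}" by (simp add: configs_def)
      qed
    qed
  qed
  also have "\<dots> = 2 ^ card I" using assms(1) by (simp add: card_PiE)
  finally show ?thesis by simp
qed

text \<open>The two-vertex configurations are counted by patterns instead: a pattern with two
  vertices has two embeddings into two sites and a larger one has none, which accounts for the lower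
  power of 2. The result is the value in the dilute regime and the base case for the closed form of
  \<open>lead_sum\<close>.\<close>

lemma sum_two_vertex_patterns:
  fixes V :: "nat \<Rightarrow> real"
  assumes "finite I" "I \<noteq> {}" "\<forall>i\<in>I. 1 \<le> l i"
  shows "(\<Sum>r | r \<in> patterns I l \<and> card (pat_verts I l r) = 2. \<Prod>e\<in>edges I l r. V (edge_count I l r e))
    = 2 ^ (card I - 1) * V (\<Sum>i\<in>I. l i)"
proof -
  let ?w = "\<lambda>r. \<Prod>e\<in>edges I l r. V (edge_count I l r e)"
  let ?S = "{r. r \<in> patterns I l \<and> card (pat_verts I l r) = 2}"
  have c: "card (embeddings U {..<2::nat}) = (if card U = 2 then 2 else 0)"
    if "finite U" "card U \<ge> 2" for U :: "('a \<times> nat) set"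
  proof (cases "card U = 2")
    case True
    then show ?thesis
      unfolding embeddings_def using card_inj_on_subset_funcset[OF that(1), of "{..<2::nat}" U]
      by (simp add: numeral_2_eq_2)
  next
    case False
    have "y \<notin> embeddings U {..<2::nat}" for y
    proof
      assume "y \<in> embeddings U {..<2::nat}"
      then have "inj_on y U" "y ` U \<subseteq> {..<2}" by (auto simp: embeddings_def)
      then have "card U \<le> card {..<2::nat}" by (intro card_inj_on_le) auto
      with False that show False by simp
    qed
    then have "embeddings U {..<2::nat} = {}" by auto
    then show ?thesis using False by simp
  qed
  have "2 ^ card I * V (\<Sum>i\<in>I. l i) = (\<Sum>r\<in>patterns I l. ?w r * card (embeddings (pat_verts I l r) {..<2::nat}))"
    using link_sum_two_vertices[OF assms, where V = V] assms(1) by (simp add: link_sum_patterns mult.commute)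
  also have "\<dots> = (\<Sum>r\<in>?S. ?w r * 2)"
  proof (rule sum.mono_neutral_cong_right)
    fix r assume "r \<in> ?S"
    then show "?w r * card (embeddings (pat_verts I l r) {..<2::nat}) = ?w r * 2"
      using c[of "pat_verts I l r"] assms(1) by simp
  next
    show "\<forall>r\<in>patterns I l - ?S. ?w r * card (embeddings (pat_verts I l r) {..<2::nat}) = 0"
    proof
      fix r assume r: "r \<in> patterns I l - ?S"
      then have "2 \<le> card (pat_verts I l r)"
        using card_verts_ge_2[OF assms(1,2) patternsD(1)[of r I l] assms(3)] by auto
      then show "?w r * card (embeddings (pat_verts I l r) {..<2::nat}) = 0"
        using c[of "pat_verts I l r"] r assms(1) by simp
    qed
  qed (use assms in auto)
  finally have "2 * (\<Sum>r\<in>?S. ?w r) = 2 ^ card I * V (\<Sum>i\<in>I. l i)"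
    by (simp add: sum_distrib_left mult.commute)
  moreover obtain m where "card I = Suc m" using assms(1,2) by (cases "card I") auto
  ultimately show ?thesis by simp
qed

section \<open>Splitting a walk\<close>

lemma configs_permute:
  assumes \<sigma>: "bij_betw \<sigma> L L" and x: "x \<in> configs I l L"
  shows "restrict (\<sigma> \<circ> x) (points I l) \<in> configs I l L"
    and "weight (\<lambda>m _. V m) I l (restrict (\<sigma> \<circ> x) (points I l)) = weight (\<lambda>m _. V m) I l x"
proof -
  let ?x = "restrict (\<sigma> \<circ> x) (points I l)"
  have xL: "x ` points I l \<subseteq> L" using x by (auto simp: configs_def)
  have inj: "inj_on \<sigma> (x ` points I l)" using \<sigma> xL by (auto simp: bij_betw_def intro: inj_on_subset)
  have eq: "?x p = \<sigma> (x p)" if "p \<in> points I l" for p using that by simp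
  have "?x \<in> points I l \<rightarrow>\<^sub>E L"
    using \<sigma> xL by (intro restrict_PiE_iff[THEN iffD2] ballI) (auto simp: bij_betw_def)
  then show "?x \<in> configs I l L"
    using x proper_inj[where I = I and l = l and x = ?x and y = \<sigma> and r = x, OF eq inj]
      linked_inj[where I = I and l = l and x = ?x and y = \<sigma> and r = x, OF eq inj]
    by (simp add: configs_def)
  show "weight (\<lambda>m _. V m) I l ?x = weight (\<lambda>m _. V m) I l x"
    using weight_inj[where I = I and l = l and r = x and y = \<sigma> and x = ?x, OF eq inj]
    by (simp add: weight_def)
qed

text \<open>Transposing two vertices preserves configurations and weights, so all N positions of a
  given point carry the same sum.\<close>

lemma mean_field_pinned:
  fixes I :: "'i set"
  assumes "finite I" and p: "p \<in> points I l" and v: "v < N"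
  shows "real N * (\<Sum>x | x \<in> configs I l {..<N} \<and> x p = v. weight (\<lambda>m _. V m) I l x) = mean_field V I l N"
proof -
  let ?C = "configs I l {..<N}" and ?w = "weight (\<lambda>m _. V m) I l :: ('i \<times> nat \<Rightarrow> nat) \<Rightarrow> real"
  have eq: "(\<Sum>x | x \<in> ?C \<and> x p = u. ?w x) = (\<Sum>x | x \<in> ?C \<and> x p = v. ?w x)" if "u < N" for u
  proof -
    define \<sigma> where "\<sigma> = Transposition.transpose u v"
    have inv: "\<sigma> (\<sigma> w) = w" for w by (simp add: \<sigma>_def)
    have \<sigma>: "bij_betw \<sigma> {..<N} {..<N}"
    proof (rule bij_betw_byWitness[where f' = \<sigma>])
      show "\<sigma> ` {..<N} \<subseteq> {..<N}"
        using that v by (auto simp: \<sigma>_def Transposition.transpose_def)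
      then show "\<sigma> ` {..<N} \<subseteq> {..<N}" .
    qed (simp_all add: inv)
    let ?f = "\<lambda>x. restrict (\<sigma> \<circ> x) (points I l)"
    have ff: "?f (?f x) = x" if "x \<in> ?C" for x
    proof
      have x: "x \<in> points I l \<rightarrow>\<^sub>E {..<N}" using that by (simp add: configs_def)
      fix p' show "?f (?f x) p' = x p'"
        using PiE_arb[OF x, of p'] by (cases "p' \<in> points I l") (simp_all add: inv)
    qed
    have fp: "?f x p = \<sigma> (x p)" for x using p by simp
    have \<sigma>uv: "\<sigma> u = v" "\<sigma> v = u" by (simp_all add: \<sigma>_def)
    show ?thesis
      by (rule sum.reindex_bij_witness[of _ ?f ?f])
        (use ff fp \<sigma>uv configs_permute[OF \<sigma>] in auto)
  qed
  have "mean_field V I l N = (\<Sum>u<N. \<Sum>x | x \<in> ?C \<and> x p = u. ?w x)"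
    unfolding link_sum_def
  proof (rule sum.group[symmetric])
    show "(\<lambda>x. x p) ` ?C \<subseteq> {..<N}" using p by (auto simp: configs_def)
  qed (use assms in auto)
  also have "\<dots> = (\<Sum>u<N. \<Sum>x | x \<in> ?C \<and> x p = v. ?w x)"
    by (intro sum.cong refl eq) auto
  finally show ?thesis by simp
qed

text \<open>A cut that avoids \<rho> meets \<open>A\<close> or its complement in \<open>I\<close>,
  and linkedness of the corresponding piece already supplies a crossing pair.\<close>

lemma linked_join:
  assumes S: "\<And>i. i \<in> I \<Longrightarrow> S0 i = S i" "\<And>i. i \<in> I \<Longrightarrow> S1 i = S i" "S \<rho> = S0 \<rho> \<union> S1 \<rho>"
    and \<rho>: "\<rho> \<notin> I" and A: "A \<subseteq> I"
    and l0: "linked (insert \<rho> A) S0" and l1: "linked (insert \<rho> (I - A)) S1"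
  shows "linked (insert \<rho> I) S"
proof (rule linkedI_root[of \<rho>])
  fix C assume C: "C \<noteq> {}" "C \<subseteq> insert \<rho> I" "\<rho> \<notin> C"
  have key: "\<exists>i\<in>C. \<exists>j\<in>insert \<rho> I - C. S i \<inter> S j \<noteq> {}"
    if lk: "linked (insert \<rho> B) S'" and S': "\<And>i. i \<in> I \<Longrightarrow> S' i = S i" "S' \<rho> \<subseteq> S \<rho>"
      and "C \<inter> B \<noteq> {}" "B \<subseteq> I" for B S'
  proof -
    have "C \<inter> B \<subset> insert \<rho> B" using C \<rho> by auto
    from lk \<open>C \<inter> B \<noteq> {}\<close> this obtain i j where ij: "i \<in> C \<inter> B" "j \<in> insert \<rho> B - C \<inter> B"
      and ne: "S' i \<inter> S' j \<noteq> {}" by (rule linkedD)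
    have "S' j \<subseteq> S j" using S' ij \<open>B \<subseteq> I\<close> by auto
    moreover have "S' i = S i" using S' ij \<open>B \<subseteq> I\<close> by auto
    ultimately have "S i \<inter> S j \<noteq> {}" using ne by auto
    then show ?thesis by (rule_tac bexI[of _ i], rule_tac bexI[of _ j]) (use ij C \<open>B \<subseteq> I\<close> in auto)
  qed
  show "\<exists>i\<in>C. \<exists>j\<in>insert \<rho> I - C. S i \<inter> S j \<noteq> {}"
  proof (cases "C \<inter> A = {}")
    case True
    then have "C \<inter> (I - A) \<noteq> {}" using C by auto
    show ?thesis
      by (rule key[OF l1]) (use S \<open>C \<inter> (I - A) \<noteq> {}\<close> in auto)
  next
    case False
    show ?thesis by (rule key[OF l0]) (use S A False in auto)
  qed
qed simp

text \<open>\<open>A\<close> is chosen as a largest set of walks linked to \<rho> through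
  \<open>S0\<close>. By maximality no remaining walk touches \<rho> or \<open>A\<close> there, so
  the remaining walks must be linked to \<rho> through \<open>S1\<close>.\<close>

lemma linked_split:
  assumes S: "\<And>i. i \<in> I \<Longrightarrow> S0 i = S i" "\<And>i. i \<in> I \<Longrightarrow> S1 i = S i" "S \<rho> = S0 \<rho> \<union> S1 \<rho>"
    and \<rho>: "\<rho> \<notin> I" and fin: "finite I" and lk: "linked (insert \<rho> I) S"
  obtains A where "A \<subseteq> I" "linked (insert \<rho> A) S0" "linked (insert \<rho> (I - A)) S1"
proof -
  define P where "P A \<longleftrightarrow> A \<subseteq> I \<and> linked (insert \<rho> A) S0" for A
  have P0: "P {}" by (simp add: P_def)
  have "\<forall>A. P A \<longrightarrow> card A < Suc (card I)"
    using fin by (auto simp: P_def less_Suc_eq_le intro: card_mono)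
  from ex_has_greatest_nat[of P, OF P0 this] obtain A where A: "P A \<and> (\<forall>B. P B \<longrightarrow> card B \<le> card A)"
    by (elim exE)
  have AI: "A \<subseteq> I" using A by (simp add: P_def)
  then have finA: "finite A" using fin by (rule finite_subset)
  have no_ext: "S i \<inter> S0 j = {}" if "i \<in> I - A" "j \<in> insert \<rho> A" for i j
  proof (rule ccontr)
    assume "S i \<inter> S0 j \<noteq> {}"
    then have ne: "S0 i \<inter> S0 j \<noteq> {}" using that S by simp
    have "linked (insert \<rho> A) S0" using A by (simp add: P_def)
    from linked_insert[OF this that(2) ne] have "linked (insert i (insert \<rho> A)) S0" .
    then have "P (insert i A)" using A that by (simp add: P_def insert_commute)
    then have "card (insert i A) \<le> card A" using A by blast
    then show False using finA that by simp
  qed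
  have "linked (insert \<rho> (I - A)) S1"
  proof (rule linkedI_root[of \<rho>])
    fix C assume C: "C \<noteq> {}" "C \<subseteq> insert \<rho> (I - A)" "\<rho> \<notin> C"
    have "C \<subset> insert \<rho> I" using C by auto
    from lk C(1) this obtain i j where ij: "i \<in> C" "j \<in> insert \<rho> I - C" and ne: "S i \<inter> S j \<noteq> {}"
      by (rule linkedD)
    have i: "i \<in> I - A" using ij C by auto
    have "j \<notin> A"
    proof
      assume "j \<in> A"
      then have "S0 j = S j" using S AI by auto
      with no_ext[OF i, of j] \<open>j \<in> A\<close> ne show False by simp
    qed
    have "S1 i \<inter> S1 j \<noteq> {}"
    proof (cases "j = \<rho>")
      case True
      then show ?thesis using no_ext[OF i, of \<rho>] ne S i by auto
    next
      case False
      then show ?thesis using ij i ne S by auto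
    qed
    then show "\<exists>i\<in>C. \<exists>j\<in>insert \<rho> (I - A) - C. S1 i \<inter> S1 j \<noteq> {}"
      by (rule_tac bexI[of _ i], rule_tac bexI[of _ j]) (use ij \<open>j \<notin> A\<close> in auto)
  qed simp
  then show ?thesis using A that[of A] by (simp add: P_def)
qed

text \<open>If \<open>A - B\<close> were nonempty, linkedness of the second piece belonging to
  \<open>B\<close> would give a crossing pair of this cut, that is, a common element of the two
  unions assumed disjoint.\<close>

lemma linked_split_subset:
  assumes S: "\<And>i. i \<in> I \<Longrightarrow> S0 i = S i" "\<And>i. i \<in> I \<Longrightarrow> S1 i = S i"
    and \<rho>: "\<rho> \<notin> I" and A: "A \<subseteq> I" "B \<subseteq> I"
    and lB: "linked (insert \<rho> (I - B)) S1"
    and disj: "(\<Union>i\<in>insert \<rho> A. S0 i) \<inter> (\<Union>i\<in>insert \<rho> (I - A). S1 i) = {}"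
  shows "A \<subseteq> B"
proof (rule ccontr)
  assume "\<not> A \<subseteq> B"
  then have "A - B \<noteq> {}" by auto
  have "A - B \<subset> insert \<rho> (I - B)" using A \<rho> by auto
  from lB \<open>A - B \<noteq> {}\<close> this obtain i j where ij: "i \<in> A - B" "j \<in> insert \<rho> (I - B) - (A - B)"
    and ne: "S1 i \<inter> S1 j \<noteq> {}" by (rule linkedD)
  have "S1 i = S0 i" using S ij A by auto
  then have "S1 i \<subseteq> (\<Union>i\<in>insert \<rho> A. S0 i)" using ij by auto
  moreover have "S1 j \<subseteq> (\<Union>i\<in>insert \<rho> (I - A). S1 i)" using ij by auto
  ultimately show False using ne disj by auto
qed

lemma sum_pairs_matching:
  fixes f :: "'a \<Rightarrow> real" and g :: "'b \<Rightarrow> real"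
  assumes "finite A" "finite B" "finite K" "\<And>a. a \<in> A \<Longrightarrow> p a \<in> K"
  shows "(\<Sum>(a, b) | a \<in> A \<and> b \<in> B \<and> p a = q b. f a * g b) =
    (\<Sum>v\<in>K. (\<Sum>a | a \<in> A \<and> p a = v. f a) * (\<Sum>b | b \<in> B \<and> q b = v. g b))"
proof -
  have "(\<Sum>v\<in>K. (\<Sum>a | a \<in> A \<and> p a = v. f a) * (\<Sum>b | b \<in> B \<and> q b = v. g b)) =
      (\<Sum>v\<in>K. \<Sum>(a, b) | a \<in> A \<and> b \<in> B \<and> p a = v \<and> q b = v. f a * g b)"
  proof (intro sum.cong refl)
    fix v
    have "{(a, b). a \<in> A \<and> b \<in> B \<and> p a = v \<and> q b = v} = {a \<in> A. p a = v} \<times> {b \<in> B. q b = v}" by auto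
    then show "(\<Sum>a | a \<in> A \<and> p a = v. f a) * (\<Sum>b | b \<in> B \<and> q b = v. g b) =
        (\<Sum>(a, b) | a \<in> A \<and> b \<in> B \<and> p a = v \<and> q b = v. f a * g b)"
      by (simp add: sum_product sum.cartesian_product)
  qed
  also have "\<dots> = (\<Sum>(a, b)\<in>(\<Union>v\<in>K. {(a, b). a \<in> A \<and> b \<in> B \<and> p a = v \<and> q b = v}). f a * g b)"
  proof (rule sum.UNION_disjoint[symmetric])
    have "finite {(a, b). a \<in> A \<and> b \<in> B \<and> p a = v \<and> q b = v}" for v
      by (rule finite_subset[of _ "A \<times> B"]) (use assms in auto)
    then show "\<forall>v\<in>K. finite {(a, b). a \<in> A \<and> b \<in> B \<and> p a = v \<and> q b = v}" by blast
  qed (use assms in auto)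
  also have "(\<Union>v\<in>K. {(a, b). a \<in> A \<and> b \<in> B \<and> p a = v \<and> q b = v}) = {(a, b). a \<in> A \<and> b \<in> B \<and> p a = q b}"
    using assms(4) by auto (metis assms(4))
  finally show ?thesis ..
qed

text \<open>The walk \<open>\<rho>\<close> is cut after its first step; \<open>shift\<close> re-indexes its remaining \<open>b\<close> steps.\<close>

locale split_walk =
  fixes I :: "'i set" and l :: "'i \<Rightarrow> nat" and \<rho> :: 'i and b :: nat
  assumes fin: "finite I" and \<rho>: "\<rho> \<notin> I" and l\<rho>: "l \<rho> = Suc b" and b: "b \<ge> 1" and l: "\<forall>i\<in>I. 1 \<le> l i"
begin

abbreviation "l0 \<equiv> l(\<rho> := Suc 0)"
abbreviation "l1 \<equiv> l(\<rho> := b)"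

definition shift :: "'i \<times> nat \<Rightarrow> 'i \<times> nat" where
  "shift p = (if fst p = \<rho> then (\<rho>, Suc (snd p)) else p)"

definition unshift :: "'i \<times> nat \<Rightarrow> 'i \<times> nat" where
  "unshift p = (if fst p = \<rho> then (\<rho>, snd p - 1) else p)"

lemma unshift_shift [simp]: "unshift (shift p) = p"
  by (cases p) (simp add: shift_def unshift_def)

lemma inj_shift: "inj_on shift X"
  by (rule inj_on_inverseI[of _ unshift]) simp

lemma edge_shift: "edge (x \<circ> shift) p = edge x (shift p)"
  by (auto simp: edge_def shift_def)

lemma steps_split:
  assumes "A \<subseteq> I"
  shows "steps (insert \<rho> I) l = steps (insert \<rho> A) l0 \<union> shift ` steps (insert \<rho> (I - A)) l1"
    "steps (insert \<rho> A) l0 \<inter> shift ` steps (insert \<rho> (I - A)) l1 = {}"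
proof -
  have mem: "(i, t) \<in> shift ` steps (insert \<rho> (I - A)) l1 \<longleftrightarrow>
      (if i = \<rho> then 1 \<le> t \<and> t \<le> b else i \<in> I - A \<and> t < l i)" for i t
  proof
    assume "(i, t) \<in> shift ` steps (insert \<rho> (I - A)) l1"
    then show "if i = \<rho> then 1 \<le> t \<and> t \<le> b else i \<in> I - A \<and> t < l i"
      by (auto simp: steps_def shift_def split: if_splits)
  next
    assume *: "if i = \<rho> then 1 \<le> t \<and> t \<le> b else i \<in> I - A \<and> t < l i"
    have "(i, t) = shift (unshift (i, t))" using * by (auto simp: shift_def unshift_def split: if_splits)
    moreover have "unshift (i, t) \<in> steps (insert \<rho> (I - A)) l1"
      using * by (auto simp: unshift_def steps_def split: if_splits)
    ultimately show "(i, t) \<in> shift ` steps (insert \<rho> (I - A)) l1" by (rule image_eqI)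
  qed
  have mem0: "(i, t) \<in> steps (insert \<rho> A) l0 \<longleftrightarrow> (if i = \<rho> then t = 0 else i \<in> A \<and> t < l i)" for i t
    using \<rho> assms by (auto simp: steps_def)
  have memI: "(i, t) \<in> steps (insert \<rho> I) l \<longleftrightarrow> (if i = \<rho> then t \<le> b else i \<in> I \<and> t < l i)" for i t
    using \<rho> l\<rho> by (auto simp: steps_def)
  show "steps (insert \<rho> I) l = steps (insert \<rho> A) l0 \<union> shift ` steps (insert \<rho> (I - A)) l1"
  proof (rule Set.set_eqI)
    fix p show "p \<in> steps (insert \<rho> I) l \<longleftrightarrow> p \<in> steps (insert \<rho> A) l0 \<union> shift ` steps (insert \<rho> (I - A)) l1"
      using assms by (cases p) (auto simp: mem mem0 memI split: if_splits)
  qed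
  show "steps (insert \<rho> A) l0 \<inter> shift ` steps (insert \<rho> (I - A)) l1 = {}"
  proof (rule equals0I)
    fix p assume "p \<in> steps (insert \<rho> A) l0 \<inter> shift ` steps (insert \<rho> (I - A)) l1"
    then show False by (cases p) (auto simp: mem mem0 split: if_splits)
  qed
qed

text \<open>The steps of the two pieces are disjoint, but one point belongs to both: position 1 of
  \<rho> ends the first piece and is position 0 of the second. This is where the pieces are
  glued.\<close>

lemma points_split:
  assumes "A \<subseteq> I"
  shows "p \<in> points (insert \<rho> I) l \<longleftrightarrow>
     p \<in> points (insert \<rho> A) l0 \<or> unshift p \<in> points (insert \<rho> (I - A)) l1"
    "p \<in> points (insert \<rho> A) l0 \<Longrightarrow> q \<in> points (insert \<rho> (I - A)) l1 \<Longrightarrow> shift q = p \<Longrightarrow>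
      p = (\<rho>, 1) \<and> q = (\<rho>, 0)"
    "q \<in> points (insert \<rho> (I - A)) l1 \<Longrightarrow> shift q \<in> points (insert \<rho> I) l"
    "p \<in> points (insert \<rho> I) l \<Longrightarrow> p \<notin> points (insert \<rho> A) l0 \<Longrightarrow> shift (unshift p) = p"
  using assms \<rho> l\<rho> b by (cases p; cases q; force simp: points_def shift_def unshift_def split: if_splits)+

lemma walk_edges_split:
  assumes "i \<in> I"
  shows "walk_edges l0 x i = walk_edges l x i" "walk_edges l1 (x \<circ> shift) i = walk_edges l x i"
  using assms \<rho> by (auto simp: walk_edges_def edge_shift, auto simp: shift_def)

lemma walk_edges_split_root:
  "walk_edges l x \<rho> = walk_edges l0 x \<rho> \<union> walk_edges l1 (x \<circ> shift) \<rho>"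
proof -
  have "walk_edges l x \<rho> = insert (edge x (\<rho>, 0)) ((\<lambda>t. edge x (\<rho>, Suc t)) ` {..<b})"
    by (simp add: walk_edges_def l\<rho> lessThan_Suc_eq_insert_0 image_image)
  then show ?thesis
    by (simp add: walk_edges_def edge_shift shift_def lessThan_Suc)
qed

lemma edges_split:
  assumes "A \<subseteq> I"
  shows "edges (insert \<rho> I) l x = edges (insert \<rho> A) l0 x \<union> edges (insert \<rho> (I - A)) l1 (x \<circ> shift)"
  unfolding edges_def steps_split(1)[OF assms] by (simp add: image_Un image_image edge_shift)

lemma edge_count_split:
  assumes "A \<subseteq> I"
  shows "edge_count (insert \<rho> I) l x e =
    edge_count (insert \<rho> A) l0 x e + edge_count (insert \<rho> (I - A)) l1 (x \<circ> shift) e"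
proof -
  have "finite A" using assms fin by (rule finite_subset)
  then have finA: "finite (steps (insert \<rho> A) l0)" "finite (steps (insert \<rho> (I - A)) l1)"
    using fin by simp_all
  have "{p \<in> steps (insert \<rho> I) l. edge x p = e} = {p \<in> steps (insert \<rho> A) l0. edge x p = e} \<union>
      shift ` {p \<in> steps (insert \<rho> (I - A)) l1. edge (x \<circ> shift) p = e}"
    unfolding steps_split(1)[OF assms] edge_shift by blast
  moreover have "{p \<in> steps (insert \<rho> A) l0. edge x p = e} \<inter>
      shift ` {p \<in> steps (insert \<rho> (I - A)) l1. edge (x \<circ> shift) p = e} = {}"
    using steps_split(2)[OF assms] by blast
  ultimately show ?thesis
    unfolding edge_count_def using finA
    by (simp add: card_Un_disjoint card_image[OF inj_shift])
qed

lemma proper_split: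
  assumes "A \<subseteq> I"
  shows "proper (insert \<rho> I) l x \<longleftrightarrow>
    proper (insert \<rho> A) l0 x \<and> proper (insert \<rho> (I - A)) l1 (x \<circ> shift)"
proof -
  have "shift (fst p, Suc (snd p)) = (fst (shift p), Suc (snd (shift p)))" for p
    by (simp add: shift_def)
  then show ?thesis
    unfolding proper_def steps_split(1)[OF assms] by (simp add: ball_Un)
qed

text \<open>Additivity balances the powers of N: maximal pieces have one vertex more than edges each
  and share the cut vertex, so together they again have one vertex more than edges.\<close>

lemma top_edges_split:
  assumes "A \<subseteq> I"
  shows "top_edges (insert \<rho> I) l = top_edges (insert \<rho> A) l0 + top_edges (insert \<rho> (I - A)) l1"
proof -
  have A: "finite A" "\<rho> \<notin> A" using assms fin \<rho> by (auto intro: finite_subset)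
  have "(\<Sum>i\<in>I. l i - 1) = (\<Sum>i\<in>A. l i - 1) + (\<Sum>i\<in>I - A. l i - 1)"
    using sum.subset_diff[OF assms fin] by (simp add: add.commute)
  moreover have "(\<Sum>i\<in>A. l0 i - 1) = (\<Sum>i\<in>A. l i - 1)" "(\<Sum>i\<in>I - A. l1 i - 1) = (\<Sum>i\<in>I - A. l i - 1)"
    using A \<rho> by (intro sum.cong; auto)+
  ultimately show ?thesis
    using fin A \<rho> b l\<rho> by (simp add: top_edges_def)
qed

end

lemma config_cong:
  assumes "\<And>p. p \<in> points I l \<Longrightarrow> x p = y p"
  shows "proper I l x \<longleftrightarrow> proper I l y" "weight \<phi> I l x = weight \<phi> I l y"
    "linked I (walk_edges l x) \<longleftrightarrow> linked I (walk_edges l y)"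
proof -
  have eq: "x p = id (y p)" if "p \<in> points I l" for p using assms[OF that] by simp
  have inj: "inj_on id (y ` points I l)" by simp
  show "proper I l x \<longleftrightarrow> proper I l y" "linked I (walk_edges l x) \<longleftrightarrow> linked I (walk_edges l y)"
    using proper_inj[where I = I and l = l and x = x and y = id and r = y, OF eq inj]
      linked_inj[where I = I and l = l and x = x and y = id and r = y, OF eq inj] by auto
  show "weight \<phi> I l x = weight \<phi> I l y"
    using weight_inj[where I = I and l = l and x = x and y = id and r = y, OF eq inj]
    by (simp add: weight_def)
qed

context split_walk
begin

text \<open>\<open>A\<close> collects walks linked to the first step of \<rho>, the others being
  linked to the rest of \<rho>. In general a configuration admits several such sets.\<close>

definition splits :: "('i \<times> nat \<Rightarrow> 'v) \<Rightarrow> 'i set \<Rightarrow> bool" where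
  "splits x A \<longleftrightarrow> A \<subseteq> I \<and> linked (insert \<rho> A) (walk_edges l0 x) \<and>
    linked (insert \<rho> (I - A)) (walk_edges l1 (x \<circ> shift))"

text \<open>Two pieces that agree at the cut vertex can be glued without any further condition,
  since they may otherwise overlap freely. By transitivity each pinned sum is the share 1 / N of its
  total, and the sum over the N cut vertices leaves a single factor 1 / N.\<close>

lemma sum_split_configs:
  assumes A: "A \<subseteq> I" and N: "N \<ge> 1"
  shows "(\<Sum>x | x \<in> points (insert \<rho> I) l \<rightarrow>\<^sub>E {..<N} \<and> proper (insert \<rho> I) l x \<and> splits x A.
      weight (\<lambda>m _. V m) (insert \<rho> A) l0 x * weight (\<lambda>m _. V m) (insert \<rho> (I - A)) l1 (x \<circ> shift))
    = mean_field V (insert \<rho> A) l0 N * mean_field V (insert \<rho> (I - A)) l1 N / real N"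
proof -
  let ?PP = "points (insert \<rho> I) l" and ?P0 = "points (insert \<rho> A) l0"
    and ?P1 = "points (insert \<rho> (I - A)) l1"
  let ?C0 = "configs (insert \<rho> A) l0 {..<N}" and ?C1 = "configs (insert \<rho> (I - A)) l1 {..<N}"
  let ?w0 = "weight (\<lambda>m _. V m) (insert \<rho> A) l0 :: ('i \<times> nat \<Rightarrow> nat) \<Rightarrow> real"
  let ?w1 = "weight (\<lambda>m _. V m) (insert \<rho> (I - A)) l1 :: ('i \<times> nat \<Rightarrow> nat) \<Rightarrow> real"
  let ?X = "{x. x \<in> ?PP \<rightarrow>\<^sub>E {..<N} \<and> proper (insert \<rho> I) l x \<and> splits x A}"
  let ?Q = "{(a, b). a \<in> ?C0 \<and> b \<in> ?C1 \<and> a (\<rho>, 1) = b (\<rho>, 0)}"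
  let ?j = "\<lambda>x. (restrict x ?P0, restrict (x \<circ> shift) ?P1)"
  let ?i = "\<lambda>(a, b). \<lambda>p\<in>?PP. if p \<in> ?P0 then a p else b (unshift p)"
  have finA: "finite A" using A fin by (rule finite_subset)
  have P0: "p \<in> ?PP" if "p \<in> ?P0" for p using points_split(1)[OF A] that by blast
  have r0: "(\<rho>, 1) \<in> ?P0" and r1: "(\<rho>, 0) \<in> ?P1" by (auto simp: points_def)
  have "(\<Sum>x\<in>?X. ?w0 x * ?w1 (x \<circ> shift)) = (\<Sum>(a, b)\<in>?Q. ?w0 a * ?w1 b)"
  proof (rule sum.reindex_bij_witness[where i = ?i and j = ?j])
    fix x assume x: "x \<in> ?X"
    then have xL: "x \<in> ?PP \<rightarrow>\<^sub>E {..<N}" by simp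
    show "?i (?j x) = x"
    proof
      fix p
      show "?i (?j x) p = x p"
      proof (cases "p \<in> ?PP")
        case p: True
        show ?thesis
        proof (cases "p \<in> ?P0")
          case True then show ?thesis using p by simp
        next
          case False
          then have "unshift p \<in> ?P1" using p points_split(1)[OF A] by blast
          then show ?thesis using p False points_split(4)[OF A p False] by simp
        qed
      next
        case False then show ?thesis using PiE_arb[OF xL False] by simp
      qed
    qed
    have c0: "restrict x ?P0 p = x p" if "p \<in> ?P0" for p using that by simp
    have c1: "restrict (x \<circ> shift) ?P1 p = (x \<circ> shift) p" if "p \<in> ?P1" for p using that by simp
    have pr: "proper (insert \<rho> A) l0 x" "proper (insert \<rho> (I - A)) l1 (x \<circ> shift)"
      using x proper_split[OF A, of x] by auto
    have lk: "linked (insert \<rho> A) (walk_edges l0 x)" "linked (insert \<rho> (I - A)) (walk_edges l1 (x \<circ> shift))"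
      using x by (auto simp: splits_def)
    have "restrict x ?P0 \<in> ?P0 \<rightarrow>\<^sub>E {..<N}"
      by (rule restrict_PiE_iff[THEN iffD2]) (use xL P0 in \<open>auto dest: PiE_mem\<close>)
    then have "restrict x ?P0 \<in> ?C0"
      using pr lk by (simp add: configs_def config_cong(1,3)[OF c0])
    moreover have "restrict (x \<circ> shift) ?P1 \<in> ?P1 \<rightarrow>\<^sub>E {..<N}"
      by (rule restrict_PiE_iff[THEN iffD2]) (use xL points_split(3)[OF A] in \<open>auto dest: PiE_mem\<close>)
    then have "restrict (x \<circ> shift) ?P1 \<in> ?C1"
    proof -
      have "proper (insert \<rho> (I - A)) l1 (restrict (x \<circ> shift) ?P1)"
        "linked (insert \<rho> (I - A)) (walk_edges l1 (restrict (x \<circ> shift) ?P1))"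
        using pr lk config_cong(1,3)[of "insert \<rho> (I - A)" l1 "restrict (x \<circ> shift) ?P1" "x \<circ> shift"] c1
        by auto
      then show ?thesis
        using \<open>restrict (x \<circ> shift) ?P1 \<in> ?P1 \<rightarrow>\<^sub>E {..<N}\<close> unfolding configs_def by blast
    qed
    moreover have "restrict x ?P0 (\<rho>, 1) = restrict (x \<circ> shift) ?P1 (\<rho>, 0)"
      using r0 r1 by (simp add: shift_def)
    ultimately show "?j x \<in> ?Q" by simp
    have "?w0 (restrict x ?P0) = ?w0 x" "?w1 (restrict (x \<circ> shift) ?P1) = ?w1 (x \<circ> shift)"
      by (rule config_cong(2); simp)+
    then show "(case ?j x of (a, b) \<Rightarrow> ?w0 a * ?w1 b) = ?w0 x * ?w1 (x \<circ> shift)"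
      by (simp only: prod.case)
  next
    fix ab assume "ab \<in> ?Q"
    then obtain a b where ab: "ab = (a, b)" "a \<in> ?C0" "b \<in> ?C1" "a (\<rho>, 1) = b (\<rho>, 0)" by auto
    let ?x = "?i (a, b)"
    have aL: "a \<in> ?P0 \<rightarrow>\<^sub>E {..<N}" and bL: "b \<in> ?P1 \<rightarrow>\<^sub>E {..<N}" using ab by (auto simp: configs_def)
    have c0: "?x p = a p" if "p \<in> ?P0" for p using that P0[OF that] by simp
    have c1: "(?x \<circ> shift) q = b q" if "q \<in> ?P1" for q
    proof (cases "shift q \<in> ?P0")
      case True
      have "(?x \<circ> shift) q = a (shift q)" using c0[OF True] by (simp only: comp_apply)
      also have "a (shift q) = b q"
      proof -
        note * = points_split(2)[OF A True that refl]
        have q: "q = (\<rho>, 0)" by (rule conjunct2[OF *])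
        from conjunct1[OF *] have "a (shift q) = b (\<rho>, 0)" using ab(4) by (simp only:)
        then show ?thesis by (simp only: q)
      qed
      finally show ?thesis .
    next
      case False
      then show ?thesis using points_split(3)[OF A that] by simp
    qed
    have "restrict ?x ?P0 = a"
    proof
      fix p show "restrict ?x ?P0 p = a p"
        using c0[of p] PiE_arb[OF aL, of p] by (cases "p \<in> ?P0") simp_all
    qed
    moreover have "restrict (?x \<circ> shift) ?P1 = b"
    proof
      fix p show "restrict (?x \<circ> shift) ?P1 p = b p"
        using c1[of p] PiE_arb[OF bL, of p] by (cases "p \<in> ?P1") simp_all
    qed
    ultimately show "?j (?i ab) = ab" by (simp only: ab(1))
    have "?x \<in> ?PP \<rightarrow>\<^sub>E {..<N}"
    proof (rule PiE_I)
      fix p assume p: "p \<in> ?PP"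
      show "?x p \<in> {..<N}"
      proof (cases "p \<in> ?P0")
        case True
        then show ?thesis using c0[OF True] PiE_mem[OF aL True] by simp
      next
        case False
        then have "unshift p \<in> ?P1" using points_split(1)[OF A] p by blast
        from PiE_mem[OF bL this] show ?thesis using False p by simp
      qed
    qed simp
    moreover have "proper (insert \<rho> I) l ?x"
      using ab(2,3) by (simp only: proper_split[OF A] config_cong(1)[OF c0] config_cong(1)[OF c1])
        (simp add: configs_def)
    moreover have "splits ?x A"
      using ab(2,3) A by (simp only: splits_def config_cong(3)[OF c0] config_cong(3)[OF c1])
        (simp add: configs_def)
    ultimately show "?i ab \<in> ?X" by (simp only: ab(1)) simp
  qed
  also have "\<dots> = (\<Sum>v<N. (\<Sum>a | a \<in> ?C0 \<and> a (\<rho>, 1) = v. ?w0 a) * (\<Sum>b | b \<in> ?C1 \<and> b (\<rho>, 0) = v. ?w1 b))"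
  proof (rule sum_pairs_matching)
    show "a (\<rho>, 1) \<in> {..<N}" if "a \<in> ?C0" for a
      using that r0 unfolding configs_def by (auto dest: PiE_mem)
  qed (use fin finA in auto)
  also have "\<dots> = (\<Sum>v<N. (mean_field V (insert \<rho> A) l0 N / real N) * (mean_field V (insert \<rho> (I - A)) l1 N / real N))"
  proof (rule sum.cong[OF refl])
    fix v assume v: "v \<in> {..<N}"
    have "(\<Sum>a | a \<in> ?C0 \<and> a (\<rho>, 1) = v. ?w0 a) = mean_field V (insert \<rho> A) l0 N / real N"
      using mean_field_pinned[OF _ r0, of v N V] v N finA by (simp add: field_simps)
    moreover have "(\<Sum>b | b \<in> ?C1 \<and> b (\<rho>, 0) = v. ?w1 b) = mean_field V (insert \<rho> (I - A)) l1 N / real N"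
      using mean_field_pinned[OF _ r1, of v N V] v N fin by (simp add: field_simps)
    ultimately show "(\<Sum>a | a \<in> ?C0 \<and> a (\<rho>, 1) = v. ?w0 a) * (\<Sum>b | b \<in> ?C1 \<and> b (\<rho>, 0) = v. ?w1 b) =
      (mean_field V (insert \<rho> A) l0 N / real N) * (mean_field V (insert \<rho> (I - A)) l1 N / real N)" by simp
  qed
  also have "\<dots> = mean_field V (insert \<rho> A) l0 N * mean_field V (insert \<rho> (I - A)) l1 N / real N"
    using N by (simp add: field_simps)
  finally show ?thesis .
qed

lemma splits_linked:
  assumes "splits x A"
  shows "linked (insert \<rho> I) (walk_edges l x)"
  using assms unfolding splits_def
  by (intro linked_join[of I "walk_edges l0 x" _ "walk_edges l1 (x \<circ> shift)" \<rho> A])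
    (auto simp: walk_edges_split walk_edges_split_root \<rho>)

lemma splits_exists:
  assumes "linked (insert \<rho> I) (walk_edges l x)"
  obtains A where "splits x A"
proof -
  obtain A where "A \<subseteq> I" "linked (insert \<rho> A) (walk_edges l0 x)"
    "linked (insert \<rho> (I - A)) (walk_edges l1 (x \<circ> shift))"
  proof (rule linked_split[of I "walk_edges l0 x" "walk_edges l x" "walk_edges l1 (x \<circ> shift)" \<rho>])
  qed (use assms fin \<rho> in \<open>simp_all add: walk_edges_split walk_edges_split_root[symmetric]\<close>)
  then show ?thesis using that by (simp add: splits_def)
qed

text \<open>Each piece has at most its own maximal number of edges, and these two numbers add up to
  the size of the union, which leaves no room for a common edge.\<close>

lemma splits_top_disjoint:
  assumes sp: "splits x A" and top: "card (edges (insert \<rho> I) l x) = top_edges (insert \<rho> I) l"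
  shows "edges (insert \<rho> A) l0 x \<inter> edges (insert \<rho> (I - A)) l1 (x \<circ> shift) = {}"
proof -
  let ?E0 = "edges (insert \<rho> A) l0 x" and ?E1 = "edges (insert \<rho> (I - A)) l1 (x \<circ> shift)"
  have A: "A \<subseteq> I" using sp by (simp add: splits_def)
  have finA: "finite A" using A fin by (rule finite_subset)
  have f: "finite ?E0" "finite ?E1" using finA fin by simp_all
  have "card ?E0 \<le> top_edges (insert \<rho> A) l0" 
    using sp finA l b A by (intro card_edges_le) (auto simp: splits_def)
  moreover have "card ?E1 \<le> top_edges (insert \<rho> (I - A)) l1"
    using sp fin l b by (intro card_edges_le) (auto simp: splits_def)
  moreover have "card (?E0 \<union> ?E1) = top_edges (insert \<rho> A) l0 + top_edges (insert \<rho> (I - A)) l1"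
    using top top_edges_split[OF A] edges_split[OF A, of x] by simp
  moreover have "card ?E0 + card ?E1 = card (?E0 \<union> ?E1) + card (?E0 \<inter> ?E1)"
    by (rule card_Un_Int[OF f])
  ultimately have "card (?E0 \<inter> ?E1) = 0" by linarith
  then show ?thesis using f by simp
qed

text \<open>The pieces have disjoint edge sets, so the inclusion argument applies to the two
  splittings in both orders.\<close>

lemma splits_top_unique:
  assumes "splits x A" "splits x B" and top: "card (edges (insert \<rho> I) l x) = top_edges (insert \<rho> I) l"
  shows "A = B"
proof -
  have "A \<subseteq> B" if "splits x A" "splits x B" for A B
  proof (rule linked_split_subset[of I "walk_edges l0 x" "walk_edges l x" "walk_edges l1 (x \<circ> shift)" \<rho>])
    show "(\<Union>i\<in>insert \<rho> A. walk_edges l0 x i) \<inter> (\<Union>i\<in>insert \<rho> (I - A). walk_edges l1 (x \<circ> shift) i) = {}"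
      using splits_top_disjoint[OF that(1) top] by (simp only: edges_UN)
  qed (use that \<rho> in \<open>simp_all add: walk_edges_split splits_def\<close>)
  with assms show ?thesis by blast
qed

text \<open>Disjointness keeps the multiplicities apart: every edge is used in one piece only, as
  often as in the whole configuration.\<close>

lemma weight_split:
  assumes sp: "splits x A" and top: "card (edges (insert \<rho> I) l x) = top_edges (insert \<rho> I) l"
  shows "weight (\<lambda>m _. V m) (insert \<rho> I) l x =
    weight (\<lambda>m _. V m) (insert \<rho> A) l0 x * weight (\<lambda>m _. V m) (insert \<rho> (I - A)) l1 (x \<circ> shift)"
proof -
  let ?E0 = "edges (insert \<rho> A) l0 x" and ?E1 = "edges (insert \<rho> (I - A)) l1 (x \<circ> shift)"
  have A: "A \<subseteq> I" using sp by (simp add: splits_def)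
  have finA: "finite A" using A fin by (rule finite_subset)
  have disj: "?E0 \<inter> ?E1 = {}" by (rule splits_top_disjoint[OF assms])
  have zero: "edge_count J m y e = 0" if "e \<notin> edges J m y" for J m e and y :: "'i \<times> nat \<Rightarrow> 'b"
  proof -
    have "{p \<in> steps J m. edge y p = e} = {}" using that by (auto simp: edges_def)
    then show ?thesis unfolding edge_count_def by (simp only: card.empty)
  qed
  have 0: "edge_count (insert \<rho> I) l x e = edge_count (insert \<rho> A) l0 x e" if "e \<in> ?E0" for e
    using that disj edge_count_split[OF A, of x e] zero[of e] by auto
  have 1: "edge_count (insert \<rho> I) l x e = edge_count (insert \<rho> (I - A)) l1 (x \<circ> shift) e" if "e \<in> ?E1" for e
    using that disj edge_count_split[OF A, of x e] zero[of e] by auto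
  have "weight (\<lambda>m _. V m) (insert \<rho> I) l x = (\<Prod>e\<in>?E0. V (edge_count (insert \<rho> I) l x e)) *
      (\<Prod>e\<in>?E1. V (edge_count (insert \<rho> I) l x e))"
    unfolding weight_def edges_split[OF A] using finA fin disj by (intro prod.union_disjoint) simp_all
  also have "\<dots> = weight (\<lambda>m _. V m) (insert \<rho> A) l0 x * weight (\<lambda>m _. V m) (insert \<rho> (I - A)) l1 (x \<circ> shift)"
    unfolding weight_def using 0 1 by simp
  finally show ?thesis .
qed

end

lemma abs_weight_le:
  fixes V :: "nat \<Rightarrow> real"
  assumes "finite I"
  obtains B where "B \<ge> 0" "\<And>x :: 'i \<times> nat \<Rightarrow> 'v. \<bar>weight (\<lambda>m _. V m) (I :: 'i set) l x\<bar> \<le> B"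
proof
  define M where "M = 1 + (\<Sum>m\<le>card (steps I l). \<bar>V m\<bar>)"
  have M: "M \<ge> 1" by (simp add: M_def sum_nonneg)
  then show "0 \<le> M ^ card (steps I l)" by simp
  show "\<bar>weight (\<lambda>m _. V m) I l x\<bar> \<le> M ^ card (steps I l)" for x :: "'i \<times> nat \<Rightarrow> 'v"
  proof -
    have V: "\<bar>V (edge_count I l x e)\<bar> \<le> M" for e
    proof -
      have "edge_count I l x e \<le> card (steps I l)"
        unfolding edge_count_def using assms by (intro card_mono) auto
      then have "\<bar>V (edge_count I l x e)\<bar> \<le> (\<Sum>m\<le>card (steps I l). \<bar>V m\<bar>)"
        by (intro member_le_sum) auto
      then show ?thesis by (simp add: M_def)
    qed
    have "\<bar>weight (\<lambda>m _. V m) I l x\<bar> \<le> (\<Prod>e\<in>edges I l x. M)"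
      unfolding weight_def abs_prod using V by (intro prod_mono) auto
    also have "\<dots> \<le> M ^ card (steps I l)"
      using M assms by (simp, intro power_increasing) (auto simp: edges_def intro: card_image_le)
    finally show ?thesis .
  qed
qed

text \<open>Fewer than n edges means at most n vertices, hence at most N^n embeddings of each
  pattern.\<close>

lemma card_configs_few_edges:
  assumes "finite I" "I \<noteq> {}" "\<forall>i\<in>I. 1 \<le> l i" "N \<ge> 1"
  shows "card {x \<in> configs I l {..<N}. card (edges I l x) < n} \<le> card (patterns I l) * N ^ n"
proof -
  let ?C = "configs I l {..<N}"
  have "card {x \<in> ?C. card (edges I l x) < n} = (\<Sum>x\<in>?C. if card (edges I l x) < n then 1 else 0)"
    using assms(1) by (simp add: sum.If_cases Int_def)
  also have "\<dots> = (\<Sum>r\<in>patterns I l. \<Sum>y\<in>embeddings (pat_verts I l r) {..<N}.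
      if card (edges I l (restrict (y \<circ> r) (points I l))) < n then 1 else 0)"
    by (rule sum_configs) (use assms in auto)
  also have "\<dots> \<le> (\<Sum>r\<in>patterns I l. N ^ n)"
  proof (rule sum_mono)
    fix r assume r: "r \<in> patterns I l"
    let ?U = "pat_verts I l r"
    have finU: "finite ?U" using assms by simp
    have e: "card (edges I l (restrict (y \<circ> r) (points I l))) = card (edges I l r)"
      if y: "y \<in> embeddings ?U {..<N}" for y
    proof -
      have inj: "inj_on y ?U" using y by (simp add: embeddings_def)
      have eq: "restrict (y \<circ> r) (points I l) p = y (r p)" if "p \<in> points I l" for p using that by simp
      show ?thesis
        using edges_inj[where I = I and l = l and r = r and y = y and x = "restrict (y \<circ> r) (points I l)", OF eq inj]
          inj_on_edges[where I = I and l = l and r = r and y = y and x = "restrict (y \<circ> r) (points I l)", OF eq inj]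
        by (simp add: card_image)
    qed
    have "(\<Sum>y\<in>embeddings ?U {..<N}. if card (edges I l (restrict (y \<circ> r) (points I l))) < n then 1 else 0)
        = (\<Sum>y\<in>embeddings ?U {..<N}. if card (edges I l r) < n then 1 else 0)"
      using e by (intro sum.cong) auto
    also have "\<dots> \<le> N ^ n"
    proof (cases "card (edges I l r) < n")
      case True
      have "card (embeddings ?U {..<N}) \<le> card (?U \<rightarrow>\<^sub>E {..<N})"
        unfolding embeddings_def using finU by (intro card_mono) (auto intro: finite_PiE)
      also have "\<dots> = N ^ card ?U" using finU by (simp add: card_PiE)
      also have "\<dots> \<le> N ^ n"
        using card_verts_le[OF assms(1,2) patternsD(2)[OF r] assms(3)] True assms(4)
        by (intro power_increasing) auto
      finally show ?thesis using True by simp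
    qed simp
    finally show "(\<Sum>y\<in>embeddings ?U {..<N}. if card (edges I l (restrict (y \<circ> r) (points I l))) < n then 1 else 0)
      \<le> N ^ n" .
  qed
  finally show ?thesis by simp
qed

context split_walk
begin

text \<open>If the number of edges is maximal, exactly one \<open>A\<close> splits the configuration
  and the weight factors, so both sums agree there. The other configurations are fewer by a factor N
  and enter with bounded weights; \<open>B\<close> and \<open>BB A\<close> are the bounds.\<close>

lemma mean_field_split_error:
  fixes V :: "nat \<Rightarrow> real"
  obtains K where "\<And>N. N \<ge> 1 \<Longrightarrow> \<bar>mean_field V (insert \<rho> I) l N -
      (\<Sum>A\<in>Pow I. mean_field V (insert \<rho> A) l0 N * mean_field V (insert \<rho> (I - A)) l1 N / real N)\<bar>
    \<le> K * real N ^ top_edges (insert \<rho> I) l"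
proof -
  let ?J = "insert \<rho> I" and ?n = "top_edges (insert \<rho> I) l"
  let ?w = "\<lambda>x :: 'i \<times> nat \<Rightarrow> nat. weight (\<lambda>m _. V m) ?J l x"
  let ?ww = "\<lambda>A (x :: 'i \<times> nat \<Rightarrow> nat).
    weight (\<lambda>m _. V m) (insert \<rho> A) l0 x * weight (\<lambda>m _. V m) (insert \<rho> (I - A)) l1 (x \<circ> shift)"
  obtain B where B: "B \<ge> 0" "\<And>x. \<bar>?w x\<bar> \<le> B"
    using abs_weight_le[of ?J V l, where ?'v = nat] fin by auto
  have "\<exists>B\<ge>0. \<forall>x. \<bar>?ww A x\<bar> \<le> B" if "A \<in> Pow I" for A
  proof -
    have finA: "finite A" using that fin by (auto intro: finite_subset)
    obtain B0 where B0: "B0 \<ge> 0" "\<And>x :: 'i \<times> nat \<Rightarrow> nat. \<bar>weight (\<lambda>m _. V m) (insert \<rho> A) l0 x\<bar> \<le> B0"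
      using abs_weight_le[of "insert \<rho> A" V l0, where ?'v = nat] finA by auto
    obtain B1 where B1: "B1 \<ge> 0" "\<And>x :: 'i \<times> nat \<Rightarrow> nat. \<bar>weight (\<lambda>m _. V m) (insert \<rho> (I - A)) l1 x\<bar> \<le> B1"
      using abs_weight_le[of "insert \<rho> (I - A)" V l1, where ?'v = nat] fin by auto
    show ?thesis
      by (rule exI[of _ "B0 * B1"]) (use B0 B1 in \<open>auto simp: abs_mult intro: mult_mono\<close>)
  qed
  then obtain BB where BB: "\<And>A. A \<in> Pow I \<Longrightarrow> BB A \<ge> 0 \<and> (\<forall>x. \<bar>?ww A x\<bar> \<le> BB A)" by metis
  define K where "K = (B + (\<Sum>A\<in>Pow I. BB A)) * real (card (patterns ?J l))"
  show ?thesis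
  proof (rule that)
    fix N :: nat assume N: "N \<ge> 1"
    let ?C = "configs ?J l {..<N}"
    let ?s = "\<lambda>x. \<Sum>A\<in>Pow I. if splits x A then ?ww A x else 0"
    have fC: "finite ?C" using fin by simp
    have "(\<Sum>A\<in>Pow I. mean_field V (insert \<rho> A) l0 N * mean_field V (insert \<rho> (I - A)) l1 N / real N)
        = (\<Sum>A\<in>Pow I. \<Sum>x\<in>?C. if splits x A then ?ww A x else 0)"
    proof (rule sum.cong[OF refl])
      fix A assume A: "A \<in> Pow I"
      have "{x. x \<in> points ?J l \<rightarrow>\<^sub>E {..<N} \<and> proper ?J l x \<and> splits x A} = {x \<in> ?C. splits x A}"
        using splits_linked by (auto simp: configs_def)
      then show "mean_field V (insert \<rho> A) l0 N * mean_field V (insert \<rho> (I - A)) l1 N / real N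
          = (\<Sum>x\<in>?C. if splits x A then ?ww A x else 0)"
        using sum_split_configs[of A N V] A N fC by (simp add: sum.inter_filter)
    qed
    also have "\<dots> = (\<Sum>x\<in>?C. ?s x)" by (rule sum.swap)
    finally have "\<bar>mean_field V ?J l N - (\<Sum>A\<in>Pow I. mean_field V (insert \<rho> A) l0 N *
        mean_field V (insert \<rho> (I - A)) l1 N / real N)\<bar> = \<bar>\<Sum>x\<in>?C. ?w x - ?s x\<bar>"
      by (simp add: link_sum_def sum_subtractf)
    also have "\<dots> \<le> (\<Sum>x\<in>?C. \<bar>?w x - ?s x\<bar>)" by (rule sum_abs)
    also have "\<dots> \<le> (\<Sum>x\<in>?C. if card (edges ?J l x) < ?n then B + (\<Sum>A\<in>Pow I. BB A) else 0)"
    proof (rule sum_mono)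
      fix x assume x: "x \<in> ?C"
      have lk: "linked ?J (walk_edges l x)" using x by (simp add: configs_def)
      show "\<bar>?w x - ?s x\<bar> \<le> (if card (edges ?J l x) < ?n then B + (\<Sum>A\<in>Pow I. BB A) else 0)"
      proof (cases "card (edges ?J l x) < ?n")
        case True
        have "\<bar>?s x\<bar> \<le> (\<Sum>A\<in>Pow I. \<bar>if splits x A then ?ww A x else 0\<bar>)" by (rule sum_abs)
        also have "\<dots> \<le> (\<Sum>A\<in>Pow I. BB A)" using BB by (intro sum_mono) auto
        finally show ?thesis using B(2)[of x] True by (simp only: if_True)
      next
        case False
        moreover have "card (edges ?J l x) \<le> ?n"
          using card_edges_le[OF _ _ lk] fin l l\<rho> by simp
        ultimately have top: "card (edges ?J l x) = ?n" by simp
        obtain A where A: "splits x A" using splits_exists[OF lk] .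
        then have AI: "A \<in> Pow I" by (simp add: splits_def)
        have "?s x = (\<Sum>A'\<in>Pow I. if A' = A then ?ww A x else 0)"
        proof (rule sum.cong[OF refl])
          fix A'
          show "(if splits x A' then ?ww A' x else 0) = (if A' = A then ?ww A x else 0)"
          proof (cases "A' = A")
            case False
            then have "\<not> splits x A'" using splits_top_unique[OF _ A top] by blast
            then show ?thesis using False by simp
          qed (use A in simp)
        qed
        also have "\<dots> = ?ww A x" using AI fin by simp
        finally show ?thesis using weight_split[OF A top, of V] False by simp
      qed
    qed
    also have "\<dots> = (B + (\<Sum>A\<in>Pow I. BB A)) * real (card {x \<in> ?C. card (edges ?J l x) < ?n})"
      using fC by (simp add: sum.inter_filter[symmetric])
    also have "\<dots> \<le> (B + (\<Sum>A\<in>Pow I. BB A)) * real (card (patterns ?J l) * N ^ ?n)"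
    proof (intro mult_left_mono)
      show "real (card {x \<in> ?C. card (edges ?J l x) < ?n}) \<le> real (card (patterns ?J l) * N ^ ?n)"
        unfolding of_nat_le_iff by (rule card_configs_few_edges) (use fin l l\<rho> N in auto)
      show "0 \<le> B + (\<Sum>A\<in>Pow I. BB A)" using B BB by (intro add_nonneg_nonneg sum_nonneg) auto
    qed
    finally show "\<bar>mean_field V ?J l N - (\<Sum>A\<in>Pow I. mean_field V (insert \<rho> A) l0 N *
        mean_field V (insert \<rho> (I - A)) l1 N / real N)\<bar> \<le> K * real N ^ ?n"
      by (simp add: K_def mult.assoc)
  qed
qed

text \<open>After division by the leading power of N the configurations on which gluing is ambiguous
  contribute O(1 / N), so the exact product formula for glued pieces passes to the leading
  coefficients.\<close>

theorem lead_sum_split: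
  "lead_sum V (insert \<rho> I) l = (\<Sum>A\<in>Pow I. lead_sum V (insert \<rho> A) l0 * lead_sum V (insert \<rho> (I - A)) l1)"
proof (rule LIMSEQ_unique)
  let ?J = "insert \<rho> I" and ?n = "top_edges (insert \<rho> I) l"
  let ?S = "\<lambda>N. \<Sum>A\<in>Pow I. mean_field V (insert \<rho> A) l0 N * mean_field V (insert \<rho> (I - A)) l1 N / real N"
  show "(\<lambda>N. mean_field V ?J l N / real N ^ Suc ?n) \<longlonglongrightarrow> lead_sum V ?J l"
    by (rule mean_field_limit) (use fin l l\<rho> in auto)
  obtain K where K: "\<And>N. N \<ge> 1 \<Longrightarrow> \<bar>mean_field V ?J l N - ?S N\<bar> \<le> K * real N ^ ?n"
    using mean_field_split_error[where V = V] by blast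
  have "(\<lambda>N. (mean_field V ?J l N - ?S N) / real N ^ Suc ?n) \<longlonglongrightarrow> 0"
  proof (rule Lim_null_comparison)
    show "\<forall>\<^sub>F N in sequentially. norm ((mean_field V ?J l N - ?S N) / real N ^ Suc ?n) \<le> K / real N"
      using eventually_ge_at_top[of 1]
    proof eventually_elim
      case (elim N)
      have "\<bar>mean_field V ?J l N - ?S N\<bar> / real N ^ Suc ?n \<le> K * real N ^ ?n / real N ^ Suc ?n"
        by (rule divide_right_mono[OF K[OF elim]]) simp
      then show ?case using elim by (simp add: abs_divide)
    qed
    show "(\<lambda>N. K / real N) \<longlonglongrightarrow> 0" by (rule lim_const_over_n)
  qed
  moreover have "(\<lambda>N. ?S N / real N ^ Suc ?n) \<longlonglongrightarrow>
      (\<Sum>A\<in>Pow I. lead_sum V (insert \<rho> A) l0 * lead_sum V (insert \<rho> (I - A)) l1)"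
  proof -
    have "(\<lambda>N. \<Sum>A\<in>Pow I. (mean_field V (insert \<rho> A) l0 N / real N ^ Suc (top_edges (insert \<rho> A) l0)) *
          (mean_field V (insert \<rho> (I - A)) l1 N / real N ^ Suc (top_edges (insert \<rho> (I - A)) l1)))
       \<longlonglongrightarrow> (\<Sum>A\<in>Pow I. lead_sum V (insert \<rho> A) l0 * lead_sum V (insert \<rho> (I - A)) l1)"
    proof (intro tendsto_sum tendsto_mult mean_field_limit)
      fix A assume A: "A \<in> Pow I"
      then show "finite (insert \<rho> A)" using fin by (auto intro: finite_subset)
      show "\<forall>i\<in>insert \<rho> A. 1 \<le> l0 i" "\<forall>i\<in>insert \<rho> (I - A). 1 \<le> l1 i" using A l b by auto
    qed (use fin in auto)
    moreover have "(\<Sum>A\<in>Pow I. (mean_field V (insert \<rho> A) l0 N / real N ^ Suc (top_edges (insert \<rho> A) l0)) *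
          (mean_field V (insert \<rho> (I - A)) l1 N / real N ^ Suc (top_edges (insert \<rho> (I - A)) l1))) =
        ?S N / real N ^ Suc ?n" for N
      unfolding sum_divide_distrib
    proof (rule sum.cong[OF refl])
      fix A assume A: "A \<in> Pow I"
      then show "(mean_field V (insert \<rho> A) l0 N / real N ^ Suc (top_edges (insert \<rho> A) l0)) *
          (mean_field V (insert \<rho> (I - A)) l1 N / real N ^ Suc (top_edges (insert \<rho> (I - A)) l1)) =
        mean_field V (insert \<rho> A) l0 N * mean_field V (insert \<rho> (I - A)) l1 N / real N / real N ^ Suc ?n"
        using top_edges_split[of A] by (simp add: power_add)
    qed
    ultimately show ?thesis by simp
  qed
  ultimately have "(\<lambda>N. (mean_field V ?J l N - ?S N) / real N ^ Suc ?n + ?S N / real N ^ Suc ?n) \<longlonglongrightarrow>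
      0 + (\<Sum>A\<in>Pow I. lead_sum V (insert \<rho> A) l0 * lead_sum V (insert \<rho> (I - A)) l1)"
    by (rule tendsto_add)
  then show "(\<lambda>N. mean_field V ?J l N / real N ^ Suc ?n) \<longlonglongrightarrow>
      (\<Sum>A\<in>Pow I. lead_sum V (insert \<rho> A) l0 * lead_sum V (insert \<rho> (I - A)) l1)"
    by (simp add: diff_divide_distrib)
qed

end

section \<open>The Hurwitz-type identity\<close>

unbundle fps_syntax and no vec_syntax

text \<open>This is multiplication of series in variables t_i with the squares of the t_i discarded,
  where the value at \<open>I\<close> is the coefficient of the product of the t_i over
  \<open>I\<close>.\<close>

definition subset_conv :: "('i set \<Rightarrow> 'r::comm_ring_1) \<Rightarrow> ('i set \<Rightarrow> 'r) \<Rightarrow> 'i set \<Rightarrow> 'r" where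
  "subset_conv f g I = (\<Sum>A\<in>Pow I. f A * g (I - A))"

lemma subset_conv_commute: "subset_conv f g I = subset_conv g f I"
  unfolding subset_conv_def
  by (rule sum.reindex_bij_witness[of _ "\<lambda>A. I - A" "\<lambda>A. I - A"]) (auto simp: double_diff mult.commute)

lemma subset_conv_cong:
  assumes "\<And>A. A \<subseteq> I \<Longrightarrow> f A = f' A" "\<And>A. A \<subseteq> I \<Longrightarrow> g A = g' A"
  shows "subset_conv f g I = subset_conv f' g' I"
  unfolding subset_conv_def using assms by (intro sum.cong) auto

lemma subset_conv_assoc:
  assumes "finite I"
  shows "subset_conv (subset_conv f g) h I = subset_conv f (subset_conv g h) I"
proof -
  have "subset_conv (subset_conv f g) h I = (\<Sum>(A, B)\<in>(SIGMA A:Pow I. Pow A). f B * g (A - B) * h (I - A))"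
    unfolding subset_conv_def sum_distrib_right
    using assms by (intro sum.Sigma) (auto intro: finite_subset)
  also have "\<dots> = (\<Sum>(B, C)\<in>(SIGMA B:Pow I. Pow (I - B)). f B * (g C * h (I - B - C)))"
  proof (rule sum.reindex_bij_witness[of _ "\<lambda>(B, C). (B \<union> C, B)" "\<lambda>(A, B). (B, A - B)"])
    fix a assume "a \<in> (SIGMA A:Pow I. Pow A)"
    then obtain A B where a: "a = (A, B)" "A \<subseteq> I" "B \<subseteq> A" by auto
    then have "I - B - (A - B) = I - A" by auto
    then show "(case case a of (A, B) \<Rightarrow> (B, A - B) of (B, C) \<Rightarrow> f B * (g C * h (I - B - C))) =
        (case a of (A, B) \<Rightarrow> f B * g (A - B) * h (I - A))"
      by (simp add: a(1) mult.assoc)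
  qed auto
  also have "\<dots> = subset_conv f (subset_conv g h) I"
    unfolding subset_conv_def sum_distrib_left
    using assms by (intro sum.Sigma[symmetric]) auto
  finally show ?thesis .
qed

text \<open>The Leibniz rule for differentiation in the variable t_i: the element \<open>i\<close>
  falls into one factor or the other.\<close>

lemma subset_conv_insert:
  assumes "finite I" "i \<notin> I"
  shows "subset_conv f g (insert i I) =
    subset_conv (\<lambda>A. f (insert i A)) g I + subset_conv f (\<lambda>A. g (insert i A)) I"
proof -
  have "Pow (insert i I) = Pow I \<union> insert i ` Pow I" by (rule Pow_insert)
  moreover have "Pow I \<inter> insert i ` Pow I = {}" using assms by auto
  ultimately have "subset_conv f g (insert i I) =
      (\<Sum>A\<in>Pow I. f A * g (insert i I - A)) + (\<Sum>A\<in>insert i ` Pow I. f A * g (insert i I - A))"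
    unfolding subset_conv_def using assms by (simp add: sum.union_disjoint)
  also have "(\<Sum>A\<in>Pow I. f A * g (insert i I - A)) = subset_conv f (\<lambda>A. g (insert i A)) I"
    unfolding subset_conv_def using assms
    by (intro sum.cong refl) (auto simp: insert_Diff_if)
  also have "inj_on (insert i) (Pow I)" using assms by (auto simp: inj_on_def)
  then have "(\<Sum>A\<in>insert i ` Pow I. f A * g (insert i I - A)) = (\<Sum>A\<in>Pow I. f (insert i A) * g (insert i I - insert i A))"
    by (subst sum.reindex) simp_all
  also have "\<dots> = subset_conv (\<lambda>A. f (insert i A)) g I"
    unfolding subset_conv_def
  proof (intro sum.cong refl)
    fix A assume "A \<in> Pow I"
    then have "insert i I - insert i A = I - A" using assms by auto
    then show "f (insert i A) * g (insert i I - insert i A) = f (insert i A) * g (I - A)" by simp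
  qed
  finally show ?thesis by (simp add: add.commute)
qed

lemma fps_deriv_subset_conv:
  fixes f g :: "'i set \<Rightarrow> real fps"
  shows "fps_deriv (subset_conv f g I) =
    subset_conv (\<lambda>A. fps_deriv (f A)) g I + subset_conv f (\<lambda>A. fps_deriv (g A)) I"
  unfolding subset_conv_def fps_deriv_sum sum.distrib[symmetric]
  by (intro sum.cong refl) (simp add: algebra_simps)

lemma subset_conv_const:
  fixes f g :: "'i set \<Rightarrow> real fps"
  shows "subset_conv (\<lambda>A. fps_const a * f A) g I = fps_const a * subset_conv f g I"
    "subset_conv f (\<lambda>A. fps_const a * g A) I = fps_const a * subset_conv f g I"
  unfolding subset_conv_def by (simp_all add: sum_distrib_left mult.left_commute mult.assoc)

text \<open>
  \<open>hurwitz G c r I\<close> is the coefficient of \<open>\<Prod>i\<in>I. t\<^sub>i\<close> in \<open>u ^ r\<close>, where \<open>u\<close> solves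
  \<open>u = G (x + (\<Sum>i\<in>I. t\<^sub>i * u ^ c i))\<close>; hence it is multiplicative in \<open>r\<close>. The proof below uses
  only the differential form \<open>\<partial>u / \<partial>t\<^sub>i = u ^ c i * \<partial>u / \<partial>x\<close>, which is \<open>hurwitz_insert\<close>.
\<close>

definition hurwitz :: "real fps \<Rightarrow> ('i \<Rightarrow> nat) \<Rightarrow> nat \<Rightarrow> 'i set \<Rightarrow> real fps" where
  "hurwitz G c r I = fps_const (real r / real (r + sum c I)) * (fps_deriv ^^ card I) (G ^ (r + sum c I))"

lemma hurwitz_insert:
  assumes "finite I" "i \<notin> I" "r \<ge> 1"
  shows "hurwitz G c r (insert i I) = fps_const (real r / real (r + c i)) * fps_deriv (hurwitz G c (r + c i) I)"
proof -
  have "real r / real (r + c i) * (real (r + c i) / real (r + c i + sum c I)) = real r / real (r + c i + sum c I)"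
    using assms(3) by simp
  then show ?thesis
    using assms by (simp add: hurwitz_def fps_deriv_mult_const_left add.assoc mult.assoc[symmetric] del: of_nat_add)
qed

text \<open>Differentiation in t_i turns the claim for \<open>I\<close> into one about x-derivatives
  over \<open>I - {i}\<close>, where multiplicativity is known by induction and yields the power
  rule. The fractions r / (r + s + c i) and s / (r + s + c i) then add up to the prefactor of the
  right-hand side.\<close>

theorem subset_conv_hurwitz:
  assumes "finite I" "r \<ge> 1" "s \<ge> 1"
  shows "subset_conv (hurwitz G c r) (hurwitz G c s) I = hurwitz G c (r + s) I"
  using assms
proof (induction I arbitrary: r s rule: finite_psubset_induct)
  case (psubset I)
  show ?case
  proof (cases "I = {}")
    case True
    then show ?thesis using psubset.prems by (simp add: subset_conv_def hurwitz_def power_add)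
  next
    case False
    then obtain i where i: "i \<in> I" by auto
    define J where "J = I - {i}"
    have J: "finite J" "i \<notin> J" "I = insert i J" using psubset.hyps i by (auto simp: J_def)
    let ?a = "hurwitz G c" and ?D = "\<lambda>f A. fps_deriv (f A)"
    have IH: "subset_conv (?a r) (?a s) A = ?a (r + s) A" if "A \<subseteq> J" "r \<ge> 1" "s \<ge> 1" for A r s
      using that J by (intro psubset.IH) auto
    \<comment> \<open>\<open>?X r s\<close> stands for (u^r)' u^s over \<open>J\<close>, with u as
      in the description of \<open>hurwitz\<close>. The facts \<open>step\<close>,
      \<open>mul\<close> and \<open>top\<close> derive the power rule for u from multiplicativity
      alone, without constructing u.\<close>
    let ?X = "\<lambda>r s. subset_conv (?D (?a r)) (?a s) J"
    have step: "?X (Suc r) s = ?X r (Suc s) + ?X 1 (r + s)" if "r \<ge> 1" "s \<ge> 1" for r s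
    proof -
      have "?X (Suc r) s = subset_conv (\<lambda>A. subset_conv (?D (?a r)) (?a 1) A + subset_conv (?a r) (?D (?a 1)) A) (?a s) J"
      proof (rule subset_conv_cong)
        fix A assume "A \<subseteq> J"
        then have "?a (Suc r) A = subset_conv (?a r) (?a 1) A" using IH[of A r 1] that by simp
        then show "fps_deriv (?a (Suc r) A) = subset_conv (?D (?a r)) (?a 1) A + subset_conv (?a r) (?D (?a 1)) A"
          by (simp add: fps_deriv_subset_conv)
      qed simp
      also have "\<dots> = subset_conv (subset_conv (?D (?a r)) (?a 1)) (?a s) J +
          subset_conv (subset_conv (?a r) (?D (?a 1))) (?a s) J"
        by (simp add: subset_conv_def[of _ "?a s"] distrib_right sum.distrib)
      also have "subset_conv (subset_conv (?D (?a r)) (?a 1)) (?a s) J = ?X r (Suc s)"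
        unfolding subset_conv_assoc[OF J(1)] using IH[of _ 1 s] that by (intro subset_conv_cong) auto
      also have "subset_conv (?a r) (?D (?a 1)) = subset_conv (?D (?a 1)) (?a r)"
        by (rule ext) (rule subset_conv_commute)
      also have "subset_conv (subset_conv (?D (?a 1)) (?a r)) (?a s) J = ?X 1 (r + s)"
        unfolding subset_conv_assoc[OF J(1)] using IH[of _ r s] that by (intro subset_conv_cong) auto
      finally show ?thesis .
    qed
    have mul: "?X r s = fps_const (real r) * ?X 1 (r + s - 1)" if "r \<ge> 1" "s \<ge> 1" for r s
      using that
    proof (induction r arbitrary: s rule: nat_induct_at_least)
      case (Suc r)
      have "?X (Suc r) s = fps_const (real r) * ?X 1 (r + s) + ?X 1 (r + s)"
        using step[of r s] Suc.IH[of "Suc s"] Suc.prems Suc.hyps by simp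
      also have "\<dots> = fps_const (real (Suc r)) * ?X 1 (r + s)"
        by (simp add: fps_eq_iff algebra_simps)
      finally show ?case by simp
    qed simp
    have top: "fps_deriv (?a n J) = fps_const (real n) * ?X 1 (n - 1)" if "n \<ge> 2" for n
    proof -
      have "?a n J = subset_conv (?a (n - 1)) (?a 1) J" using IH[of J "n - 1" 1] that by simp
      then have "fps_deriv (?a n J) = ?X (n - 1) 1 + subset_conv (?a (n - 1)) (?D (?a 1)) J"
        by (simp add: fps_deriv_subset_conv)
      also have "subset_conv (?a (n - 1)) (?D (?a 1)) J = ?X 1 (n - 1)" by (rule subset_conv_commute)
      also have "?X (n - 1) 1 = fps_const (real (n - 1)) * ?X 1 (n - 1)" using mul[of "n - 1" 1] that by simp
      also have "\<dots> + ?X 1 (n - 1) = fps_const (real n) * ?X 1 (n - 1)"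
        using that by (simp add: fps_eq_iff algebra_simps of_nat_diff)
      finally show ?thesis .
    qed
    have X: "?X r s = fps_const (real r / real (r + s)) * fps_deriv (?a (r + s) J)" if "r \<ge> 1" "s \<ge> 1" for r s
    proof -
      have t: "2 \<le> r + s" using that by simp
      show ?thesis unfolding top[OF t] mul[OF that] using that by (simp add: fps_eq_iff)
    qed
    have "subset_conv (?a r) (?a s) I =
       fps_const (real r / real (r + c i)) * ?X (r + c i) s +
       fps_const (real s / real (s + c i)) * ?X (s + c i) r"
    proof -
      have fin: "finite A" "i \<notin> A" if "A \<subseteq> J" for A using that J by (auto intro: finite_subset)
      have "subset_conv (\<lambda>A. ?a r (insert i A)) (?a s) J =
          subset_conv (\<lambda>A. fps_const (real r / real (r + c i)) * fps_deriv (?a (r + c i) A)) (?a s) J"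
        using psubset.prems fin by (intro subset_conv_cong) (auto simp: hurwitz_insert)
      moreover have "subset_conv (?a r) (\<lambda>A. ?a s (insert i A)) J =
          subset_conv (?a r) (\<lambda>A. fps_const (real s / real (s + c i)) * fps_deriv (?a (s + c i) A)) J"
        using psubset.prems fin by (intro subset_conv_cong) (auto simp: hurwitz_insert)
      ultimately show ?thesis
        unfolding J(3) subset_conv_insert[OF J(1,2)]
        by (simp only: subset_conv_const subset_conv_commute[of "?a r"])
    qed
    also have "?X (r + c i) s = fps_const (real (r + c i) / real (r + s + c i)) * fps_deriv (?a (r + s + c i) J)"
      using X[of "r + c i" s] psubset.prems by (simp add: add_ac)
    also have "?X (s + c i) r = fps_const (real (s + c i) / real (r + s + c i)) * fps_deriv (?a (r + s + c i) J)"
      using X[of "s + c i" r] psubset.prems by (simp add: add_ac)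
    also have "fps_const (real r / real (r + c i)) * (fps_const (real (r + c i) / real (r + s + c i)) * fps_deriv (?a (r + s + c i) J)) +
        fps_const (real s / real (s + c i)) * (fps_const (real (s + c i) / real (r + s + c i)) * fps_deriv (?a (r + s + c i) J)) =
        fps_const (real (r + s) / real (r + s + c i)) * fps_deriv (?a (r + s + c i) J)"
    proof -
      have "real r / real (r + c i) * (real (r + c i) / real (r + s + c i)) = real r / real (r + s + c i)"
        "real s / real (s + c i) * (real (s + c i) / real (r + s + c i)) = real s / real (r + s + c i)"
        using psubset.prems by simp_all
      then show ?thesis
        by (simp only: mult.assoc[symmetric] fps_const_mult distrib_right[symmetric] fps_const_add
            add_divide_distrib[symmetric] of_nat_add[of r s])
    qed
    also have "\<dots> = ?a (r + s) I"
      using hurwitz_insert[OF J(1,2), of "r + s"] psubset.prems by (simp add: J(3))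
    finally show ?thesis .
  qed
qed

section \<open>Closed form of the leading coefficient\<close>

lemma fps_higher_deriv_nth_0:
  fixes f :: "real fps"
  shows "(fps_deriv ^^ k) f $ 0 = fact k * f $ k"
proof -
  have "fact n * ((fps_deriv ^^ k) f $ n) = fact (n + k) * f $ (n + k)" for n
  proof (induction k arbitrary: n)
    case (Suc k)
    have "fact n * ((fps_deriv ^^ Suc k) f $ n) = fact (Suc n) * ((fps_deriv ^^ k) f $ Suc n)"
      by (simp add: algebra_simps)
    also have "\<dots> = fact (Suc n + k) * f $ (Suc n + k)" by (rule Suc.IH)
    finally show ?case by simp
  qed simp
  from this[of 0] show ?thesis by simp
qed

text \<open>The exponential generating function of what happens on a single edge: besides the step
  that is already there, m further walks use it, each in one of 2 directions, so that its
  multiplicity is m + 1.\<close>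

definition branching_series :: "(nat \<Rightarrow> real) \<Rightarrow> real fps" where
  "branching_series V = Abs_fps (\<lambda>m. 2 ^ m * V (Suc m) / fact m)"

lemma top_edges_insert:
  "finite J \<Longrightarrow> \<rho> \<notin> J \<Longrightarrow> 1 \<le> l \<rho> \<Longrightarrow> top_edges (insert \<rho> J) l = l \<rho> + (\<Sum>i\<in>J. l i - 1)"
  by (simp add: top_edges_def)

text \<open>Induction on the number of steps beyond the first of each walk. If all walks have one
  step, there is a single common edge; otherwise a walk with at least two steps is cut and its
  pieces are recombined by the multiplicativity of \<open>hurwitz\<close>.\<close>

theorem lead_sum_closed_form:
  assumes "finite I" "I \<noteq> {}" "\<forall>i\<in>I. 1 \<le> l i"
  shows "lead_sum V I l = (\<Prod>i\<in>I. real (l i)) / real (top_edges I l) *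
    (fps_deriv ^^ (card I - 1)) (branching_series V ^ top_edges I l) $ 0"
  using assms
proof (induction "\<Sum>i\<in>I. l i - 1" arbitrary: I l rule: less_induct)
  case less
  let ?G = "branching_series V"
  \<comment> \<open>With r the length of \<rho> and c i one less than the length of walk i, the
    quotient of \<open>l \<rho>\<close> by the number of edges is the prefactor of
    \<open>hurwitz\<close>. Hence cutting \<rho> changes only r and the set of walks, and the
    product of the other lengths splits off.\<close>
  have root: "(\<Prod>i\<in>insert \<rho> J. real (l i)) / real (top_edges (insert \<rho> J) l) *
      (fps_deriv ^^ (card (insert \<rho> J) - 1)) (?G ^ top_edges (insert \<rho> J) l) $ 0 =
      (\<Prod>i\<in>J. real (l i)) * hurwitz ?G (\<lambda>i. l i - 1) (l \<rho>) J $ 0"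
    if "finite J" "\<rho> \<notin> J" "1 \<le> l \<rho>" for J \<rho> and l :: "'a \<Rightarrow> nat"
    using that by (simp add: hurwitz_def top_edges_insert)
  show ?case
  proof (cases "\<exists>\<rho>\<in>I. 2 \<le> l \<rho>")
    case False
    then have l1: "\<And>i. i \<in> I \<Longrightarrow> l i = 1" using less.prems(3) by force
    then have t: "top_edges I l = 1" "(\<Sum>i\<in>I. l i) = card I" "(\<Prod>i\<in>I. real (l i)) = 1"
      by (simp_all add: top_edges_def)
    have "lead_sum V I l = 2 ^ (card I - 1) * V (card I)"
      using sum_two_vertex_patterns[OF less.prems, where V = V] unfolding lead_sum_def t by (simp add: numeral_2_eq_2)
    moreover obtain m where "card I = Suc m" using less.prems(1,2) by (cases "card I") auto
    ultimately show ?thesis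
      unfolding t by (simp add: fps_higher_deriv_nth_0 branching_series_def)
  next
    case True
    then obtain \<rho> where rho: "\<rho> \<in> I" "2 \<le> l \<rho>" by auto
    define J where "J = I - {\<rho>}"
    define b where "b = l \<rho> - 1"
    have J: "finite J" "\<rho> \<notin> J" "I = insert \<rho> J" using less.prems(1) rho by (auto simp: J_def)
    have lJ: "\<forall>i\<in>J. 1 \<le> l i" using less.prems(3) J(3) by simp
    interpret split_walk J l \<rho> b
      by standard (use J rho lJ in \<open>auto simp: b_def\<close>)
    let ?c = "\<lambda>i. l i - 1"
    have piece: "lead_sum V (insert \<rho> A) (l(\<rho> := d)) = (\<Prod>i\<in>A. real (l i)) * hurwitz ?G ?c d A $ 0"
      if A: "A \<subseteq> J" and d: "1 \<le> d" "d < l \<rho>" for A d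
    proof -
      have A': "finite A" "\<rho> \<notin> A" using A J(1,2) by (auto intro: finite_subset)
      let ?l = "l(\<rho> := d)"
      have cong: "(\<Sum>i\<in>A. ?l i - 1) = (\<Sum>i\<in>A. l i - 1)" "(\<Prod>i\<in>A. real (?l i)) = (\<Prod>i\<in>A. real (l i))"
        using A' by (intro sum.cong prod.cong; auto)+
      have "(\<Sum>i\<in>insert \<rho> A. ?l i - 1) < (\<Sum>i\<in>I. l i - 1)"
      proof -
        have "(\<Sum>i\<in>insert \<rho> A. ?l i - 1) = (d - 1) + (\<Sum>i\<in>A. l i - 1)"
          using sum.insert[OF A', of "\<lambda>i. ?l i - 1"] by (simp only: fun_upd_same cong)
        also have "\<dots> < (l \<rho> - 1) + (\<Sum>i\<in>J. l i - 1)"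
          using sum_mono2[OF J(1) A, of ?c] d by simp
        finally show ?thesis using J by simp
      qed
      moreover have "\<forall>i\<in>insert \<rho> A. 1 \<le> ?l i" using d lJ A by auto
      ultimately have "lead_sum V (insert \<rho> A) ?l = (\<Prod>i\<in>insert \<rho> A. real (?l i)) / real (top_edges (insert \<rho> A) ?l) *
          (fps_deriv ^^ (card (insert \<rho> A) - 1)) (?G ^ top_edges (insert \<rho> A) ?l) $ 0"
        using A' by (intro less.hyps) auto
      also have "\<dots> = (\<Prod>i\<in>A. real (?l i)) * hurwitz ?G (\<lambda>i. ?l i - 1) (?l \<rho>) A $ 0"
        using A' d by (intro root) auto
      also have "hurwitz ?G (\<lambda>i. ?l i - 1) (?l \<rho>) A = hurwitz ?G ?c d A"
        unfolding hurwitz_def cong by simp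
      finally show ?thesis by (simp only: cong)
    qed
    have "lead_sum V I l = (\<Sum>A\<in>Pow J. lead_sum V (insert \<rho> A) (l(\<rho> := Suc 0)) * lead_sum V (insert \<rho> (J - A)) (l(\<rho> := b)))"
      unfolding J(3) by (rule lead_sum_split)
    also have "\<dots> = (\<Sum>A\<in>Pow J. (\<Prod>i\<in>J. real (l i)) * (hurwitz ?G ?c 1 A * hurwitz ?G ?c b (J - A)) $ 0)"
    proof (rule sum.cong[OF refl])
      fix A assume "A \<in> Pow J"
      then have A: "A \<subseteq> J" by simp
      have "(\<Prod>i\<in>J. real (l i)) = (\<Prod>i\<in>A. real (l i)) * (\<Prod>i\<in>J - A. real (l i))"
        using prod.subset_diff[OF A J(1)] by (simp add: mult.commute)
      then show "lead_sum V (insert \<rho> A) (l(\<rho> := Suc 0)) * lead_sum V (insert \<rho> (J - A)) (l(\<rho> := b)) =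
          (\<Prod>i\<in>J. real (l i)) * (hurwitz ?G ?c 1 A * hurwitz ?G ?c b (J - A)) $ 0"
        using piece[OF A, of "Suc 0"] piece[of "J - A" b] rho(2) by (simp add: b_def)
    qed
    also have "\<dots> = (\<Prod>i\<in>J. real (l i)) * subset_conv (hurwitz ?G ?c 1) (hurwitz ?G ?c b) J $ 0"
      by (simp add: subset_conv_def fps_sum_nth sum_distrib_left)
    also have "\<dots> = (\<Prod>i\<in>J. real (l i)) * hurwitz ?G ?c (l \<rho>) J $ 0"
      using subset_conv_hurwitz[OF J(1), of 1 b] rho(2) by (simp add: b_def)
    also have "\<dots> = (\<Prod>i\<in>I. real (l i)) / real (top_edges I l) *
        (fps_deriv ^^ (card I - 1)) (?G ^ top_edges I l) $ 0"
      unfolding J(3) using root[OF J(1,2)] rho(2) by simp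
    finally show ?thesis .
  qed
qed

section \<open>Extraction of the coefficient\<close>

lemma fps_power_nth_scale:
  fixes f :: "real fps"
  shows "(Abs_fps (\<lambda>m. a ^ m * f $ m)) ^ n $ m = a ^ m * (f ^ n) $ m"
proof (induction n arbitrary: m)
  case (Suc n)
  have "(Abs_fps (\<lambda>m. a ^ m * f $ m)) ^ Suc n $ m = (\<Sum>i=0..m. (a ^ i * f $ i) * (a ^ (m - i) * (f ^ n) $ (m - i)))"
    by (simp add: fps_mult_nth Suc.IH)
  also have "\<dots> = (\<Sum>i=0..m. a ^ m * (f $ i * (f ^ n) $ (m - i)))"
  proof (rule sum.cong[OF refl])
    fix i assume "i \<in> {0..m}"
    then have "a ^ m = a ^ i * a ^ (m - i)" by (simp flip: power_add)
    then show "(a ^ i * f $ i) * (a ^ (m - i) * (f ^ n) $ (m - i)) = a ^ m * (f $ i * (f ^ n) $ (m - i))"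
      by (simp add: mult_ac)
  qed
  finally show ?case by (simp add: fps_mult_nth sum_distrib_left)
qed simp

lemma fps_power_nth_cong:
  fixes f g :: "real fps"
  assumes "\<And>i. i \<le> m \<Longrightarrow> f $ i = g $ i"
  shows "(f ^ n) $ m = (g ^ n) $ m"
proof -
  have "(f ^ n) $ j = (g ^ n) $ j" if "j \<le> m" for j
    using that
  proof (induction n arbitrary: j)
    case (Suc n)
    then show ?case using assms by (auto simp: fps_mult_nth intro!: sum.cong)
  qed simp
  then show ?thesis by simp
qed

text \<open>The sequences of \<open>cum_seqs\<close> with length \<open>p\<close> and weight
  \<open>m\<close> decoupled, as an induction on \<open>p\<close> requires.\<close>

definition bounded_seqs :: "nat \<Rightarrow> nat \<Rightarrow> nat \<Rightarrow> (nat \<Rightarrow> nat) set" where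
  "bounded_seqs p u m = {s \<in> {1..p} \<rightarrow>\<^sub>E UNIV. (\<Sum>i = 1..p. s i) = u \<and> (\<Sum>i = 1..p. i * s i) = m}"

lemma finite_bounded_seqs: "finite (bounded_seqs p u m)"
proof (rule finite_subset)
  show "bounded_seqs p u m \<subseteq> {1..p} \<rightarrow>\<^sub>E {..u}"
  proof
    fix s assume s: "s \<in> bounded_seqs p u m"
    have "s i \<le> u" if "i \<in> {1..p}" for i
      using s member_le_sum[OF that, of s] by (auto simp: bounded_seqs_def)
    with s show "s \<in> {1..p} \<rightarrow>\<^sub>E {..u}" by (auto simp: bounded_seqs_def PiE_iff)
  qed
qed (auto intro: finite_PiE)

text \<open>The multinomial theorem by peeling off the highest monomial: its multiplicity j becomes
  the value of \<open>s\<close> at p + 1, and \<open>u choose j\<close> turns the factorial of u - j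
  into that of u divided by that of j.\<close>

lemma fps_multinomial_nth:
  fixes \<beta> :: "nat \<Rightarrow> real"
  shows "((\<Sum>i=1..p. fps_const (\<beta> i) * fps_X ^ i) ^ u) $ m =
    fact u * (\<Sum>s\<in>bounded_seqs p u m. \<Prod>i=1..p. 1 / fact (s i) * \<beta> i ^ s i)"
proof (induction p arbitrary: u m)
  case 0
  have "bounded_seqs 0 u m = (if u = 0 \<and> m = 0 then {\<lambda>_. undefined} else {})"
    by (auto simp: bounded_seqs_def)
  then show ?case by (cases "u = 0") (auto simp: zero_power)
next
  case (Suc p)
  let ?B = "\<Sum>i=1..p. fps_const (\<beta> i) * fps_X ^ i"
  let ?w = "\<lambda>p s. \<Prod>i=1..p. 1 / fact (s i) * \<beta> i ^ s i"
  let ?J = "{j. j \<le> u \<and> Suc p * j \<le> m}"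
  have finJ: "finite ?J" by (rule finite_subset[of _ "{..u}"]) auto
  have "((\<Sum>i=1..Suc p. fps_const (\<beta> i) * fps_X ^ i) ^ u) $ m = ((fps_const (\<beta> (Suc p)) * fps_X ^ Suc p + ?B) ^ u) $ m"
    by (simp add: add.commute)
  also have "\<dots> = (\<Sum>j\<le>u. (of_nat (u choose j) * (fps_const (\<beta> (Suc p)) * fps_X ^ Suc p) ^ j * ?B ^ (u - j)) $ m)"
    by (simp add: binomial_ring fps_sum_nth)
  also have "\<dots> = (\<Sum>j\<le>u. if Suc p * j \<le> m then real (u choose j) * \<beta> (Suc p) ^ j * (?B ^ (u - j)) $ (m - Suc p * j) else 0)"
  proof (rule sum.cong[OF refl])
    fix j
    have "of_nat (u choose j) * (fps_const (\<beta> (Suc p)) * fps_X ^ Suc p) ^ j * ?B ^ (u - j) =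
      fps_X ^ (Suc p * j) * (fps_const (real (u choose j) * \<beta> (Suc p) ^ j) * ?B ^ (u - j))"
    proof -
      have "(fps_const (\<beta> (Suc p)) * fps_X ^ Suc p) ^ j = fps_const (\<beta> (Suc p) ^ j) * fps_X ^ (Suc p * j)"
        by (simp only: power_mult_distrib fps_const_power power_mult)
      then show ?thesis
        by (simp only: fps_of_nat[symmetric] fps_const_mult[symmetric] mult_ac)
    qed
    then show "(of_nat (u choose j) * (fps_const (\<beta> (Suc p)) * fps_X ^ Suc p) ^ j * ?B ^ (u - j)) $ m =
      (if Suc p * j \<le> m then real (u choose j) * \<beta> (Suc p) ^ j * (?B ^ (u - j)) $ (m - Suc p * j) else 0)"
      by (simp only: fps_X_power_mult_nth fps_mult_left_const_nth) auto
  qed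
  also have "\<dots> = (\<Sum>j\<in>?J. real (u choose j) * \<beta> (Suc p) ^ j * (?B ^ (u - j)) $ (m - Suc p * j))"
    using finJ by (intro sum.mono_neutral_cong_right) auto
  also have "\<dots> = (\<Sum>j\<in>?J. \<Sum>s\<in>bounded_seqs p (u - j) (m - Suc p * j). fact u * (1 / fact j * \<beta> (Suc p) ^ j * ?w p s))"
  proof (rule sum.cong[OF refl])
    fix j assume j: "j \<in> ?J"
    then have binom: "real (u choose j) * fact (u - j) = fact u * (1 / fact j)" by (simp add: binomial_fact)
    have "real (u choose j) * \<beta> (Suc p) ^ j * (fact (u - j) * S) = fact u * (1 / fact j * \<beta> (Suc p) ^ j * S)" for S
    proof -
      have "real (u choose j) * \<beta> (Suc p) ^ j * (fact (u - j) * S) =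
          (real (u choose j) * fact (u - j)) * (\<beta> (Suc p) ^ j * S)" by (simp only: mult_ac)
      also have "\<dots> = fact u * (1 / fact j) * (\<beta> (Suc p) ^ j * S)" by (simp only: binom)
      finally show ?thesis by (simp only: mult_ac)
    qed
    then show "real (u choose j) * \<beta> (Suc p) ^ j * (?B ^ (u - j)) $ (m - Suc p * j) =
      (\<Sum>s\<in>bounded_seqs p (u - j) (m - Suc p * j). fact u * (1 / fact j * \<beta> (Suc p) ^ j * ?w p s))"
      by (simp only: Suc.IH sum_distrib_left)
  qed
  also have "\<dots> = (\<Sum>(j, s)\<in>(SIGMA j:?J. bounded_seqs p (u - j) (m - Suc p * j)). fact u * (1 / fact j * \<beta> (Suc p) ^ j * ?w p s))"
    using finJ finite_bounded_seqs by (intro sum.Sigma) auto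
  also have "\<dots> = (\<Sum>s\<in>bounded_seqs (Suc p) u m. fact u * ?w (Suc p) s)"
  proof (rule sum.reindex_bij_witness[where i = "\<lambda>s. (s (Suc p), restrict s {1..p})" and j = "\<lambda>(j, s). s(Suc p := j)"])
    fix a assume "a \<in> (SIGMA j:?J. bounded_seqs p (u - j) (m - Suc p * j))"
    then obtain j s where a: "a = (j, s)" "j \<le> u" "Suc p * j \<le> m" and s: "s \<in> bounded_seqs p (u - j) (m - Suc p * j)" by auto
    have sE: "s \<in> {1..p} \<rightarrow>\<^sub>E UNIV" using s by (simp add: bounded_seqs_def)
    have "restrict (s(Suc p := j)) {1..p} = s"
    proof
      fix i show "restrict (s(Suc p := j)) {1..p} i = s i"
        using PiE_arb[OF sE, of i] by (cases "i \<in> {1..p}") auto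
    qed
    then show "(\<lambda>s. (s (Suc p), restrict s {1..p})) (case a of (j, s) \<Rightarrow> s(Suc p := j)) = a" by (simp add: a)
    have cong: "(\<Sum>i=1..p. (s(Suc p := j)) i) = (\<Sum>i=1..p. s i)" "(\<Sum>i=1..p. i * (s(Suc p := j)) i) = (\<Sum>i=1..p. i * s i)"
      "?w p (s(Suc p := j)) = ?w p s"
      by (intro sum.cong prod.cong; auto)+
    have "s(Suc p := j) \<in> {1..Suc p} \<rightarrow>\<^sub>E UNIV" using sE by (auto simp: PiE_iff extensional_def)
    then show "(case a of (j, s) \<Rightarrow> s(Suc p := j)) \<in> bounded_seqs (Suc p) u m"
      using s a by (simp add: bounded_seqs_def cong del: fun_upd_apply)
    show "fact u * ?w (Suc p) (case a of (j, s) \<Rightarrow> s(Suc p := j)) =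
      (case a of (j, s) \<Rightarrow> fact u * (1 / fact j * \<beta> (Suc p) ^ j * ?w p s))"
      using cong(3) by (simp add: a mult_ac)
  next
    fix s assume s: "s \<in> bounded_seqs (Suc p) u m"
    then have sE: "s \<in> {1..Suc p} \<rightarrow>\<^sub>E UNIV" by (simp add: bounded_seqs_def)
    show "(case (s (Suc p), restrict s {1..p}) of (j, s) \<Rightarrow> s(Suc p := j)) = s"
    proof
      fix i
      show "(case (s (Suc p), restrict s {1..p}) of (j, s) \<Rightarrow> s(Suc p := j)) i = s i"
        using PiE_arb[OF sE, of i] by (cases "i \<in> {1..Suc p}") auto
    qed
    have "(\<Sum>i=1..p. s i) + s (Suc p) = u" "(\<Sum>i=1..p. i * s i) + Suc p * s (Suc p) = m"
      using s by (auto simp: bounded_seqs_def)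
    moreover have "(\<Sum>i=1..p. restrict s {1..p} i) = (\<Sum>i=1..p. s i)" "(\<Sum>i=1..p. i * restrict s {1..p} i) = (\<Sum>i=1..p. i * s i)"
      by (intro sum.cong; auto)+
    ultimately show "(s (Suc p), restrict s {1..p}) \<in> (SIGMA j:?J. bounded_seqs p (u - j) (m - Suc p * j))"
      by (auto simp: bounded_seqs_def)
  qed
  finally show ?case by (simp add: sum_distrib_left)
qed

definition hypertree_sum :: "(nat \<Rightarrow> real) \<Rightarrow> nat \<Rightarrow> nat \<Rightarrow> real" where
  "hypertree_sum V q k = 
     2 ^ (k - 1) * real q ^ k * fact (k - 1) / real (k * (q - 1) + 1) *
     (\<Sum>u = 0..k - 1. fact u * real ((k * (q - 1) + 1) choose u) *
       (\<Sum>s \<in> bounded_seqs (k - 1) u (k - 1).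
          V 1 powi (int (k * (q - 1) + 1) - int u) *
          (\<Prod>i = 1..k - 1. 1 / fact (s i) * (V (i + 1) / fact i) ^ s i)))"

text \<open>For equal lengths the closed form is one coefficient of a power of the branching series.
  Rescaling the variable by 2 extracts the powers of 2, and the binomial theorem separates the
  constant term \<open>V 1\<close>, whose exponent is the s_0 of the formula.\<close>

theorem lead_sum_eq_hypertree_sum:
  assumes "1 \<le> q" "1 \<le> k"
  shows "lead_sum V {..<k} (\<lambda>_. q) = hypertree_sum V q k"
proof -
  define n where "n = k * (q - 1) + 1"
  define G where "G = Abs_fps (\<lambda>m. V (Suc m) / fact m)"
  define B where "B = (\<Sum>i=1..k - 1. fps_const (V (Suc i) / fact i) * fps_X ^ i)"
  have top: "top_edges {..<k} (\<lambda>_. q) = n" by (simp add: top_edges_def n_def)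
  have "lead_sum V {..<k} (\<lambda>_. q) =
      real q ^ k / real n * (fact (k - 1) * (branching_series V ^ n) $ (k - 1))"
    using lead_sum_closed_form[of "{..<k}" "\<lambda>_. q" V] assms
    by (auto simp: top fps_higher_deriv_nth_0 lessThan_empty_iff)
  also have "branching_series V = Abs_fps (\<lambda>m. 2 ^ m * G $ m)"
    by (simp add: branching_series_def G_def)
  also have "(\<dots> ^ n) $ (k - 1) = 2 ^ (k - 1) * (G ^ n) $ (k - 1)" by (rule fps_power_nth_scale)
  also have "(G ^ n) $ (k - 1) = ((B + fps_const (V 1)) ^ n) $ (k - 1)"
  proof (rule fps_power_nth_cong)
    fix i assume i: "i \<le> k - 1"
    have "B $ i = (\<Sum>j=1..k - 1. if i = j then V (Suc j) / fact j else 0)"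
      unfolding B_def fps_sum_nth by (intro sum.cong) (auto simp: fps_X_power_nth)
    then show "G $ i = (B + fps_const (V 1)) $ i"
      using i by (cases "i = 0") (auto simp: G_def)
  qed
  also have "\<dots> = (\<Sum>u\<le>n. real (n choose u) * V 1 ^ (n - u) * (B ^ u) $ (k - 1))"
  proof -
    have "(B + fps_const (V 1)) ^ n = (\<Sum>u\<le>n. fps_const (real (n choose u) * V 1 ^ (n - u)) * B ^ u)"
      unfolding binomial_ring
      by (intro sum.cong refl) (simp only: fps_of_nat[symmetric] fps_const_mult[symmetric] fps_const_power mult_ac)
    then show ?thesis by (simp add: fps_sum_nth)
  qed
  \<comment> \<open>\<open>B\<close> has no constant term, so u above k - 1 contributes nothing. For
    u above n the binomial coefficient is 0, which also neutralises the negative exponents of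
    \<open>powi\<close>.\<close>
  also have "\<dots> = (\<Sum>u=0..k - 1. real (n choose u) * V 1 powi (int n - int u) * (B ^ u) $ (k - 1))"
  proof -
    have B0: "(B ^ u) $ (k - 1) = 0" if "u > k - 1" for u
    proof -
      have "B $ 0 = 0" by (simp add: B_def fps_sum_nth)
      then show ?thesis using startsby_zero_power_prefix[of B u] that by auto
    qed
    have "(\<Sum>u\<le>n. real (n choose u) * V 1 ^ (n - u) * (B ^ u) $ (k - 1)) =
        (\<Sum>u\<in>{..n} \<inter> {0..k - 1}. real (n choose u) * V 1 ^ (n - u) * (B ^ u) $ (k - 1))"
      using B0 by (intro sum.mono_neutral_right) auto
    also have "\<dots> = (\<Sum>u\<in>{..n} \<inter> {0..k - 1}. real (n choose u) * V 1 powi (int n - int u) * (B ^ u) $ (k - 1))"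
      by (intro sum.cong refl) (auto simp: of_nat_diff[symmetric] power_int_of_nat simp del: of_nat_diff)
    also have "\<dots> = (\<Sum>u=0..k - 1. real (n choose u) * V 1 powi (int n - int u) * (B ^ u) $ (k - 1))"
      by (intro sum.mono_neutral_left) auto
    finally show ?thesis .
  qed
  also have "\<dots> = (\<Sum>u = 0..k - 1. fact u * real (n choose u) * (\<Sum>s \<in> bounded_seqs (k - 1) u (k - 1).
      V 1 powi (int n - int u) * (\<Prod>i = 1..k - 1. 1 / fact (s i) * (V (i + 1) / fact i) ^ s i)))"
    unfolding B_def fps_multinomial_nth by (simp add: sum_distrib_left mult_ac)
  finally show ?thesis
    unfolding hypertree_sum_def n_def[symmetric] by (simp add: mult_ac)
qed

section \<open>Riemann sums over the lattice\<close>

text \<open>The convergence is uniform in the finite set \<open>Z\<close> once it contains a window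
  of width proportional to R. In the application \<open>Z\<close> is the box seen from a vertex, so
  it varies with the position of that vertex.\<close>

definition riemann_to :: "(real \<Rightarrow> real) \<Rightarrow> real \<Rightarrow> bool" where
  "riemann_to f V \<longleftrightarrow> (\<forall>\<epsilon>>0. \<exists>B>0. \<forall>\<^sub>F R in at_top. \<forall>Z. finite Z \<longrightarrow> {z::int. \<bar>real_of_int z\<bar> \<le> B * R} \<subseteq> Z \<longrightarrow>
     \<bar>(\<Sum>z\<in>Z. f (real_of_int z / R)) / R - V\<bar> \<le> \<epsilon>)"

text \<open>The envelope \<open>g\<close> dominates \<open>f\<close> on a whole unit neighbourhood,
  because a step function of mesh 1 / R with R at least 1 evaluates \<open>f\<close> at a point up
  to distance 1 away.\<close>

locale riemann_dominated =
  fixes f g :: "real \<Rightarrow> real"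
  assumes cont: "continuous_on UNIV f" and nonneg: "\<And>s. 0 \<le> f s"
    and int: "integrable lborel g" and dom: "\<And>s t. \<bar>t - s\<bar> \<le> 1 \<Longrightarrow> f t \<le> g s"
begin

lemma f_measurable [measurable]: "f \<in> borel_measurable borel"
  by (rule borel_measurable_continuous_onI[OF cont])

lemma g_nonneg: "0 \<le> g s"
  using dom[of s s] nonneg[of s] by simp

lemma f_le_g: "f s \<le> g s" using dom[of s s] by simp

lemma f_integrable: "integrable lborel f"
  by (rule Bochner_Integration.integrable_bound[OF int]) (use nonneg f_le_g g_nonneg in auto)

lemma floor_close:
  assumes "R \<ge> 1"
  shows "\<bar>real_of_int \<lfloor>R * s\<rfloor> / R - s\<bar> \<le> 1 / R" "\<bar>real_of_int \<lfloor>R * s\<rfloor> / R - s\<bar> \<le> 1"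
proof -
  have "\<bar>real_of_int \<lfloor>R * s\<rfloor> - R * s\<bar> \<le> 1" by linarith
  moreover have "\<bar>real_of_int \<lfloor>R * s\<rfloor> / R - s\<bar> = \<bar>real_of_int \<lfloor>R * s\<rfloor> - R * s\<bar> / R"
    using assms by (simp add: field_simps abs_if)
  ultimately show "\<bar>real_of_int \<lfloor>R * s\<rfloor> / R - s\<bar> \<le> 1 / R"
    using assms by (simp add: divide_right_mono)
  also have "1 / R \<le> 1" using assms by simp
  finally show "\<bar>real_of_int \<lfloor>R * s\<rfloor> / R - s\<bar> \<le> 1" .
qed

definition step :: "real \<Rightarrow> int set \<Rightarrow> real \<Rightarrow> real" where
  "step R Z s = (if \<lfloor>R * s\<rfloor> \<in> Z then f (real_of_int \<lfloor>R * s\<rfloor> / R) else 0)"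

lemma step_integral:
  assumes "R \<ge> 1" "finite Z"
  shows "integrable lborel (step R Z)" "(LINT s|lborel. step R Z s) = (\<Sum>z\<in>Z. f (real_of_int z / R)) / R"
proof -
  let ?I = "\<lambda>z::int. {real_of_int z / R..<(real_of_int z + 1) / R}"
  have mem: "s \<in> ?I z \<longleftrightarrow> \<lfloor>R * s\<rfloor> = z" for s z
    using assms(1) by (auto simp: field_simps floor_eq_iff mult.commute)
  have eq: "step R Z = (\<lambda>s. \<Sum>z\<in>Z. f (real_of_int z / R) * indicator (?I z) s)"
  proof
    fix s
    have "(\<Sum>z\<in>Z. f (real_of_int z / R) * indicator (?I z) s) =
        (\<Sum>z\<in>Z. if z = \<lfloor>R * s\<rfloor> then f (real_of_int z / R) else 0)"
      by (intro sum.cong refl) (simp only: indicator_def mem, auto)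
    then show "step R Z s = (\<Sum>z\<in>Z. f (real_of_int z / R) * indicator (?I z) s)"
      using assms(2) by (simp add: step_def)
  qed
  have em: "emeasure lborel (?I z) = ennreal (1 / R)" for z
    using assms(1) by (simp add: divide_right_mono diff_divide_distrib[symmetric])
  have int: "integrable lborel (indicat_real (?I z))" for z
    by (rule integrable_real_indicator) (simp_all add: em)
  show "integrable lborel (step R Z)" unfolding eq using int by simp
  have "measure lborel (?I z) = 1 / R" for z using assms(1) by (simp add: measure_def em)
  then show "(LINT s|lborel. step R Z s) = (\<Sum>z\<in>Z. f (real_of_int z / R)) / R"
    unfolding eq using int by (simp add: sum_divide_distrib)
qed

lemma step_le: "R \<ge> 1 \<Longrightarrow> step R Z s \<le> g s"
  using dom[OF floor_close(2)] g_nonneg by (simp add: step_def)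

lemma riemann_sum_le:
  assumes "R \<ge> 1" "finite Z"
  shows "(\<Sum>z\<in>Z. f (real_of_int z / R)) / R \<le> (LINT s|lborel. g s)"
  unfolding step_integral(2)[OF assms, symmetric]
  by (rule integral_mono[OF step_integral(1)[OF assms] int]) (rule step_le[OF assms(1)])

text \<open>Dominated convergence is used twice: for the step functions as R grows, and for the tail
  of \<open>f\<close> outside a window. The set \<open>Z\<close> affects only the tail, which makes
  the estimate uniform in it.\<close>

lemma riemann_to_integral: "riemann_to f (LINT s|lborel. f s)"
  unfolding riemann_to_def
proof (intro allI impI)
  fix \<epsilon> :: real assume "\<epsilon> > 0"
  define FR where "FR R s = f (real_of_int \<lfloor>R * s\<rfloor> / R)" for R s
  have [measurable]: "FR R \<in> borel_measurable borel" for R unfolding FR_def by measurable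
  have FR: "0 \<le> FR R s" "R \<ge> 1 \<Longrightarrow> FR R s \<le> g s" for R s
    using nonneg dom[OF floor_close(2)] by (auto simp: FR_def)
  have FRint: "integrable lborel (FR R)" if "R \<ge> 1" for R
  proof (rule Bochner_Integration.integrable_bound[OF int])
    show "AE s in lborel. norm (FR R s) \<le> norm (g s)"
      by (rule AE_I2) (use FR that g_nonneg in simp)
  qed simp
  have lim0: "((\<lambda>R. LINT s|lborel. \<bar>FR R s - f s\<bar>) \<longlongrightarrow> (LINT s|(lborel :: real measure). (0 :: real))) at_top"
  proof (rule integral_dominated_convergence_at_top)
    show "integrable lborel (\<lambda>s. 2 * g s)" using int by simp
    show "\<forall>\<^sub>F R in at_top. AE s in lborel. norm \<bar>FR R s - f s\<bar> \<le> 2 * g s"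
      using eventually_ge_at_top[of "1::real"]
    proof eventually_elim
      case (elim R)
      show ?case
      proof (rule AE_I2)
        fix s show "norm \<bar>FR R s - f s\<bar> \<le> 2 * g s"
          using FR(1)[of R s] FR(2)[OF elim, of s] nonneg[of s] f_le_g[of s] by simp
      qed
    qed
    show "AE s in lborel. ((\<lambda>R. \<bar>FR R s - f s\<bar>) \<longlongrightarrow> 0) at_top"
    proof (rule AE_I2)
      fix s
      have "((\<lambda>R. real_of_int \<lfloor>R * s\<rfloor> / R - s) \<longlongrightarrow> 0) at_top"
      proof (rule Lim_null_comparison)
        show "\<forall>\<^sub>F R in at_top. norm (real_of_int \<lfloor>R * s\<rfloor> / R - s) \<le> 1 / R"
          using eventually_ge_at_top[of "1::real"] by eventually_elim (use floor_close in auto)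
        show "((\<lambda>R. 1 / R :: real) \<longlongrightarrow> 0) at_top" 
          by (rule tendsto_divide_0[OF tendsto_const]) (simp add: filterlim_at_top_imp_at_infinity filterlim_ident)
      qed
      then have "((\<lambda>R. real_of_int \<lfloor>R * s\<rfloor> / R) \<longlongrightarrow> s) at_top" by (simp add: LIM_zero_iff)
      moreover have "isCont f s" using cont by (simp add: continuous_on_eq_continuous_at)
      ultimately have "((\<lambda>R. FR R s) \<longlongrightarrow> f s) at_top" unfolding FR_def by (rule isCont_tendsto_compose[rotated])
      then show "((\<lambda>R. \<bar>FR R s - f s\<bar>) \<longlongrightarrow> 0) at_top" by (simp add: LIM_zero_iff tendsto_rabs_zero_iff)
    qed
  qed measurable
  \<comment> \<open>The shift by 1 allows for rounding: for R at least 1, if the lattice point of s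
    lies outside the window of radius B R, then s exceeds B - 1 in modulus.\<close>
  have limB: "((\<lambda>B. LINT s|lborel. f s * indicator {s. \<bar>s\<bar> > B - 1} s) \<longlongrightarrow> (LINT s|(lborel :: real measure). (0 :: real))) at_top"
  proof (rule integral_dominated_convergence_at_top)
    show "integrable lborel g" by (rule int)
    show "\<forall>\<^sub>F B in at_top. AE s in lborel. norm (f s * indicator {s. \<bar>s\<bar> > B - 1} s) \<le> g s"
      using nonneg f_le_g g_nonneg by (intro always_eventually allI AE_I2) (auto simp: indicator_def)
    show "AE s in lborel. ((\<lambda>B. f s * indicator {s. \<bar>s\<bar> > B - 1} s) \<longlongrightarrow> 0) at_top"
    proof (rule AE_I2, rule tendsto_eventually)
      fix s show "\<forall>\<^sub>F B in at_top. f s * indicator {s. \<bar>s\<bar> > B - 1} s = 0"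
        using eventually_ge_at_top[of "\<bar>s\<bar> + 1"] by eventually_elim (auto simp: indicator_def)
    qed
  qed measurable
  have "\<forall>\<^sub>F B in at_top. (LINT s|lborel. f s * indicator {s. \<bar>s\<bar> > B - 1} s) < \<epsilon> / 2 \<and> B \<ge> 1"
    using limB \<open>\<epsilon> > 0\<close> by (intro eventually_conj eventually_ge_at_top order_tendstoD(2)[OF limB]) auto
  then obtain B where B: "(LINT s|lborel. f s * indicator {s. \<bar>s\<bar> > B - 1} s) < \<epsilon> / 2" "B \<ge> 1"
    by (auto dest: eventually_happens)
  have ev: "\<forall>\<^sub>F R in at_top. (LINT s|lborel. \<bar>FR R s - f s\<bar>) < \<epsilon> / 2"
    using \<open>\<epsilon> > 0\<close> by (intro order_tendstoD(2)[OF lim0]) auto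
  show "\<exists>B>0. \<forall>\<^sub>F R in at_top. \<forall>Z. finite Z \<longrightarrow> {z::int. \<bar>real_of_int z\<bar> \<le> B * R} \<subseteq> Z \<longrightarrow>
     \<bar>(\<Sum>z\<in>Z. f (real_of_int z / R)) / R - (LINT s|lborel. f s)\<bar> \<le> \<epsilon>"
  proof (rule exI[of _ B], intro conjI)
    show "0 < B" using B by simp
    show "\<forall>\<^sub>F R in at_top. \<forall>Z. finite Z \<longrightarrow> {z::int. \<bar>real_of_int z\<bar> \<le> B * R} \<subseteq> Z \<longrightarrow>
     \<bar>(\<Sum>z\<in>Z. f (real_of_int z / R)) / R - (LINT s|lborel. f s)\<bar> \<le> \<epsilon>"
      using ev eventually_ge_at_top[of "1::real"]
    proof eventually_elim
      case (elim R)
      show ?case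
      proof (intro allI impI)
        fix Z assume Z: "finite Z" "{z::int. \<bar>real_of_int z\<bar> \<le> B * R} \<subseteq> Z"
        let ?T = "\<lambda>s. f s * indicator {s. \<bar>s\<bar> > B - 1} s"
        have Tint: "integrable lborel ?T"
          by (rule Bochner_Integration.integrable_bound[OF int])
            (use nonneg f_le_g g_nonneg in \<open>auto simp: indicator_def\<close>)
        have pt: "\<bar>step R Z s - f s\<bar> \<le> \<bar>FR R s - f s\<bar> + ?T s" for s
        proof (cases "\<lfloor>R * s\<rfloor> \<in> Z")
          case True
          then show ?thesis using nonneg by (simp add: step_def FR_def)
        next
          case False
          then have "\<not> \<bar>real_of_int \<lfloor>R * s\<rfloor>\<bar> \<le> B * R" using Z(2) by auto
          then have "B * R < \<bar>R * s\<bar> + 1" by linarith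
          also have "\<bar>R * s\<bar> + 1 \<le> (\<bar>s\<bar> + 1) * R" using elim(2) by (simp add: abs_mult algebra_simps)
          finally have "B < \<bar>s\<bar> + 1" using elim(2) by simp
          then show ?thesis using False nonneg by (simp add: step_def)
        qed
        have "\<bar>(\<Sum>z\<in>Z. f (real_of_int z / R)) / R - (LINT s|lborel. f s)\<bar> =
            \<bar>LINT s|lborel. step R Z s - f s\<bar>"
          using step_integral[OF elim(2) Z(1)] f_integrable by simp
        also have "\<dots> \<le> (LINT s|lborel. \<bar>step R Z s - f s\<bar>)" by (rule integral_abs_bound)
        also have "\<dots> \<le> (LINT s|lborel. \<bar>FR R s - f s\<bar> + ?T s)"
          using step_integral(1)[OF elim(2) Z(1)] f_integrable FRint[OF elim(2)] Tint pt
          by (intro integral_mono) auto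
        also have "\<dots> = (LINT s|lborel. \<bar>FR R s - f s\<bar>) + (LINT s|lborel. ?T s)"
          using f_integrable FRint[OF elim(2)] Tint by (intro Bochner_Integration.integral_add) auto
        also have "\<dots> \<le> \<epsilon>" using B(1) elim(1) by simp
        finally show "\<bar>(\<Sum>z\<in>Z. f (real_of_int z / R)) / R - (LINT s|lborel. f s)\<bar> \<le> \<epsilon>" .
      qed
    qed
  qed
qed

end

section \<open>Integrable envelopes for the edge profiles\<close>

lemma power_exp_decreasing:
  fixes x y :: real
  assumes "0 \<le> x" "real m \<le> x" "x \<le> y"
  shows "(1 + y) ^ m * exp (- y) \<le> (1 + x) ^ m * exp (- x)"
proof -
  have "(1 + y) / (1 + x) = 1 + (y - x) / (1 + x)" using assms by (simp add: field_simps)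
  \<comment> \<open>The inequality 1 + t \<le> exp t replaces a derivative; the m-th power is then
    controlled because m is at most 1 + x.\<close>
  also have "\<dots> \<le> exp ((y - x) / (1 + x))" by (rule exp_ge_add_one_self)
  finally have "((1 + y) / (1 + x)) ^ m \<le> exp ((y - x) / (1 + x)) ^ m"
    using assms by (intro power_mono) auto
  also have "\<dots> = exp (real m * ((y - x) / (1 + x)))" by (rule exp_of_nat_mult[symmetric])
  also have "\<dots> \<le> exp (y - x)"
  proof -
    have "real m * (y - x) \<le> (1 + x) * (y - x)" using assms by (intro mult_right_mono) auto
    then show ?thesis using assms by (simp add: field_simps)
  qed
  finally have "(1 + y) ^ m / (1 + x) ^ m \<le> exp (y - x)" by (simp add: power_divide)
  then have "(1 + y) ^ m \<le> exp (y - x) * (1 + x) ^ m" using assms by (simp add: field_simps)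
  then have "(1 + y) ^ m * exp (- y) \<le> exp (y - x) * (1 + x) ^ m * exp (- y)"
    by (rule mult_right_mono) simp
  also have "\<dots> = (1 + x) ^ m * exp (- x)" by (simp add: mult_exp_exp mult.assoc mult.left_commute)
  finally show ?thesis .
qed

lemma power_exp_bounded:
  fixes x :: real
  assumes "0 \<le> x"
  shows "(1 + x) ^ m * exp (- x) \<le> (1 + real m) ^ m"
proof (cases "real m \<le> x")
  case True
  have "(1 + x) ^ m * exp (- x) \<le> (1 + real m) ^ m * exp (- real m)"
    by (rule power_exp_decreasing) (use True in auto)
  also have "\<dots> \<le> (1 + real m) ^ m" by (simp add: mult_left_le)
  finally show ?thesis .
next
  case False
  have "(1 + x) ^ m * exp (- x) \<le> (1 + x) ^ m" using assms by (simp add: mult_left_le)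
  also have "\<dots> \<le> (1 + real m) ^ m" using assms False by (intro power_mono) auto
  finally show ?thesis .
qed

locale connection_profile =
  fixes \<psi> :: "real \<Rightarrow> real"
  assumes even: "\<And>x. \<psi> (- x) = \<psi> x"
    and continuous: "continuous_on UNIV \<psi>"
    and positive: "\<And>x. 0 < \<psi> x"
    and mono: "mono_on {0..} \<psi>"
    and integrable_exp: "integrable lborel (\<lambda>t. exp (- (\<psi> t)\<^sup>2))"
    and finite_V: "\<And>m::nat. integrable lborel (\<lambda>s. (1 + (\<psi> s)\<^sup>2) ^ m * exp (- (\<psi> s)\<^sup>2))"
begin

text \<open>The m-th power of the link weight times the edge probability without its factor c /
  N.\<close>

definition profile :: "nat \<Rightarrow> real \<Rightarrow> real" where
  "profile m s = (1 + (\<psi> s)\<^sup>2) ^ m * exp (- (\<psi> s)\<^sup>2)"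

lemma profile_nonneg: "0 \<le> profile m s" by (simp add: profile_def)

lemma profile_le: "profile m s \<le> (1 + real m) ^ m"
  unfolding profile_def by (rule power_exp_bounded) simp

lemma psi_abs: "\<psi> \<bar>x\<bar> = \<psi> x" using even by (simp add: abs_if)

lemma psi_mono: "\<bar>x\<bar> \<le> \<bar>y\<bar> \<Longrightarrow> \<psi> x \<le> \<psi> y"
  using mono_onD[OF mono, of "\<bar>x\<bar>" "\<bar>y\<bar>"] psi_abs by simp

text \<open>A bounded \<psi> would keep the exponential away from 0, against its integrability on
  the line.\<close>

lemma psi_unbounded: "\<exists>s\<ge>0. real m \<le> (\<psi> s)\<^sup>2"
proof (rule ccontr)
  assume "\<not> ?thesis"
  then have "(\<psi> s)\<^sup>2 < real m" for s using psi_abs[of s] by (metis abs_ge_zero not_le)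
  then have le: "exp (- real m) \<le> exp (- (\<psi> s)\<^sup>2)" for s by (simp add: less_imp_le)
  have "integrable lborel (\<lambda>s::real. exp (- real m))"
    by (rule Bochner_Integration.integrable_bound[OF integrable_exp]) (use le in auto)
  then show False
    by (simp add: integrable_iff_bounded ennreal_mult_top)
qed

text \<open>Beyond a point \<open>s0\<close> where the square of \<psi> has reached m, the profile
  decreases in the modulus, so its values near s are bounded by the value one unit closer to 0. The
  envelope adds both shifts, which avoids the sign of s, and a constant on the middle
  interval.\<close>

lemma profile_dominated:
  obtains g where "riemann_dominated (profile m) g"
proof -
  obtain s0 where s0: "s0 \<ge> 0" "real m \<le> (\<psi> s0)\<^sup>2" using psi_unbounded by blast
  let ?C = "(1 + real m) ^ m"
  define g where "g s = ?C * indicator {- (s0 + 1)..s0 + 1} s + profile m (s - 1) + profile m (s + 1)" for s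
  have dec: "profile m t \<le> profile m s" if "s0 \<le> \<bar>s\<bar>" "\<bar>s\<bar> \<le> \<bar>t\<bar>" for s t
  proof -
    have "(\<psi> s0)\<^sup>2 \<le> (\<psi> s)\<^sup>2" "(\<psi> s)\<^sup>2 \<le> (\<psi> t)\<^sup>2"
      using psi_mono[of s0 s] psi_mono[of s t] that s0 less_imp_le[OF positive] by (auto intro!: power_mono)
    then show ?thesis unfolding profile_def using s0 by (intro power_exp_decreasing) auto
  qed
  have "riemann_dominated (profile m) g"
  proof
    show "continuous_on UNIV (profile m)"
      unfolding profile_def by (intro continuous_intros continuous)
    show "0 \<le> profile m s" for s by (rule profile_nonneg)
    have "integrable lborel (\<lambda>s. profile m (s + c))" for c
    proof -
      have "integrable lborel (profile m)" using finite_V[of m] by (simp add: profile_def[abs_def])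
      from lborel_integrable_real_affine[OF this, of 1 c] show ?thesis by (simp add: add.commute)
    qed
    from this[of 1] this[of "-1"] show "integrable lborel g"
      unfolding g_def
      by (intro Bochner_Integration.integrable_add integrable_mult_right integrable_real_indicator) (auto simp: emeasure_lborel_Icc_eq)
    show "profile m t \<le> g s" if "\<bar>t - s\<bar> \<le> 1" for s t
    proof -
      consider "\<bar>s\<bar> \<le> s0 + 1" | "s > s0 + 1" | "s < - (s0 + 1)" by linarith
      then show ?thesis
      proof cases
        case 1
        then have "indicator {- (s0 + 1)..s0 + 1} s = (1::real)" by (auto simp: indicator_def)
        then show ?thesis using profile_le[of m t] profile_nonneg[of m] by (simp add: g_def add_increasing2)
      next
        case 2
        then have "profile m t \<le> profile m (s - 1)" using that s0 by (intro dec) auto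
        then show ?thesis using profile_nonneg[of m "s + 1"] by (simp add: g_def add_increasing add_increasing2)
      next
        case 3
        then have "profile m t \<le> profile m (s + 1)" using that s0 by (intro dec) auto
        then show ?thesis using profile_nonneg[of m "s - 1"] by (simp add: g_def add_increasing add_increasing2)
      qed
    qed
  qed
  then show ?thesis by (rule that)
qed

end

section \<open>Sums over embedded trees\<close>

text \<open>The distance of the end points, written through \<open>Max\<close> and
  \<open>Min\<close> so as to be a function of the unordered edge.\<close>

abbreviation spread :: "int set \<Rightarrow> real" where
  "spread e \<equiv> real_of_int (Max e - Min e)"

lemma spread_doubleton: "spread {a, b} = \<bar>real_of_int a - real_of_int b\<bar>"
  by (simp add: max_def min_def)

definition tree_weight :: "('e set \<Rightarrow> real \<Rightarrow> real) \<Rightarrow> 'e set set \<Rightarrow> real \<Rightarrow> ('e \<Rightarrow> int) \<Rightarrow> real" where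
  "tree_weight f E R y = (\<Prod>e\<in>E. f e (spread (y ` e) / R))"

lemma sum_PiE_insert:
  assumes "v \<notin> U"
  shows "(\<Sum>y\<in>insert v U \<rightarrow>\<^sub>E L. h y) = (\<Sum>y\<in>U \<rightarrow>\<^sub>E L. \<Sum>z\<in>L. h (y(v := z)))"
proof -
  have "(\<Sum>y\<in>insert v U \<rightarrow>\<^sub>E L. h y) = (\<Sum>(z, y)\<in>L \<times> (U \<rightarrow>\<^sub>E L). h (y(v := z)))"
    unfolding PiE_insert_eq
    by (subst sum.reindex) (use inj_combinator[OF assms] in \<open>auto simp: case_prod_unfold\<close>)
  also have "\<dots> = (\<Sum>z\<in>L. \<Sum>y\<in>U \<rightarrow>\<^sub>E L. h (y(v := z)))" by (simp add: sum.cartesian_product)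
  finally show ?thesis by (simp only: sum.swap[of _ L])
qed

lemma tree_weight_extend:
  assumes "utree U E" "u \<in> U" "v \<notin> U"
  shows "tree_weight f (insert {u, v} E) R (y(v := z)) =
    f {u, v} (\<bar>real_of_int (y u) - real_of_int z\<bar> / R) * tree_weight f E R y"
proof -
  have "{u, v} \<notin> E" using utree_props(4)[OF assms(1), of "{u, v}"] assms(3) by auto
  moreover have "(y(v := z)) ` {u, v} = {y u, z}" using assms by auto
  moreover have "(y(v := z)) ` e = y ` e" if "e \<in> E" for e
    using utree_props(4)[OF assms(1) that] assms(3) by (intro image_cong) auto
  ultimately have "tree_weight f (insert {u, v} E) R (y(v := z)) =
      f {u, v} (spread {y u, z} / R) * (\<Prod>e\<in>E. f e (spread (y ` e) / R))"
    unfolding tree_weight_def using utree_props(3)[OF assms(1)] by simp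
  then show ?thesis by (simp only: spread_doubleton tree_weight_def)
qed

lemma sum_translate:
  fixes f :: "real \<Rightarrow> real" and a :: int
  shows "(\<Sum>z\<in>L. f (\<bar>real_of_int a - real_of_int z\<bar> / R)) = (\<Sum>z\<in>(\<lambda>z. a - z) ` L. f (\<bar>real_of_int z\<bar> / R))"
  by (subst sum.reindex) (auto simp: inj_on_def)

text \<open>One constant bounds both values and Riemann sums: summing out a leaf costs
  \<open>C * R\<close>, discarding a surplus edge costs \<open>C\<close>.\<close>

locale edge_family =
  fixes f :: "'e set \<Rightarrow> real \<Rightarrow> real" and E0 :: "'e set set" and C :: real
  assumes f_nonneg: "\<And>e s. 0 \<le> f e s" and f_le: "\<And>e s. e \<in> E0 \<Longrightarrow> f e s \<le> C"
    and f_even: "\<And>e s. f e \<bar>s\<bar> = f e s"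
    and f_sum: "\<And>e R Z. e \<in> E0 \<Longrightarrow> R \<ge> 1 \<Longrightarrow> finite Z \<Longrightarrow> (\<Sum>z\<in>Z. f e (real_of_int z / R)) / R \<le> C"
    and C: "0 \<le> C"
begin

lemma tree_weight_nonneg: "0 \<le> tree_weight f E R y"
  by (simp add: tree_weight_def prod_nonneg f_nonneg)

lemma f_abs_div: "R > 0 \<Longrightarrow> f e (\<bar>x\<bar> / R) = f e (x / R)"
  using f_even[of e "x / R"] by (simp add: abs_divide)

lemma f_sum_translate:
  assumes "e \<in> E0" "R \<ge> 1" "finite L"
  shows "(\<Sum>z\<in>L. f e (\<bar>real_of_int a - real_of_int z\<bar> / R)) \<le> C * R"
proof -
  have "(\<Sum>z\<in>L. f e (\<bar>real_of_int a - real_of_int z\<bar> / R)) / R \<le> C"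
    unfolding sum_translate using f_sum[OF assms(1,2), of "(\<lambda>z. a - z) ` L"] assms
    by (simp add: f_abs_div)
  then show ?thesis using assms(2) by (simp add: field_simps)
qed

text \<open>Each summed leaf costs \<open>C * R\<close>. The pinned vertex is arbitrary because the
  induction has to move the pin, and because the limit theorem confines a chosen vertex to sites
  near the boundary.\<close>

lemma tree_sum_pinned_le:
  assumes "utree U E" "E \<subseteq> E0" "R \<ge> 1" "finite L" "w \<in> U"
  shows "(\<Sum>y\<in>U \<rightarrow>\<^sub>E L. if y w = z0 then tree_weight f E R y else 0) \<le> (C * R) ^ card E"
  using assms
proof (induction arbitrary: w z0 rule: utree.induct)
  case (singleton v)
  have "(\<Sum>y\<in>{v} \<rightarrow>\<^sub>E L. if y w = z0 then tree_weight f {} R y else 0) =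
      (\<Sum>y\<in>{} \<rightarrow>\<^sub>E L. \<Sum>z\<in>L. if (y(v := z)) w = z0 then tree_weight f {} R (y(v := z)) else 0)"
    by (rule sum_PiE_insert) simp
  also have "\<dots> = (\<Sum>z\<in>L. if z = z0 then 1 else 0)"
    using singleton.prems by (simp add: tree_weight_def)
  also have "\<dots> \<le> 1" using singleton.prems by (simp add: sum.delta)
  finally show ?case by simp
next
  case (extend U E u v)
  let ?e = "{u, v}"
  have E: "?e \<in> E0" "E \<subseteq> E0" using extend.prems by auto
  have finU: "finite U" by (rule utree_props(1)[OF extend.hyps(1)])
  have card: "card (insert ?e E) = Suc (card E)"
    using utree_props(3,4)[OF extend.hyps(1)] extend.hyps(3) by (subst card_insert_disjoint) auto
  have CR: "0 \<le> C * R" using C extend.prems by simp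
  have eq: "(\<Sum>y\<in>insert v U \<rightarrow>\<^sub>E L. if y w = z0 then tree_weight f (insert ?e E) R y else 0) =
      (\<Sum>y\<in>U \<rightarrow>\<^sub>E L. \<Sum>z\<in>L. if (y(v := z)) w = z0
        then f ?e (\<bar>real_of_int (y u) - real_of_int z\<bar> / R) * tree_weight f E R y else 0)"
    unfolding sum_PiE_insert[OF extend.hyps(3)] tree_weight_extend[OF extend.hyps] ..
  show ?case
  proof (cases "w = v")
    case False
    then have w: "w \<in> U" using extend.prems by simp
    have "(\<Sum>y\<in>U \<rightarrow>\<^sub>E L. \<Sum>z\<in>L. if (y(v := z)) w = z0
        then f ?e (\<bar>real_of_int (y u) - real_of_int z\<bar> / R) * tree_weight f E R y else 0) =
        (\<Sum>y\<in>U \<rightarrow>\<^sub>E L. (if y w = z0 then tree_weight f E R y else 0) *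
          (\<Sum>z\<in>L. f ?e (\<bar>real_of_int (y u) - real_of_int z\<bar> / R)))"
      using False by (intro sum.cong refl) (auto simp: sum_distrib_left mult.commute)
    also have "\<dots> \<le> (\<Sum>y\<in>U \<rightarrow>\<^sub>E L. (if y w = z0 then tree_weight f E R y else 0) * (C * R))"
      using f_sum_translate[OF E(1)] extend.prems tree_weight_nonneg
      by (intro sum_mono mult_left_mono) auto
    also have "\<dots> \<le> (C * R) ^ card E * (C * R)"
      unfolding sum_distrib_right[symmetric]
      using extend.IH[OF E(2) extend.prems(2,3) w] CR by (rule mult_right_mono)
    finally show ?thesis by (simp add: eq card mult.commute)
  next
    \<comment> \<open>If the new leaf itself is pinned, the pin moves to its neighbour
      \<open>u\<close>, and the position of \<open>u\<close> is summed in place of that of the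
      leaf.\<close>
    case True
    have "(\<Sum>y\<in>U \<rightarrow>\<^sub>E L. \<Sum>z\<in>L. if (y(v := z)) w = z0
        then f ?e (\<bar>real_of_int (y u) - real_of_int z\<bar> / R) * tree_weight f E R y else 0) \<le>
        (\<Sum>y\<in>U \<rightarrow>\<^sub>E L. f ?e (\<bar>real_of_int (y u) - real_of_int z0\<bar> / R) * tree_weight f E R y)"
    proof (rule sum_mono)
      fix y
      have "(\<Sum>z\<in>L. if (y(v := z)) w = z0
        then f ?e (\<bar>real_of_int (y u) - real_of_int z\<bar> / R) * tree_weight f E R y else 0) =
        (\<Sum>z\<in>L. if z = z0 then f ?e (\<bar>real_of_int (y u) - real_of_int z0\<bar> / R) * tree_weight f E R y else 0)"
        using True by (intro sum.cong) auto
      also have "\<dots> \<le> f ?e (\<bar>real_of_int (y u) - real_of_int z0\<bar> / R) * tree_weight f E R y"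
        using extend.prems(3) f_nonneg tree_weight_nonneg by (simp add: sum.delta)
      finally show "(\<Sum>z\<in>L. if (y(v := z)) w = z0
        then f ?e (\<bar>real_of_int (y u) - real_of_int z\<bar> / R) * tree_weight f E R y else 0) \<le>
        f ?e (\<bar>real_of_int (y u) - real_of_int z0\<bar> / R) * tree_weight f E R y" .
    qed
    also have "\<dots> = (\<Sum>z1\<in>L. \<Sum>y\<in>{y \<in> U \<rightarrow>\<^sub>E L. y u = z1}.
        f ?e (\<bar>real_of_int (y u) - real_of_int z0\<bar> / R) * tree_weight f E R y)"
      by (rule sum.group[symmetric]) (use finU extend.prems extend.hyps in \<open>auto intro: finite_PiE\<close>)
    also have "\<dots> = (\<Sum>z1\<in>L. f ?e (\<bar>real_of_int z1 - real_of_int z0\<bar> / R) *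
        (\<Sum>y\<in>U \<rightarrow>\<^sub>E L. if y u = z1 then tree_weight f E R y else 0))"
    proof (intro sum.cong refl)
      fix z1
      have "(\<Sum>y\<in>U \<rightarrow>\<^sub>E L. if y u = z1 then tree_weight f E R y else 0) = (\<Sum>y\<in>{y \<in> U \<rightarrow>\<^sub>E L. y u = z1}. tree_weight f E R y)"
        using finU extend.prems by (intro sum.inter_filter[symmetric]) (auto intro: finite_PiE)
      then show "(\<Sum>y\<in>{y \<in> U \<rightarrow>\<^sub>E L. y u = z1}. f ?e (\<bar>real_of_int (y u) - real_of_int z0\<bar> / R) * tree_weight f E R y) =
        f ?e (\<bar>real_of_int z1 - real_of_int z0\<bar> / R) * (\<Sum>y\<in>U \<rightarrow>\<^sub>E L. if y u = z1 then tree_weight f E R y else 0)"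
        by (simp add: sum_distrib_left)
    qed
    also have "\<dots> \<le> (\<Sum>z1\<in>L. f ?e (\<bar>real_of_int z1 - real_of_int z0\<bar> / R) * (C * R) ^ card E)"
      using extend.IH[OF E(2) extend.prems(2,3) extend.hyps(2)] f_nonneg
      by (intro sum_mono mult_left_mono) auto
    also have "\<dots> \<le> (C * R) * (C * R) ^ card E"
      unfolding sum_distrib_right[symmetric]
      using f_sum_translate[OF E(1), of R L z0] extend.prems CR
      by (intro mult_right_mono) (auto simp: abs_minus_commute)
    finally show ?thesis by (simp add: eq card)
  qed
qed

lemma tree_sum_le:
  assumes "utree U E" "E \<subseteq> E0" "R \<ge> 1" "finite L"
  shows "(\<Sum>y\<in>U \<rightarrow>\<^sub>E L. tree_weight f E R y) \<le> card L * (C * R) ^ card E"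
proof -
  obtain w where w: "w \<in> U" using utree_props(2)[OF assms(1)] by auto
  have fin: "finite (U \<rightarrow>\<^sub>E L)" using utree_props(1)[OF assms(1)] assms(4) by (auto intro: finite_PiE)
  have "(\<Sum>y\<in>U \<rightarrow>\<^sub>E L. tree_weight f E R y) = (\<Sum>z\<in>L. \<Sum>y\<in>{y \<in> U \<rightarrow>\<^sub>E L. y w = z}. tree_weight f E R y)"
    by (rule sum.group[symmetric]) (use fin assms(4) w in auto)
  also have "\<dots> = (\<Sum>z\<in>L. \<Sum>y\<in>U \<rightarrow>\<^sub>E L. if y w = z then tree_weight f E R y else 0)"
    using fin by (intro sum.cong refl sum.inter_filter)
  also have "\<dots> \<le> (\<Sum>z\<in>L. (C * R) ^ card E)"
    using tree_sum_pinned_le[OF assms w] by (intro sum_mono)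
  finally show ?thesis by simp
qed

end

section \<open>Embeddings of trees into the box\<close>

abbreviation sites :: "nat \<Rightarrow> int set" where
  "sites n \<equiv> {- int n..int n}"

lemma card_sites: "card (sites n) = 2 * n + 1"
  by simp

lemma card_near_boundary:
  assumes "0 \<le> a"
  shows "real (card {z \<in> sites n. real n - a < \<bar>real_of_int z\<bar>}) \<le> 2 * a + 2"
proof -
  define k where "k = nat \<lfloor>a\<rfloor>"
  have k: "real k \<le> a" "a < real k + 1" using assms by (auto simp: k_def)
  have "{z \<in> sites n. real n - a < \<bar>real_of_int z\<bar>} \<subseteq> {int n - int k..int n} \<union> {- int n..int k - int n}"
  proof
    fix z assume z: "z \<in> {z \<in> sites n. real n - a < \<bar>real_of_int z\<bar>}"
    then have "real n - real k - 1 < \<bar>real_of_int z\<bar>" using k by auto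
    then have "int n - int k \<le> \<bar>z\<bar>" by linarith
    then show "z \<in> {int n - int k..int n} \<union> {- int n..int k - int n}" using z by auto
  qed
  then have "card {z \<in> sites n. real n - a < \<bar>real_of_int z\<bar>} \<le> card ({int n - int k..int n} \<union> {- int n..int k - int n})"
    by (intro card_mono) auto
  also have "\<dots> \<le> card {int n - int k..int n} + card {- int n..int k - int n}" by (rule card_Un_le)
  also have "\<dots> = 2 * (k + 1)" by simp
  finally have "real (card {z \<in> sites n. real n - a < \<bar>real_of_int z\<bar>}) \<le> real (2 * (k + 1))"
    by (simp only: of_nat_le_iff)
  then show ?thesis using k by simp
qed

lemma embeddings_insert:
  assumes "v \<notin> U" "finite L"  "finite U"
  shows "(\<Sum>y\<in>embeddings (insert v U) L. h y) = (\<Sum>y\<in>embeddings U L. \<Sum>z\<in>L - y ` U. h (y(v := z)))"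
proof -
  have "(\<Sum>y\<in>embeddings U L. \<Sum>z\<in>L - y ` U. h (y(v := z))) = (\<Sum>(y, z)\<in>(SIGMA y:embeddings U L. L - y ` U). h (y(v := z)))"
    using assms by (intro sum.Sigma) auto
  also have "\<dots> = (\<Sum>y\<in>embeddings (insert v U) L. h y)"
  proof (rule sum.reindex_bij_witness[where j = "\<lambda>(y, z). y(v := z)" and i = "\<lambda>y. (restrict y U, y v)"])
    fix a assume "a \<in> (SIGMA y:embeddings U L. L - y ` U)"
    then obtain y z where a: "a = (y, z)" "y \<in> U \<rightarrow>\<^sub>E L" "inj_on y U" "z \<in> L" "z \<notin> y ` U"
      by (auto simp: embeddings_def)
    have "restrict (y(v := z)) U = y"
    proof
      fix w show "restrict (y(v := z)) U w = y w"
        using PiE_arb[OF a(2), of w] assms(1) by (cases "w \<in> U") auto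
    qed
    then show "(\<lambda>y. (restrict y U, y v)) (case a of (y, z) \<Rightarrow> y(v := z)) = a" by (simp add: a)
    have "y(v := z) \<in> insert v U \<rightarrow>\<^sub>E L" using a(2,4) by (rule PiE_fun_upd[rotated])
    moreover have "inj_on (y(v := z)) (insert v U)"
      using a(3,5) assms(1) by (auto simp: inj_on_def)
    ultimately show "(case a of (y, z) \<Rightarrow> y(v := z)) \<in> embeddings (insert v U) L"
      by (simp add: a embeddings_def)
  next
    fix y assume "y \<in> embeddings (insert v U) L"
    then have y: "y \<in> insert v U \<rightarrow>\<^sub>E L" "inj_on y (insert v U)" by (auto simp: embeddings_def)
    show "(case (restrict y U, y v) of (y, z) \<Rightarrow> y(v := z)) = y"
    proof
      fix w show "(case (restrict y U, y v) of (y, z) \<Rightarrow> y(v := z)) w = y w"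
        using PiE_arb[OF y(1), of w] by (cases "w \<in> insert v U") auto
    qed
    have "restrict y U \<in> U \<rightarrow>\<^sub>E L" using y(1) by auto
    moreover have "inj_on (restrict y U) U" using y(2) by (auto simp: inj_on_def)
    moreover have "y v \<in> L" using y(1) by auto
    moreover have "y v \<notin> restrict y U ` U" using y(2) assms(1) by (auto simp: inj_on_def)
    ultimately show "(restrict y U, y v) \<in> (SIGMA y:embeddings U L. L - y ` U)"
      by (simp add: embeddings_def)
  qed auto
  finally show ?thesis ..
qed

locale edge_family_limit = edge_family +
  fixes V :: "'a set \<Rightarrow> real"
  assumes conv: "\<And>e. e \<in> E0 \<Longrightarrow> riemann_to (f e) (V e)"
begin

text \<open>Attaching a leaf at \<open>u\<close> multiplies the sum by about \<open>R * V e\<close>.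
  There are three errors: that of the Riemann sum, the sites excluded by injectivity, and positions
  of \<open>u\<close> so close to the boundary that the box cuts off the window; the last have a
  share of order R / N.\<close>

theorem tree_limit:
  fixes n :: "'p \<Rightarrow> nat" and R :: "'p \<Rightarrow> real" and F :: "'p filter"
  assumes R: "filterlim R at_top F" and RN: "((\<lambda>p. R p / real (2 * n p + 1)) \<longlongrightarrow> 0) F"
    and "utree U E" "E \<subseteq> E0"
  shows "((\<lambda>p. (\<Sum>y\<in>embeddings U (sites (n p)). tree_weight f E (R p) y) /
      (real (2 * n p + 1) * R p ^ card E)) \<longlongrightarrow> (\<Prod>e\<in>E. V e)) F"
  using assms(3,4)
proof (induction rule: utree.induct)
  case (singleton v)
  have "(\<Sum>y\<in>embeddings {v} (sites m). tree_weight f {} r y) = real (2 * m + 1)" for m r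
  proof -
    have "(\<Sum>y\<in>embeddings {v} (sites m). tree_weight f {} r y) = 
      (\<Sum>y\<in>embeddings {} (sites m). \<Sum>z\<in>sites m - y ` {}. tree_weight f {} r (y(v := z)))"
      by (rule embeddings_insert) auto
    also have "embeddings {} (sites m) = {\<lambda>_. undefined}" by (auto simp: embeddings_def)
    finally show ?thesis by (simp add: tree_weight_def)
  qed
  then show ?case by simp
next
  case (extend U E u v)
  let ?e = "{u, v}" and ?N = "\<lambda>p. real (2 * n p + 1)"
  have E: "?e \<in> E0" "E \<subseteq> E0" using extend.prems by auto
  have finU: "finite U" by (rule utree_props(1)[OF extend.hyps(1)])
  have eE: "?e \<notin> E" using utree_props(4)[OF extend.hyps(1), of ?e] extend.hyps(3) by auto
  have finE: "finite E" by (rule utree_props(3)[OF extend.hyps(1)])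
  have card: "card (insert ?e E) = Suc (card E)" using eE finE by simp
  let ?W = "\<lambda>p y. tree_weight f E (R p) y"
  define S where "S p = (\<Sum>y\<in>embeddings U (sites (n p)). ?W p y)" for p
  define S' where "S' p = (\<Sum>y\<in>embeddings (insert v U) (sites (n p)). tree_weight f (insert ?e E) (R p) y)" for p
  define s where "s p = S p / (?N p * R p ^ card E)" for p
  define s' where "s' p = S' p / (?N p * R p ^ Suc (card E))" for p
  define Q where "Q = C + \<bar>V ?e\<bar>"
  define K where "K = C ^ card E"
  have K: "0 \<le> K" and Q: "0 \<le> Q" using C by (simp_all add: K_def Q_def)
  have lim_s: "(s \<longlongrightarrow> (\<Prod>e\<in>E. V e)) F"
    using extend.IH[OF E(2)] by (simp add: s_def[abs_def] S_def)
  have R1: "\<forall>\<^sub>F p in F. R p \<ge> 1" using R by (rule filterlim_at_top[THEN iffD1, rule_format])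
  have invR: "((\<lambda>p. 1 / R p) \<longlongrightarrow> 0) F"
    by (rule tendsto_divide_0[OF tendsto_const]) (rule filterlim_at_top_imp_at_infinity[OF R])
  have Npos: "?N p > 0" for p by simp
  have bound: "\<bar>s' p - V ?e * s p\<bar> \<le> (\<epsilon> + real (card U) * C * (1 / R p)) * K +
      Q * K * (2 * B * (R p / ?N p) + 2 * (R p / ?N p))"
    if R1: "R p \<ge> 1" and B: "B > 0" and \<epsilon>: "\<epsilon> > 0"
      and riem: "\<And>Z. finite Z \<Longrightarrow> {z::int. \<bar>real_of_int z\<bar> \<le> B * R p} \<subseteq> Z \<Longrightarrow>
        \<bar>(\<Sum>z\<in>Z. f ?e (real_of_int z / R p)) / R p - V ?e\<bar> \<le> \<epsilon>" for p B \<epsilon>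
  proof -
    let ?L = "sites (n p)" and ?r = "R p"
    let ?inner = "\<lambda>y Z. (\<Sum>z\<in>Z. f ?e (\<bar>real_of_int (y u) - real_of_int z\<bar> / ?r)) / ?r"
    \<comment> \<open>For all other positions of \<open>u\<close> the box, seen from
      \<open>y u\<close>, contains the whole window of radius B R, so the Riemann estimate
      applies.\<close>
    define near where "near y \<longleftrightarrow> real (n p) - B * ?r < \<bar>real_of_int (y u)\<bar>" for y :: "'a \<Rightarrow> int"
    let ?h = "\<epsilon> + real (card U) * C * (1 / ?r)"
    have S': "S' p = (\<Sum>y\<in>embeddings U ?L. ?W p y * (?r * ?inner y (?L - y ` U)))"
    proof -
      have "S' p = (\<Sum>y\<in>embeddings U ?L. \<Sum>z\<in>?L - y ` U.
          f ?e (\<bar>real_of_int (y u) - real_of_int z\<bar> / ?r) * ?W p y)"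
        unfolding S'_def embeddings_insert[OF extend.hyps(3) finite_atLeastAtMost_int finU]
          tree_weight_extend[OF extend.hyps] ..
      then show ?thesis using R1 by (simp add: sum_distrib_left[symmetric] mult.commute)
    qed
    have inner_nonneg: "0 \<le> ?inner y Z" for y Z using f_nonneg R1 by (simp add: sum_nonneg)
    have inner_le: "?inner y Z \<le> C" if "finite Z" for y Z
      using f_sum_translate[OF E(1) R1 that, of "y u"] R1 by (simp add: field_simps)
    have h0: "0 \<le> ?h" using \<epsilon> C R1 by simp
    have dev: "\<bar>?inner y (?L - y ` U) - V ?e\<bar> \<le> ?h + (if near y then Q else 0)"
      if y: "y \<in> embeddings U ?L" for y
    proof (cases "near y")
      case True
      then show ?thesis using inner_nonneg[of y "?L - y ` U"] inner_le[of "?L - y ` U" y] h0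
        by (simp add: Q_def)
    next
      case False
      have sub: "y ` U \<subseteq> ?L" using y by (auto simp: embeddings_def)
      have "\<bar>?inner y ?L - V ?e\<bar> \<le> \<epsilon>"
      proof -
        have "\<bar>(\<Sum>z\<in>(\<lambda>z. y u - z) ` ?L. f ?e (real_of_int z / ?r)) / ?r - V ?e\<bar> \<le> \<epsilon>"
        proof (rule riem)
          show "{z::int. \<bar>real_of_int z\<bar> \<le> B * ?r} \<subseteq> (\<lambda>z. y u - z) ` ?L"
          proof
            fix z assume "z \<in> {z::int. \<bar>real_of_int z\<bar> \<le> B * ?r}"
            then have "\<bar>real_of_int (y u)\<bar> + \<bar>real_of_int z\<bar> \<le> real (n p)"
              using False by (simp add: near_def)
            then have "y u - z \<in> ?L" by auto
            then show "z \<in> (\<lambda>z. y u - z) ` ?L" by (intro image_eqI[of _ _ "y u - z"]) auto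
          qed
        qed simp
        then show ?thesis unfolding sum_translate using R1 by (simp add: f_abs_div)
      qed
      moreover have "\<bar>?inner y ?L - ?inner y (?L - y ` U)\<bar> \<le> real (card U) * C * (1 / ?r)"
      proof -
        have fin: "finite (y ` U)" using finU by simp
        have "(\<Sum>z\<in>?L. f ?e (\<bar>real_of_int (y u) - real_of_int z\<bar> / ?r)) =
            (\<Sum>z\<in>?L - y ` U. f ?e (\<bar>real_of_int (y u) - real_of_int z\<bar> / ?r)) +
            (\<Sum>z\<in>y ` U. f ?e (\<bar>real_of_int (y u) - real_of_int z\<bar> / ?r))"
          by (rule sum.subset_diff[OF sub]) simp
        then have "?inner y ?L - ?inner y (?L - y ` U) = ?inner y (y ` U)"
          by (simp add: add_divide_distrib)
        moreover have "(\<Sum>z\<in>y ` U. f ?e (\<bar>real_of_int (y u) - real_of_int z\<bar> / ?r)) \<le> real (card (y ` U)) * C"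
          by (rule sum_bounded_above) (rule f_le[OF E(1)])
        moreover have "real (card (y ` U)) * C \<le> real (card U) * C"
          using finU C by (intro mult_right_mono) (auto intro: card_image_le)
        ultimately have "?inner y ?L - ?inner y (?L - y ` U) \<le> real (card U) * C / ?r"
          using R1 by (simp add: divide_right_mono)
        then show ?thesis using \<open>?inner y ?L - ?inner y (?L - y ` U) = ?inner y (y ` U)\<close> inner_nonneg[of y "y ` U"]
          by simp
      qed
      ultimately show ?thesis using False by simp
    qed
    have "S' p - V ?e * S p * ?r = (\<Sum>y\<in>embeddings U ?L. ?W p y * ?r * (?inner y (?L - y ` U) - V ?e))"
      unfolding S' S_def by (simp add: sum_distrib_left sum_distrib_right right_diff_distrib sum_subtractf mult_ac)
    then have "\<bar>S' p - V ?e * S p * ?r\<bar> \<le> (\<Sum>y\<in>embeddings U ?L. \<bar>?W p y * ?r * (?inner y (?L - y ` U) - V ?e)\<bar>)"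
      by (simp only: sum_abs)
    also have "\<dots> \<le> (\<Sum>y\<in>embeddings U ?L. ?W p y * ?r * (?h + (if near y then Q else 0)))"
      using dev R1 tree_weight_nonneg by (intro sum_mono) (simp add: abs_mult mult_left_mono)
    \<comment> \<open>All terms are nonnegative, so the error may be summed over all maps, not only
      injective ones; the tree bounds are stated for these.\<close>
    also have "\<dots> \<le> (\<Sum>y\<in>U \<rightarrow>\<^sub>E ?L. ?W p y * ?r * (?h + (if near y then Q else 0)))"
      using finU h0 Q R1 tree_weight_nonneg
      by (intro sum_mono2) (auto simp: embeddings_def intro!: finite_PiE mult_nonneg_nonneg add_nonneg_nonneg)
    also have "\<dots> = ?r * (?h * (\<Sum>y\<in>U \<rightarrow>\<^sub>E ?L. ?W p y) + Q * (\<Sum>y\<in>U \<rightarrow>\<^sub>E ?L. if near y then ?W p y else 0))"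
    proof -
      have "?W p y * ?r * (?h + (if near y then Q else 0)) = ?r * (?h * ?W p y + Q * (if near y then ?W p y else 0))" for y
        by (simp add: algebra_simps)
      then show ?thesis by (simp only: sum.distrib sum_distrib_left[symmetric])
    qed
    also have "\<dots> \<le> ?r * (?h * (?N p * (C * ?r) ^ card E) + Q * ((2 * (B * ?r) + 2) * (C * ?r) ^ card E))"
    proof -
      have 1: "(\<Sum>y\<in>U \<rightarrow>\<^sub>E ?L. ?W p y) \<le> ?N p * (C * ?r) ^ card E"
        using tree_sum_le[OF extend.hyps(1) E(2) R1, of ?L] unfolding card_sites by simp
      let ?Z = "{z \<in> ?L. real (n p) - B * ?r < \<bar>real_of_int z\<bar>}"
      have finP: "finite (U \<rightarrow>\<^sub>E ?L)" using finU by (auto intro: finite_PiE)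
      have "(\<Sum>y\<in>U \<rightarrow>\<^sub>E ?L. if near y then ?W p y else 0) = (\<Sum>z\<in>?L. \<Sum>y\<in>{y \<in> U \<rightarrow>\<^sub>E ?L. y u = z}. if near y then ?W p y else 0)"
        by (rule sum.group[symmetric]) (use finP extend.hyps in auto)
      also have "\<dots> \<le> (\<Sum>z\<in>?L. if z \<in> ?Z then (C * ?r) ^ card E else 0)"
      proof (rule sum_mono)
        fix z assume z: "z \<in> ?L"
        have "(\<Sum>y\<in>{y \<in> U \<rightarrow>\<^sub>E ?L. y u = z}. if near y then ?W p y else 0) =
            (\<Sum>y\<in>{y \<in> U \<rightarrow>\<^sub>E ?L. y u = z}. if z \<in> ?Z then ?W p y else 0)"
          using z by (intro sum.cong refl) (auto simp: near_def)
        also have "\<dots> = (if z \<in> ?Z then (\<Sum>y\<in>U \<rightarrow>\<^sub>E ?L. if y u = z then ?W p y else 0) else 0)"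
          unfolding sum.inter_filter[OF finP, symmetric] by (cases "z \<in> ?Z") (simp_all only: if_True if_False sum.neutral_const)
        also have "\<dots> \<le> (if z \<in> ?Z then (C * ?r) ^ card E else 0)"
          using tree_sum_pinned_le[OF extend.hyps(1) E(2) R1 _ extend.hyps(2), of ?L z] by auto
        finally show "(\<Sum>y\<in>{y \<in> U \<rightarrow>\<^sub>E ?L. y u = z}. if near y then ?W p y else 0) \<le> (if z \<in> ?Z then (C * ?r) ^ card E else 0)" .
      qed
      also have "\<dots> = (\<Sum>z\<in>?Z. (C * ?r) ^ card E)"
        by (rule sum.mono_neutral_cong_right) auto
      also have "\<dots> \<le> (2 * (B * ?r) + 2) * (C * ?r) ^ card E"
        using card_near_boundary[of "B * ?r" "n p"] B R1 C by (simp add: mult_right_mono)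
      finally have 2: "(\<Sum>y\<in>U \<rightarrow>\<^sub>E ?L. if near y then ?W p y else 0) \<le> (2 * (B * ?r) + 2) * (C * ?r) ^ card E" .
      show ?thesis using 1 2 h0 Q R1 by (intro mult_left_mono add_mono) auto
    qed
    \<comment> \<open>The constant 2 is enlarged to \<open>2 * R p\<close>, which is allowed for R
      at least 1 and gives every boundary term the factor R / N.\<close>
    also have "\<dots> \<le> ?r * (?h * (?N p * (C * ?r) ^ card E) + Q * ((2 * (B * ?r) + 2 * ?r) * (C * ?r) ^ card E))"
      using Q C R1 by (intro mult_left_mono add_left_mono mult_right_mono) auto
    finally have main: "\<bar>S' p - V ?e * S p * ?r\<bar> \<le> \<dots>" .
    have "\<bar>s' p - V ?e * s p\<bar> = \<bar>S' p - V ?e * S p * ?r\<bar> / (?N p * ?r ^ Suc (card E))"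
    proof -
      have "s' p - V ?e * s p = (S' p - V ?e * S p * ?r) / (?N p * ?r ^ Suc (card E))"
        unfolding s'_def s_def using R1 Npos[of p] by (simp add: divide_simps)
      then show ?thesis using R1 by (simp add: abs_divide abs_mult)
    qed
    also have "\<dots> \<le> ?r * (?h * (?N p * (C * ?r) ^ card E) + Q * ((2 * (B * ?r) + 2 * ?r) * (C * ?r) ^ card E)) / (?N p * ?r ^ Suc (card E))"
      using main R1 by (intro divide_right_mono) auto
    also have "\<dots> = ?h * K + Q * K * (2 * B * (?r / ?N p) + 2 * (?r / ?N p))"
    proof -
      have "r * (h * (N * (C * r) ^ k) + Q * ((2 * (B * r) + 2 * r) * (C * r) ^ k)) / (N * r ^ Suc k) =
          h * C ^ k + Q * C ^ k * (2 * B * (r / N) + 2 * (r / N))" if "r > 0" "N > 0" for r h N :: real and k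
        using that by (simp add: power_mult_distrib field_simps)
      from this[of ?r "?N p" ?h "card E"] show ?thesis
        unfolding K_def using R1 Npos[of p] by linarith
    qed
    finally show ?thesis .
  qed
  have "((\<lambda>p. s' p - V ?e * s p) \<longlongrightarrow> 0) F"
    unfolding tendsto_iff
  proof (intro allI impI)
    fix \<eta> :: real assume \<eta>: "\<eta> > 0"
    \<comment> \<open>The denominator uses K + 1 because K may be 0.\<close>
    define \<epsilon> where "\<epsilon> = \<eta> / (2 * (K + 1))"
    have \<epsilon>: "\<epsilon> > 0" "\<epsilon> * K < \<eta> / 2 + 0" using \<eta> K by (auto simp: \<epsilon>_def field_simps)
    from conv[OF E(1)] \<epsilon>(1) obtain B where B: "B > 0" and evB: "\<forall>\<^sub>F R in at_top. \<forall>Z. finite Z \<longrightarrow>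
        {z::int. \<bar>real_of_int z\<bar> \<le> B * R} \<subseteq> Z \<longrightarrow> \<bar>(\<Sum>z\<in>Z. f ?e (real_of_int z / R)) / R - V ?e\<bar> \<le> \<epsilon>"
      unfolding riemann_to_def by blast
    have "((\<lambda>p. (\<epsilon> + real (card U) * C * (1 / R p)) * K + Q * K * (2 * B * (R p / ?N p) + 2 * (R p / ?N p))) \<longlongrightarrow>
        (\<epsilon> + real (card U) * C * 0) * K + Q * K * (2 * B * 0 + 2 * 0)) F"
      by (intro tendsto_intros invR RN)
    moreover have "(\<epsilon> + real (card U) * C * 0) * K + Q * K * (2 * B * 0 + 2 * 0) < \<eta>"
      using \<epsilon>(2) \<eta> by simp
    ultimately have "\<forall>\<^sub>F p in F. (\<epsilon> + real (card U) * C * (1 / R p)) * K + Q * K * (2 * B * (R p / ?N p) + 2 * (R p / ?N p)) < \<eta>"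
      by (rule order_tendstoD(2))
    moreover have "\<forall>\<^sub>F p in F. \<forall>Z. finite Z \<longrightarrow> {z::int. \<bar>real_of_int z\<bar> \<le> B * R p} \<subseteq> Z \<longrightarrow>
        \<bar>(\<Sum>z\<in>Z. f ?e (real_of_int z / R p)) / R p - V ?e\<bar> \<le> \<epsilon>"
      using R evB by (auto simp: filterlim_iff)
    ultimately show "\<forall>\<^sub>F p in F. dist (s' p - V ?e * s p) 0 < \<eta>"
      using R1
    proof eventually_elim
      case (elim p)
      have "\<bar>s' p - V ?e * s p\<bar> \<le> (\<epsilon> + real (card U) * C * (1 / R p)) * K + Q * K * (2 * B * (R p / ?N p) + 2 * (R p / ?N p))"
        by (rule bound[OF elim(3) B \<epsilon>(1)]) (use elim(2) in blast)
      then show ?case using elim(1) by simp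
    qed
  qed
  then have "((\<lambda>p. (s' p - V ?e * s p) + V ?e * s p) \<longlongrightarrow> 0 + V ?e * (\<Prod>e\<in>E. V e)) F"
    by (intro tendsto_add tendsto_mult tendsto_const lim_s)
  then have "(s' \<longlongrightarrow> (\<Prod>e\<in>insert ?e E. V e)) F"
    using eE finE by simp
  then show ?case by (simp add: s'_def[abs_def] S'_def card)
qed

end

section \<open>The three regimes for sums over linked walks\<close>

context connection_profile
begin

definition profile_int :: "nat \<Rightarrow> real" where
  "profile_int m = (LINT s|lborel. profile m s)"

text \<open>An edge used \<open>m\<close> times contributes its probability times the \<open>m\<close>-th power of its weight.\<close>

definition edge_weight :: "nat \<Rightarrow> real \<Rightarrow> real \<Rightarrow> nat \<Rightarrow> int set \<Rightarrow> real" where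
  "edge_weight n c R m e = c / real (2 * n + 1) * profile m (spread e / R)"

lemma profile_even: "profile m \<bar>s\<bar> = profile m s"
  by (simp add: profile_def psi_abs)

lemma profile_riemann_to: "riemann_to (profile m) (profile_int m)"
proof -
  obtain g where "riemann_dominated (profile m) g" by (rule profile_dominated)
  then show ?thesis unfolding profile_int_def by (rule riemann_dominated.riemann_to_integral)
qed

lemma profile_bounds:
  obtains C where "0 \<le> C" "\<And>s. profile m s \<le> C"
    "\<And>R Z. R \<ge> 1 \<Longrightarrow> finite Z \<Longrightarrow> (\<Sum>z\<in>Z. profile m (real_of_int z / R)) / R \<le> C"
proof -
  obtain g where g: "riemann_dominated (profile m) g" by (rule profile_dominated)
  define C where "C = max ((1 + real m) ^ m) (LINT s|lborel. g s)"
  have "0 \<le> (1 + real m) ^ m" by simp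
  then have "0 \<le> C" by (simp add: C_def le_max_iff_disj)
  moreover have "profile m s \<le> C" for s using profile_le[of m s] by (simp add: C_def le_max_iff_disj)
  moreover have "(\<Sum>z\<in>Z. profile m (real_of_int z / R)) / R \<le> C" if "R \<ge> 1" "finite Z" for R Z
    using riemann_dominated.riemann_sum_le[OF g that] by (simp add: C_def le_max_iff_disj)
  ultimately show ?thesis by (rule that)
qed

lemma edge_family_limit_exists:
  fixes m :: "'e set \<Rightarrow> nat"
  assumes "finite E"
  obtains C where "edge_family_limit (\<lambda>e. profile (m e)) E C (\<lambda>e. profile_int (m e))"
proof -
  have "\<exists>C. 0 \<le> C \<and> (\<forall>s. profile k s \<le> C) \<and>
    (\<forall>R Z. R \<ge> 1 \<longrightarrow> finite Z \<longrightarrow> (\<Sum>z\<in>Z. profile k (real_of_int z / R)) / R \<le> C)" for k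
    using profile_bounds[of k] by metis
  then obtain Cf where Cf: "\<And>k. 0 \<le> Cf k" "\<And>k s. profile k s \<le> Cf k"
    "\<And>k R Z. R \<ge> 1 \<Longrightarrow> finite Z \<Longrightarrow> (\<Sum>z\<in>Z. profile k (real_of_int z / R)) / R \<le> Cf k" by metis
  define C where "C = (\<Sum>e\<in>E. Cf (m e))"
  have le: "Cf (m e) \<le> C" if "e \<in> E" for e
    unfolding C_def using assms that Cf(1) by (intro member_le_sum) auto
  have "edge_family_limit (\<lambda>e. profile (m e)) E C (\<lambda>e. profile_int (m e))"
  proof
    show "0 \<le> profile (m e) s" for e s by (rule profile_nonneg)
    show "profile (m e) s \<le> C" if "e \<in> E" for e s using Cf(2) le[OF that] order_trans by blast
    show "profile (m e) \<bar>s\<bar> = profile (m e) s" for e s by (rule profile_even)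
    show "(\<Sum>z\<in>Z. profile (m e) (real_of_int z / R)) / R \<le> C"
      if "e \<in> E" "1 \<le> R" "finite Z" for e R Z using Cf(3)[OF that(2,3)] le[OF that(1)] order_trans by blast
    show "0 \<le> C" unfolding C_def using Cf(1) by (simp add: sum_nonneg)
    show "riemann_to (profile (m e)) (profile_int (m e))" if "e \<in> E" for e by (rule profile_riemann_to)
  qed
  then show ?thesis by (rule that)
qed

end

text \<open>What the three regimes have in common, along an arbitrary filter; the behaviour of
  \<open>link_dens\<close> is left open.\<close>

locale sparse_limit = connection_profile +
  fixes F :: "'p filter" and n :: "'p \<Rightarrow> nat" and c R :: "'p \<Rightarrow> real"
  assumes R: "filterlim R at_top F"
    and RN: "((\<lambda>p. R p / real (2 * n p + 1)) \<longlongrightarrow> 0) F"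
    and cN: "((\<lambda>p. c p / real (2 * n p + 1)) \<longlongrightarrow> 0) F"
    and c_pos: "\<forall>\<^sub>F p in F. 0 < c p"
begin

abbreviation "link_dens p \<equiv> c p * R p / real (2 * n p + 1)"

definition pattern_sum :: "'i set \<Rightarrow> ('i \<Rightarrow> nat) \<Rightarrow> ('i \<times> nat \<Rightarrow> 'i \<times> nat) \<Rightarrow> 'p \<Rightarrow> real" where
  "pattern_sum I l r p = (\<Sum>y\<in>embeddings (pat_verts I l r) (sites (n p)).
     \<Prod>e\<in>edges I l r. edge_weight (n p) (c p) (R p) (edge_count I l r e) (y ` e)) / (c p * R p)"

definition pattern_value :: "'i set \<Rightarrow> ('i \<Rightarrow> nat) \<Rightarrow> ('i \<times> nat \<Rightarrow> 'i \<times> nat) \<Rightarrow> real" where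
  "pattern_value I l r = (if card (pat_verts I l r) = Suc (card (edges I l r))
     then \<Prod>e\<in>edges I l r. profile_int (edge_count I l r e) else 0)"

lemma R_ge_1: "\<forall>\<^sub>F p in F. R p \<ge> 1"
  using R by (rule filterlim_at_top[THEN iffD1, rule_format])

text \<open>With v vertices and e edges, the normalised sum is a quantity \<open>Q\<close> times (c
  / N)^(e + 1 - v). For a tree the power is 1 and \<open>Q\<close> converges by the tree limit.
  Otherwise boundedness of \<open>Q\<close> suffices, and it follows by summing over a spanning tree
  and bounding the surplus edges by \<open>C\<close>.\<close>

lemma pattern_sum_limit:
  assumes I: "finite I" "I \<noteq> {}" "\<forall>i\<in>I. 1 \<le> l i" and r: "r \<in> patterns I l"
  shows "((\<lambda>p. pattern_sum I l r p / link_dens p ^ (card (pat_verts I l r) - 2)) \<longlongrightarrow> pattern_value I l r) F"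
proof -
  let ?U = "pat_verts I l r" and ?E = "edges I l r"
  let ?v = "card ?U" and ?m = "\<lambda>e. edge_count I l r e"
  let ?N = "\<lambda>p. real (2 * n p + 1)"
  let ?f = "\<lambda>e. profile (?m e)"
  have v2: "2 \<le> ?v" by (rule card_verts_ge_2[OF I(1,2) patternsD(1)[OF r] I(3)])
  have vE: "?v \<le> Suc (card ?E)" by (rule card_verts_le[OF I(1,2) patternsD(2)[OF r] I(3)])
  obtain E' where E': "utree ?U E'" "E' \<subseteq> ?E"
    by (rule spanning_tree[OF I(1,2) patternsD(2)[OF r]]) (use I(3) in auto)
  have cE': "card E' = ?v - 1" using utree_props(5)[OF E'(1)] by simp
  have finE: "finite ?E" using I(1) by simp
  obtain C where "edge_family_limit ?f ?E C (\<lambda>e. profile_int (?m e))"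
    using edge_family_limit_exists[OF finE] by blast
  then interpret fam: edge_family_limit ?f ?E C "\<lambda>e. profile_int (?m e)" .
  define S where "S p = (\<Sum>y\<in>embeddings ?U (sites (n p)). tree_weight ?f ?E (R p) y)" for p
  define Q where "Q p = S p / (?N p * R p ^ (?v - 1))" for p
  have eq: "\<forall>\<^sub>F p in F. Q p * (c p / ?N p) ^ (Suc (card ?E) - ?v) = pattern_sum I l r p / link_dens p ^ (?v - 2)"
    using c_pos R_ge_1
  proof eventually_elim
    case (elim p)
    have N: "?N p > 0" by simp
    have "(\<Sum>y\<in>embeddings ?U (sites (n p)). \<Prod>e\<in>?E. edge_weight (n p) (c p) (R p) (?m e) (y ` e)) =
        (c p / ?N p) ^ card ?E * S p"
      unfolding edge_weight_def prod.distrib tree_weight_def S_def by (simp add: sum_distrib_left)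
    then have "pattern_sum I l r p / link_dens p ^ (?v - 2) =
        (c p / ?N p) ^ card ?E * S p / (c p * R p) / link_dens p ^ (?v - 2)"
      by (simp add: pattern_sum_def)
    also have "(c p / ?N p) ^ card ?E = (c p / ?N p) ^ (Suc (card ?E) - ?v) * (c p / ?N p) ^ (?v - 1)"
      using vE v2 by (simp flip: power_add)
    also have "(c p / ?N p) ^ (?v - 1) = (c p / ?N p) * (c p / ?N p) ^ (?v - 2)"
      using v2 by (simp flip: power_Suc add: Suc_diff_Suc numeral_2_eq_2)
    also have "(c p / ?N p) ^ (Suc (card ?E) - ?v) * ((c p / ?N p) * (c p / ?N p) ^ (?v - 2)) * S p / (c p * R p) / link_dens p ^ (?v - 2) =
        S p / (?N p * (R p * R p ^ (?v - 2))) * (c p / ?N p) ^ (Suc (card ?E) - ?v)"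
    proof -
      have "link_dens p ^ (?v - 2) = (c p / ?N p) ^ (?v - 2) * R p ^ (?v - 2)"
        by (simp add: power_mult_distrib power_divide)
      moreover have "(c p / ?N p) ^ (?v - 2) \<noteq> 0" "R p ^ (?v - 2) \<noteq> 0" "c p \<noteq> 0" "R p \<noteq> 0" "?N p \<noteq> 0"
        using elim by auto
      ultimately show ?thesis by (simp add: field_simps del: of_nat_add of_nat_mult of_nat_Suc)
    qed
    also have "R p * R p ^ (?v - 2) = R p ^ (?v - 1)"
      using v2 by (simp flip: power_Suc add: Suc_diff_Suc numeral_2_eq_2)
    finally show ?case by (simp add: Q_def)
  qed
  have "((\<lambda>p. Q p * (c p / ?N p) ^ (Suc (card ?E) - ?v)) \<longlongrightarrow> pattern_value I l r) F"
  proof (cases "?v = Suc (card ?E)")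
    case True
    then have "E' = ?E" using cE' card_subset_eq[OF finE E'(2)] by simp
    then have "(Q \<longlongrightarrow> (\<Prod>e\<in>?E. profile_int (?m e))) F"
      using fam.tree_limit[OF R RN, of ?U ?E] E'(1) True by (simp add: Q_def[abs_def] S_def)
    then show ?thesis using True by (simp add: pattern_value_def)
  next
    case False
    define a where "a = Suc (card ?E) - ?v"
    have a: "a \<ge> 1" using False vE by (simp add: a_def)
    define K where "K = C ^ card (?E - E') * C ^ (?v - 1)"
    have bound: "0 \<le> Q p \<and> Q p \<le> K" if R1: "R p \<ge> 1" for p
    proof -
      have nn: "0 \<le> tree_weight ?f X (R p) y" for X y by (rule fam.tree_weight_nonneg)
      have finU: "finite ?U" using I(1) by simp
      have "S p \<le> (\<Sum>y\<in>?U \<rightarrow>\<^sub>E sites (n p). tree_weight ?f ?E (R p) y)"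
        unfolding S_def using nn finU by (intro sum_mono2) (auto simp: embeddings_def intro: finite_PiE)
      also have "\<dots> \<le> (\<Sum>y\<in>?U \<rightarrow>\<^sub>E sites (n p). C ^ card (?E - E') * tree_weight ?f E' (R p) y)"
      proof (rule sum_mono)
        fix y
        have "tree_weight ?f ?E (R p) y = tree_weight ?f (?E - E') (R p) y * tree_weight ?f E' (R p) y"
          unfolding tree_weight_def using prod.subset_diff[OF E'(2) finE] by simp
        also have "tree_weight ?f (?E - E') (R p) y \<le> (\<Prod>e\<in>?E - E'. C)"
          unfolding tree_weight_def by (rule prod_mono) (use fam.f_le profile_nonneg in auto)
        then have "tree_weight ?f (?E - E') (R p) y * tree_weight ?f E' (R p) y \<le> C ^ card (?E - E') * tree_weight ?f E' (R p) y"
          using nn by (intro mult_right_mono) auto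
        finally show "tree_weight ?f ?E (R p) y \<le> C ^ card (?E - E') * tree_weight ?f E' (R p) y" .
      qed
      also have "\<dots> \<le> C ^ card (?E - E') * (?N p * (C * R p) ^ card E')"
        unfolding sum_distrib_left[symmetric]
        using fam.tree_sum_le[OF E'(1,2) R1, of "sites (n p)"] fam.C unfolding card_sites
        by (intro mult_left_mono) auto
      finally have "S p \<le> K * (?N p * R p ^ (?v - 1))"
        unfolding cE' K_def by (simp add: power_mult_distrib mult_ac)
      moreover have "0 \<le> S p" unfolding S_def using nn by (simp add: sum_nonneg)
      moreover have "0 < ?N p * R p ^ (?v - 1)" using R1 by simp
      ultimately show ?thesis unfolding Q_def by (simp add: divide_le_eq del: of_nat_add of_nat_mult of_nat_Suc)
    qed
    have "((\<lambda>p. Q p * (c p / ?N p) ^ a) \<longlongrightarrow> 0) F"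
    proof (rule Lim_null_comparison)
      show "\<forall>\<^sub>F p in F. norm (Q p * (c p / ?N p) ^ a) \<le> K * \<bar>c p / ?N p\<bar> ^ a"
        using R_ge_1 by eventually_elim (use bound in \<open>auto simp: abs_mult power_abs intro!: mult_right_mono\<close>)
      have "((\<lambda>p. K * \<bar>c p / ?N p\<bar> ^ a) \<longlongrightarrow> K * \<bar>0\<bar> ^ a) F"
        by (intro tendsto_intros cN)
      moreover have "K * \<bar>0\<bar> ^ a = 0" using a by (simp add: power_0_left)
      ultimately show "((\<lambda>p. K * \<bar>c p / ?N p\<bar> ^ a) \<longlongrightarrow> 0) F" by (simp only:)
    qed
    then show ?thesis using False by (simp add: pattern_value_def a_def)
  qed
  then show ?thesis using eq by (rule Lim_transform_eventually)
qed

definition total_sum :: "'i set \<Rightarrow> ('i \<Rightarrow> nat) \<Rightarrow> 'p \<Rightarrow> real" where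
  "total_sum I l p = link_sum (edge_weight (n p) (c p) (R p)) I l (sites (n p)) / (c p * R p)"

lemma total_sum_patterns: "finite I \<Longrightarrow> total_sum I l p = (\<Sum>r\<in>patterns I l. pattern_sum I l r p)"
  by (simp add: total_sum_def pattern_sum_def link_sum_patterns sum_divide_distrib)

lemma pattern_value_top:
  assumes I: "finite I" "I \<noteq> {}" "\<forall>i\<in>I. 1 \<le> l i" and r: "r \<in> patterns I l"
    and "card (pat_verts I l r) = Suc (top_edges I l)"
  shows "pattern_value I l r = (\<Prod>e\<in>edges I l r. profile_int (edge_count I l r e))"
  using card_verts_le[OF I(1,2) patternsD(2)[OF r] I(3)]
    card_edges_le[OF I(1,2) patternsD(2)[OF r] I(3)] assms(5)
  by (simp add: pattern_value_def)

text \<open>Every edge equals the two-element vertex set, so there is only one edge and the pattern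
  is a tree.\<close>

lemma pattern_value_two:
  assumes I: "finite I" "I \<noteq> {}" "\<forall>i\<in>I. 1 \<le> l i" and r: "r \<in> patterns I l"
    and two: "card (pat_verts I l r) = 2"
  shows "pattern_value I l r = (\<Prod>e\<in>edges I l r. profile_int (edge_count I l r e))"
proof -
  have "e = pat_verts I l r" if e: "e \<in> edges I l r" for e
  proof (rule card_subset_eq)
    show "finite (pat_verts I l r)" using I(1) by simp
    show "e \<subseteq> pat_verts I l r" by (rule edges_subset[OF e])
    obtain p where "p \<in> steps I l" "e = edge r p" using e by (auto simp: edges_def)
    then show "card e = card (pat_verts I l r)"
      using patternsD(1)[OF r] two by (simp add: proper_def edge_def)
  qed
  then have "edges I l r \<subseteq> {pat_verts I l r}" by auto
  then have "card (edges I l r) \<le> 1" using card_mono[of "{pat_verts I l r}"] by fastforce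
  then show ?thesis
    using card_verts_le[OF I(1,2) patternsD(2)[OF r] I(3)] two by (simp add: pattern_value_def)
qed

text \<open>A pattern with v vertices grows at most like the link density to the power v - 2, while
  the normalisation has the exponent \<open>top_edges I l - 1\<close>; only v =
  \<open>top_edges I l\<close> + 1 keeps up with it.\<close>

theorem total_sum_dense:
  assumes I: "finite I" "I \<noteq> {}" "\<forall>i\<in>I. 1 \<le> l i" and dense: "filterlim link_dens at_top F"
  shows "((\<lambda>p. total_sum I l p / link_dens p ^ (top_edges I l - 1)) \<longlongrightarrow> lead_sum profile_int I l) F"
proof -
  let ?t = "top_edges I l" and ?v = "\<lambda>r. card (pat_verts I l r)"
  have inv: "((\<lambda>p. 1 / link_dens p) \<longlongrightarrow> 0) F"
    by (rule tendsto_divide_0[OF tendsto_const]) (rule filterlim_at_top_imp_at_infinity[OF dense])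
  have dpos: "\<forall>\<^sub>F p in F. link_dens p > 0" using dense by (simp add: filterlim_at_top_dense)
  have v: "2 \<le> ?v r" "?v r \<le> Suc ?t" if "r \<in> patterns I l" for r
    using card_verts_ge_2[OF I(1,2) patternsD(1)[OF that] I(3)]
      card_verts_le[OF I(1,2) patternsD(2)[OF that] I(3)] card_edges_le[OF I(1,2) patternsD(2)[OF that] I(3)] by auto
  have lim: "((\<lambda>p. \<Sum>r\<in>patterns I l. pattern_sum I l r p / link_dens p ^ (?v r - 2) * (1 / link_dens p) ^ (Suc ?t - ?v r)) \<longlongrightarrow>
      (\<Sum>r\<in>patterns I l. pattern_value I l r * 0 ^ (Suc ?t - ?v r))) F"
    by (intro tendsto_sum tendsto_mult tendsto_power inv pattern_sum_limit I)
  have val: "(\<Sum>r\<in>patterns I l. pattern_value I l r * 0 ^ (Suc ?t - ?v r)) = lead_sum profile_int I l"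
    unfolding lead_sum_def
  proof (rule sum.mono_neutral_cong_right)
    show "\<forall>r\<in>patterns I l - {r. r \<in> patterns I l \<and> ?v r = Suc ?t}. pattern_value I l r * 0 ^ (Suc ?t - ?v r) = 0"
    proof
      fix r assume r: "r \<in> patterns I l - {r. r \<in> patterns I l \<and> ?v r = Suc ?t}"
      then have "Suc ?t - ?v r \<noteq> 0" using v(2)[of r] by auto
      then show "pattern_value I l r * 0 ^ (Suc ?t - ?v r) = 0" by (simp add: power_0_left)
    qed
  qed (use I pattern_value_top[OF I] in auto)
  have "\<forall>\<^sub>F p in F. (\<Sum>r\<in>patterns I l. pattern_sum I l r p / link_dens p ^ (?v r - 2) * (1 / link_dens p) ^ (Suc ?t - ?v r)) =
      total_sum I l p / link_dens p ^ (?t - 1)"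
    using dpos
  proof eventually_elim
    case (elim p)
    show ?case unfolding total_sum_patterns[OF I(1)] sum_divide_distrib
    proof (rule sum.cong[OF refl])
      fix r assume r: "r \<in> patterns I l"
      have "?t - 1 = (?v r - 2) + (Suc ?t - ?v r)" using v[OF r] by auto
      then have "link_dens p ^ (?t - 1) = link_dens p ^ (?v r - 2) * link_dens p ^ (Suc ?t - ?v r)"
        by (simp only: power_add)
      then show "pattern_sum I l r p / link_dens p ^ (?v r - 2) * (1 / link_dens p) ^ (Suc ?t - ?v r) =
          pattern_sum I l r p / link_dens p ^ (?t - 1)"
        by (simp only: power_one_over[symmetric] power_divide power_one times_divide_eq_right mult_1_right divide_divide_eq_left)
    qed
  qed
  with lim[unfolded val] show ?thesis by (rule Lim_transform_eventually)
qed

theorem total_sum_fixed: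
  assumes I: "finite I" "I \<noteq> {}" "\<forall>i\<in>I. 1 \<le> l i" and fixed: "\<forall>\<^sub>F p in F. link_dens p = s" and s: "s > 0"
  shows "((\<lambda>p. total_sum I l p) \<longlongrightarrow>
    (\<Sum>r\<in>patterns I l. pattern_value I l r * s ^ (card (pat_verts I l r) - 2))) F"
proof -
  have "((\<lambda>p. \<Sum>r\<in>patterns I l. pattern_sum I l r p / link_dens p ^ (card (pat_verts I l r) - 2) * s ^ (card (pat_verts I l r) - 2)) \<longlongrightarrow>
      (\<Sum>r\<in>patterns I l. pattern_value I l r * s ^ (card (pat_verts I l r) - 2))) F"
    by (intro tendsto_sum tendsto_mult tendsto_const pattern_sum_limit I)
  moreover have "\<forall>\<^sub>F p in F. (\<Sum>r\<in>patterns I l. pattern_sum I l r p / link_dens p ^ (card (pat_verts I l r) - 2) * s ^ (card (pat_verts I l r) - 2)) =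
      total_sum I l p"
    using fixed by eventually_elim (use s in \<open>simp add: total_sum_patterns[OF I(1)]\<close>)
  ultimately show ?thesis by (rule Lim_transform_eventually)
qed

text \<open>A positive power of the vanishing link density removes every pattern with more than two
  vertices.\<close>

theorem total_sum_dilute:
  assumes I: "finite I" "I \<noteq> {}" "\<forall>i\<in>I. 1 \<le> l i" and dilute: "(link_dens \<longlongrightarrow> 0) F"
  shows "((\<lambda>p. total_sum I l p) \<longlongrightarrow> 2 ^ (card I - 1) * profile_int (\<Sum>i\<in>I. l i)) F"
proof -
  let ?v = "\<lambda>r. card (pat_verts I l r)"
  have lim: "((\<lambda>p. \<Sum>r\<in>patterns I l. pattern_sum I l r p / link_dens p ^ (?v r - 2) * link_dens p ^ (?v r - 2)) \<longlongrightarrow>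
      (\<Sum>r\<in>patterns I l. pattern_value I l r * 0 ^ (?v r - 2))) F"
    by (intro tendsto_sum tendsto_mult tendsto_power dilute pattern_sum_limit I)
  have val: "(\<Sum>r\<in>patterns I l. pattern_value I l r * 0 ^ (?v r - 2)) =
      (\<Sum>r | r \<in> patterns I l \<and> ?v r = 2. \<Prod>e\<in>edges I l r. profile_int (edge_count I l r e))"
  proof (rule sum.mono_neutral_cong_right)
    show "\<forall>r\<in>patterns I l - {r. r \<in> patterns I l \<and> ?v r = 2}. pattern_value I l r * 0 ^ (?v r - 2) = 0"
    proof
      fix r assume r: "r \<in> patterns I l - {r. r \<in> patterns I l \<and> ?v r = 2}"
      then have "2 \<le> ?v r" using card_verts_ge_2[OF I(1,2) patternsD(1)[of r I l] I(3)] by auto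
      then have "?v r - 2 \<noteq> 0" using r by auto
      then show "pattern_value I l r * 0 ^ (?v r - 2) = 0" by (simp add: power_0_left)
    qed
  qed (use I pattern_value_two[OF I] in auto)
  have "\<forall>\<^sub>F p in F. (\<Sum>r\<in>patterns I l. pattern_sum I l r p / link_dens p ^ (?v r - 2) * link_dens p ^ (?v r - 2)) = total_sum I l p"
    using c_pos R_ge_1
  proof eventually_elim
    case (elim p)
    then have "link_dens p \<noteq> 0" by simp
    then show ?case by (simp add: total_sum_patterns[OF I(1)])
  qed
  with lim[unfolded val sum_two_vertex_patterns[OF I]] show ?thesis by (rule Lim_transform_eventually)
qed

end

section \<open>Cumulants of polynomials in independent indicators\<close>

lemma sum_PiE_split:
  fixes g h :: "('i \<Rightarrow> 'x) \<Rightarrow> real"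
  assumes B: "B \<subseteq> I"
    and g: "\<And>z z'. (\<And>i. i \<in> B \<Longrightarrow> z i = z' i) \<Longrightarrow> g z = g z'"
    and h: "\<And>z z'. (\<And>i. i \<in> I - B \<Longrightarrow> z i = z' i) \<Longrightarrow> h z = h z'"
  shows "(\<Sum>z\<in>I \<rightarrow>\<^sub>E X. g z * h z) = (\<Sum>z\<in>B \<rightarrow>\<^sub>E X. g z) * (\<Sum>z\<in>I - B \<rightarrow>\<^sub>E X. h z)"
proof -
  have "(\<Sum>z\<in>B \<rightarrow>\<^sub>E X. g z) * (\<Sum>z\<in>I - B \<rightarrow>\<^sub>E X. h z) =
      (\<Sum>(u, v)\<in>(B \<rightarrow>\<^sub>E X) \<times> (I - B \<rightarrow>\<^sub>E X). g u * h v)"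
    by (simp add: sum_product sum.cartesian_product)
  also have "\<dots> = (\<Sum>z\<in>I \<rightarrow>\<^sub>E X. g z * h z)"
  proof (rule sum.reindex_bij_witness[where i = "\<lambda>z. (restrict z B, restrict z (I - B))"
        and j = "\<lambda>(u, v). \<lambda>i. if i \<in> B then u i else v i"])
    fix a assume "a \<in> (B \<rightarrow>\<^sub>E X) \<times> (I - B \<rightarrow>\<^sub>E X)"
    then obtain u v where a: "a = (u, v)" and u: "u \<in> B \<rightarrow>\<^sub>E X" and v: "v \<in> I - B \<rightarrow>\<^sub>E X" by auto
    let ?z = "\<lambda>i. if i \<in> B then u i else v i"
    have "restrict ?z B = u"
    proof
      fix i show "restrict ?z B i = u i" using PiE_arb[OF u, of i] by (cases "i \<in> B") auto
    qed
    moreover have "restrict ?z (I - B) = v"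
    proof
      fix i show "restrict ?z (I - B) i = v i" using PiE_arb[OF v, of i] by (cases "i \<in> I - B") auto
    qed
    ultimately show "(restrict (case a of (u, v) \<Rightarrow> \<lambda>i. if i \<in> B then u i else v i) B,
        restrict (case a of (u, v) \<Rightarrow> \<lambda>i. if i \<in> B then u i else v i) (I - B)) = a"
      by (simp add: a)
    show "(case a of (u, v) \<Rightarrow> \<lambda>i. if i \<in> B then u i else v i) \<in> I \<rightarrow>\<^sub>E X"
    proof (rule PiE_I)
      fix i assume "i \<in> I"
      then show "(case a of (u, v) \<Rightarrow> \<lambda>i. if i \<in> B then u i else v i) i \<in> X"
        using PiE_mem[OF u, of i] PiE_mem[OF v, of i] by (simp add: a)
    next
      fix i assume "i \<notin> I"
      then show "(case a of (u, v) \<Rightarrow> \<lambda>i. if i \<in> B then u i else v i) i = undefined"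
        using PiE_arb[OF v, of i] B by (auto simp: a)
    qed
    have "g ?z = g u" "h ?z = h v" by (rule g, simp, rule h, simp)
    then show "g (case a of (u, v) \<Rightarrow> \<lambda>i. if i \<in> B then u i else v i) *
        h (case a of (u, v) \<Rightarrow> \<lambda>i. if i \<in> B then u i else v i) = (case a of (u, v) \<Rightarrow> g u * h v)"
      by (simp add: a)
  next
    fix z assume z: "z \<in> I \<rightarrow>\<^sub>E X"
    show "(case (restrict z B, restrict z (I - B)) of (u, v) \<Rightarrow> \<lambda>i. if i \<in> B then u i else v i) = z"
    proof
      fix i show "(case (restrict z B, restrict z (I - B)) of (u, v) \<Rightarrow> \<lambda>i. if i \<in> B then u i else v i) i = z i"
        using PiE_arb[OF z, of i] B by (cases "i \<in> I") auto
    qed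
    show "(restrict z B, restrict z (I - B)) \<in> (B \<rightarrow>\<^sub>E X) \<times> (I - B \<rightarrow>\<^sub>E X)"
      using z B by (auto dest: PiE_mem)
  qed
  finally show ?thesis ..
qed

lemma sum_Pow_card:
  fixes g :: "nat \<Rightarrow> real"
  assumes "finite A"
  shows "(\<Sum>C\<in>Pow A. g (card C)) = (\<Sum>i\<le>card A. real (card A choose i) * g i)"
proof -
  have "(\<Sum>C\<in>Pow A. g (card C)) = (\<Sum>i\<le>card A. \<Sum>C\<in>{C \<in> Pow A. card C = i}. g (card C))"
    by (rule sum.group[symmetric]) (use assms in \<open>auto intro: card_mono\<close>)
  also have "\<dots> = (\<Sum>i\<le>card A. real (card A choose i) * g i)"
    using n_subsets[OF assms] by (intro sum.cong refl) (simp add: Pow_def)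
  finally show ?thesis .
qed

text \<open>A proper block with the least index is that index and a choice of some, not all, of the
  other j elements; this produces the binomial coefficients of \<open>cumulant_rec\<close>.\<close>

lemma sum_Min_subsets:
  fixes g :: "nat \<Rightarrow> real"
  assumes "finite I" "I \<noteq> {}" "card I = Suc j"
  shows "(\<Sum>B | B \<subset> I \<and> Min I \<in> B. g (card B)) = (\<Sum>i<j. real (j choose i) * g (Suc i))"
proof -
  let ?m = "Min I" and ?A = "I - {Min I}"
  have m: "?m \<in> I" using assms by simp
  have fA: "finite ?A" and cA: "card ?A = j" using assms m by simp_all
  have "(\<Sum>B | B \<subset> I \<and> ?m \<in> B. g (card B)) = (\<Sum>C\<in>Pow ?A - {?A}. g (Suc (card C)))"
  proof (rule sum.reindex_bij_witness[where i = "insert ?m" and j = "\<lambda>B. B - {?m}"])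
    fix B assume B: "B \<in> {B. B \<subset> I \<and> ?m \<in> B}"
    then show "insert ?m (B - {?m}) = B" by auto
    show "B - {?m} \<in> Pow ?A - {?A}" using B by auto
    have "finite B" using B assms(1) by (auto intro: finite_subset)
    then have "card B = Suc (card (B - {?m}))" using B by (intro card.remove) auto
    then show "g (Suc (card (B - {?m}))) = g (card B)" by (simp only:)
  next
    fix C assume C: "C \<in> Pow ?A - {?A}"
    then show "insert ?m C - {?m} = C" by auto
    show "insert ?m C \<in> {B. B \<subset> I \<and> ?m \<in> B}" using C m by auto
  qed
  also have "\<dots> = (\<Sum>C\<in>Pow ?A. g (Suc (card C))) - g (Suc j)"
    using fA cA by (simp add: sum_diff1)
  also have "\<dots> = (\<Sum>i<j. real (j choose i) * g (Suc i))"
    using sum_Pow_card[OF fA, of "\<lambda>i. g (Suc i)"] cA by (simp add: lessThan_Suc_atMost[symmetric])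
  finally show ?thesis .
qed

text \<open>Independence enters through the product moments \<open>b_prod\<close>. Since the
  indicators are idempotent, a monomial is recorded by the set \<open>S x\<close> of its indicators,
  without exponents.\<close>

locale bernoulli_polynomial = prob_space M for M :: "'w measure" +
  fixes X :: "'x set" and W :: "'x \<Rightarrow> real" and S :: "'x \<Rightarrow> 'e set" and p :: "'e \<Rightarrow> real"
    and b :: "'e \<Rightarrow> 'w \<Rightarrow> real" and EE :: "'e set"
  assumes finX: "finite X" and finS: "\<And>x. finite (S x)" and SE: "\<And>x. x \<in> X \<Longrightarrow> S x \<subseteq> EE"
    and b01: "\<And>e \<omega>. e \<in> EE \<Longrightarrow> \<omega> \<in> space M \<Longrightarrow> b e \<omega> \<in> {0, 1}"
    and b_meas: "\<And>e. e \<in> EE \<Longrightarrow> b e \<in> borel_measurable M"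
    and b_prod: "\<And>T. finite T \<Longrightarrow> T \<subseteq> EE \<Longrightarrow> expectation (\<lambda>\<omega>. \<Prod>e\<in>T. b e \<omega>) = (\<Prod>e\<in>T. p e)"
begin

definition poly_value :: "'w \<Rightarrow> real" where
  "poly_value \<omega> = (\<Sum>x\<in>X. W x * (\<Prod>e\<in>S x. b e \<omega>))"

definition joint_moment :: "(nat \<Rightarrow> 'x) \<Rightarrow> nat set \<Rightarrow> real" where
  "joint_moment z I = (\<Prod>e\<in>(\<Union>i\<in>I. S (z i)). p e)"

lemma prod_b_measurable:
  assumes "T \<subseteq> EE"
  shows "(\<lambda>\<omega>. \<Prod>e\<in>T. b e \<omega>) \<in> borel_measurable M"
  using assms by (intro borel_measurable_prod b_meas) auto

lemma prod_b_01: "T \<subseteq> EE \<Longrightarrow> \<omega> \<in> space M \<Longrightarrow> (\<Prod>e\<in>T. b e \<omega>) \<in> {0, 1}"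
proof (induction T rule: infinite_finite_induct)
  case (insert e T)
  then show ?case using b01[of e \<omega>] by auto
qed auto

lemma poly_value_measurable: "poly_value \<in> borel_measurable M"
  unfolding poly_value_def[abs_def] using SE by (intro borel_measurable_sum borel_measurable_times prod_b_measurable) auto

lemma poly_value_finite_range: "finite (poly_value ` space M)"
proof (rule finite_subset)
  show "poly_value ` space M \<subseteq> (\<lambda>v. \<Sum>x\<in>X. W x * v x) ` (X \<rightarrow>\<^sub>E {0, 1})"
  proof (rule image_subsetI)
    fix \<omega> assume w: "\<omega> \<in> space M"
    let ?v = "\<lambda>x\<in>X. \<Prod>e\<in>S x. b e \<omega>"
    have "?v \<in> X \<rightarrow>\<^sub>E {0, 1}" using prod_b_01[OF SE w] by (intro restrict_PiE_iff[THEN iffD2] ballI) 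
    moreover have "poly_value \<omega> = (\<Sum>x\<in>X. W x * ?v x)" by (simp add: poly_value_def)
    ultimately show "poly_value \<omega> \<in> (\<lambda>v. \<Sum>x\<in>X. W x * v x) ` (X \<rightarrow>\<^sub>E {0, 1})" by (intro image_eqI)
  qed
  show "finite ((\<lambda>v. \<Sum>x\<in>X. W x * v x) ` (X \<rightarrow>\<^sub>E {0, 1}))"
    using finX by (intro finite_imageI finite_PiE) auto
qed

lemma prod_b_union:
  assumes "finite I" "\<And>i. i \<in> I \<Longrightarrow> z i \<in> X" "\<omega> \<in> space M"
  shows "(\<Prod>i\<in>I. \<Prod>e\<in>S (z i). b e \<omega>) = (\<Prod>e\<in>(\<Union>i\<in>I. S (z i)). b e \<omega>)"
  using assms
proof (induction I rule: finite_induct)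
  case (insert i I)
  let ?A = "S (z i)" and ?B = "\<Union>i\<in>I. S (z i)"
  have fin: "finite ?A" "finite ?B" using finS insert by auto
  have AE: "?A \<subseteq> EE" "?B \<subseteq> EE" using SE insert.prems(1) by blast+
  have sq: "(\<Prod>e\<in>T. b e \<omega>) * (\<Prod>e\<in>T. b e \<omega>) = (\<Prod>e\<in>T. b e \<omega>)" if "T \<subseteq> EE" for T
    using prod_b_01[OF that insert.prems(2)] by auto
  have A: "(\<Prod>e\<in>?A. b e \<omega>) = (\<Prod>e\<in>?A - ?B. b e \<omega>) * (\<Prod>e\<in>?A \<inter> ?B. b e \<omega>)"
    using prod.Int_Diff[OF fin(1), of "\<lambda>e. b e \<omega>" ?B] by (simp add: mult.commute)
  have B: "(\<Prod>e\<in>?B. b e \<omega>) = (\<Prod>e\<in>?B - ?A. b e \<omega>) * (\<Prod>e\<in>?A \<inter> ?B. b e \<omega>)"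
    using prod.Int_Diff[OF fin(2), of "\<lambda>e. b e \<omega>" ?A] by (simp add: mult.commute Int_commute)
  have "(\<Prod>e\<in>?A. b e \<omega>) * (\<Prod>e\<in>?B. b e \<omega>) = (\<Prod>e\<in>?A - ?B. b e \<omega>) * (\<Prod>e\<in>?B. b e \<omega>)"
    unfolding A by (subst (1 2) B) (use sq[of "?A \<inter> ?B"] AE in \<open>auto simp: mult_ac\<close>)
  also have "\<dots> = (\<Prod>e\<in>(?A - ?B) \<union> ?B. b e \<omega>)"
    using fin by (intro prod.union_disjoint[symmetric]) auto
  also have "(?A - ?B) \<union> ?B = (\<Union>i\<in>insert i I. S (z i))" by auto
  finally show ?case using insert by simp
qed simp

lemma moment_expand:
  assumes "finite I"
  shows "expectation (\<lambda>\<omega>. poly_value \<omega> ^ card I) =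
    (\<Sum>z\<in>I \<rightarrow>\<^sub>E X. (\<Prod>i\<in>I. W (z i)) * joint_moment z I)"
proof -
  let ?U = "\<lambda>z. \<Union>i\<in>I. S (z i)"
  have sub: "?U z \<subseteq> EE" if "z \<in> I \<rightarrow>\<^sub>E X" for z
    using SE PiE_mem[OF that] by blast
  have finU: "finite (?U z)" for z using assms finS by auto
  have finP: "finite (I \<rightarrow>\<^sub>E X)" using assms finX by (auto intro: finite_PiE)
  have "expectation (\<lambda>\<omega>. poly_value \<omega> ^ card I) =
      expectation (\<lambda>\<omega>. \<Sum>z\<in>I \<rightarrow>\<^sub>E X. (\<Prod>i\<in>I. W (z i)) * (\<Prod>e\<in>?U z. b e \<omega>))"
  proof (rule Bochner_Integration.integral_cong[OF refl])
    fix \<omega> assume w: "\<omega> \<in> space M"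
    have "poly_value \<omega> ^ card I = (\<Prod>i\<in>I. \<Sum>x\<in>X. W x * (\<Prod>e\<in>S x. b e \<omega>))"
      by (simp add: poly_value_def)
    also have "\<dots> = (\<Sum>z\<in>I \<rightarrow>\<^sub>E X. \<Prod>i\<in>I. W (z i) * (\<Prod>e\<in>S (z i). b e \<omega>))"
      by (rule prod_sum_PiE) (use assms finX in auto)
    also have "\<dots> = (\<Sum>z\<in>I \<rightarrow>\<^sub>E X. (\<Prod>i\<in>I. W (z i)) * (\<Prod>e\<in>?U z. b e \<omega>))"
    proof (intro sum.cong refl)
      fix z assume "z \<in> I \<rightarrow>\<^sub>E X"
      from prod_b_union[OF assms PiE_mem[OF this] w]
      show "(\<Prod>i\<in>I. W (z i) * (\<Prod>e\<in>S (z i). b e \<omega>)) = (\<Prod>i\<in>I. W (z i)) * (\<Prod>e\<in>?U z. b e \<omega>)"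
        by (simp add: prod.distrib)
    qed
    finally show "poly_value \<omega> ^ card I = (\<Sum>z\<in>I \<rightarrow>\<^sub>E X. (\<Prod>i\<in>I. W (z i)) * (\<Prod>e\<in>?U z. b e \<omega>))" .
  qed
  also have "\<dots> = (\<Sum>z\<in>I \<rightarrow>\<^sub>E X. (\<Prod>i\<in>I. W (z i)) * expectation (\<lambda>\<omega>. \<Prod>e\<in>?U z. b e \<omega>))"
  proof (subst Bochner_Integration.integral_sum)
    fix z assume z: "z \<in> I \<rightarrow>\<^sub>E X"
    have "integrable M (\<lambda>\<omega>. \<Prod>e\<in>?U z. b e \<omega>)"
    proof (rule integrable_const_bound[where B = 1])
      show "AE \<omega> in M. norm (\<Prod>e\<in>?U z. b e \<omega>) \<le> 1"
        using prod_b_01[OF sub[OF z]] by (intro AE_I2) fastforce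
    qed (rule prod_b_measurable[OF sub[OF z]])
    then show "integrable M (\<lambda>\<omega>. (\<Prod>i\<in>I. W (z i)) * (\<Prod>e\<in>?U z. b e \<omega>))" by simp
  qed simp
  also have "\<dots> = (\<Sum>z\<in>I \<rightarrow>\<^sub>E X. (\<Prod>i\<in>I. W (z i)) * joint_moment z I)"
    unfolding joint_moment_def using b_prod finU sub by (intro sum.cong refl) simp
  finally show ?thesis .
qed

lemma joint_moment_cong: "(\<And>i. i \<in> I \<Longrightarrow> z i = z' i) \<Longrightarrow> joint_moment z I = joint_moment z' I"
  unfolding joint_moment_def by (intro prod.cong SUP_cong) auto

lemma jcum_moment_cong:
  assumes "\<And>i. i \<in> I \<Longrightarrow> z i = z' i"
  shows "jcum (joint_moment z) I = jcum (joint_moment z') I"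
proof (rule jcum_cong, rule joint_moment_cong)
  fix B i assume "B \<subseteq> I" "i \<in> B"
  then show "z i = z' i" using assms by blast
qed

text \<open>Summed over all tuples \<open>z\<close>, the recursion of \<open>jcum\<close> becomes
  that of \<open>cumulant_rec\<close>: for a fixed block the sum factors into one over the block and
  one over its complement, and both depend only on the size of the block.\<close>

lemma cumulant_rec_expand:
  assumes "finite I" "card I = Suc j"
  shows "cumulant_rec (\<lambda>i. expectation (\<lambda>\<omega>. poly_value \<omega> ^ i)) j =
    (\<Sum>z\<in>I \<rightarrow>\<^sub>E X. (\<Prod>i\<in>I. W (z i)) * jcum (joint_moment z) I)"
  using assms
proof (induction j arbitrary: I rule: less_induct)
  case (less j)
  let ?m = "\<lambda>i. expectation (\<lambda>\<omega>. poly_value \<omega> ^ i)"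
  let ?K = "cumulant_rec ?m"
  let ?B = "{B. B \<subset> I \<and> Min I \<in> B}"
  have I: "finite I" "I \<noteq> {}" using less.prems by auto
  have finB: "finite ?B" by (rule finite_Min_subsets[OF I(1)])
  have "(\<Sum>z\<in>I \<rightarrow>\<^sub>E X. (\<Prod>i\<in>I. W (z i)) * jcum (joint_moment z) I) =
      (\<Sum>z\<in>I \<rightarrow>\<^sub>E X. (\<Prod>i\<in>I. W (z i)) * joint_moment z I) -
      (\<Sum>z\<in>I \<rightarrow>\<^sub>E X. \<Sum>B\<in>?B. (\<Prod>i\<in>I. W (z i)) * (jcum (joint_moment z) B * joint_moment z (I - B)))"
    by (simp only: jcum_rec[OF I(1)] right_diff_distrib sum_subtractf sum_distrib_left)
  also have "(\<Sum>z\<in>I \<rightarrow>\<^sub>E X. (\<Prod>i\<in>I. W (z i)) * joint_moment z I) = ?m (Suc j)"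
    using moment_expand[OF I(1)] less.prems(2) by simp
  also have "(\<Sum>z\<in>I \<rightarrow>\<^sub>E X. \<Sum>B\<in>?B. (\<Prod>i\<in>I. W (z i)) * (jcum (joint_moment z) B * joint_moment z (I - B))) =
      (\<Sum>B\<in>?B. \<Sum>z\<in>I \<rightarrow>\<^sub>E X. (\<Prod>i\<in>I. W (z i)) * (jcum (joint_moment z) B * joint_moment z (I - B)))"
    by (rule sum.swap)
  also have "\<dots> = (\<Sum>B\<in>?B. ?K (card B - 1) * ?m (Suc j - card B))"
  proof (rule sum.cong[OF refl])
    fix B assume B: "B \<in> ?B"
    then have BI: "B \<subseteq> I" by auto
    have finBB: "finite B" using BI I(1) by (rule finite_subset)
    have cB: "card B \<ge> 1" using B finBB by (auto simp: Suc_le_eq card_gt_0_iff)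
    have cI: "card B < Suc j" using B less.prems psubset_card_mono[of I B] by auto
    have "(\<Sum>z\<in>I \<rightarrow>\<^sub>E X. (\<Prod>i\<in>I. W (z i)) * (jcum (joint_moment z) B * joint_moment z (I - B))) =
        (\<Sum>z\<in>I \<rightarrow>\<^sub>E X. ((\<Prod>i\<in>B. W (z i)) * jcum (joint_moment z) B) * ((\<Prod>i\<in>I - B. W (z i)) * joint_moment z (I - B)))"
    proof (intro sum.cong refl)
      fix z
      have "(\<Prod>i\<in>I. W (z i)) = (\<Prod>i\<in>I - B. W (z i)) * (\<Prod>i\<in>B. W (z i))"
        by (rule prod.subset_diff[OF BI I(1)])
      then show "(\<Prod>i\<in>I. W (z i)) * (jcum (joint_moment z) B * joint_moment z (I - B)) =
        ((\<Prod>i\<in>B. W (z i)) * jcum (joint_moment z) B) * ((\<Prod>i\<in>I - B. W (z i)) * joint_moment z (I - B))"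
        by (simp only: mult_ac)
    qed
    also have "\<dots> = (\<Sum>z\<in>B \<rightarrow>\<^sub>E X. (\<Prod>i\<in>B. W (z i)) * jcum (joint_moment z) B) *
        (\<Sum>z\<in>I - B \<rightarrow>\<^sub>E X. (\<Prod>i\<in>I - B. W (z i)) * joint_moment z (I - B))"
    proof (rule sum_PiE_split[OF BI])
      fix z z' :: "nat \<Rightarrow> 'x"
      { assume *: "\<And>i. i \<in> B \<Longrightarrow> z i = z' i"
        show "(\<Prod>i\<in>B. W (z i)) * jcum (joint_moment z) B = (\<Prod>i\<in>B. W (z' i)) * jcum (joint_moment z') B"
          using jcum_moment_cong[of B z z', OF *] * by (simp cong: prod.cong) }
      { assume *: "\<And>i. i \<in> I - B \<Longrightarrow> z i = z' i"
        show "(\<Prod>i\<in>I - B. W (z i)) * joint_moment z (I - B) = (\<Prod>i\<in>I - B. W (z' i)) * joint_moment z' (I - B)"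
        proof -
          have "(\<Prod>i\<in>I - B. W (z i)) = (\<Prod>i\<in>I - B. W (z' i))"
            by (rule prod.cong[OF refl]) (simp only: *)
          then show ?thesis using joint_moment_cong[of "I - B" z z', OF *] by simp
        qed }
    qed
    also have "\<dots> = ?K (card B - 1) * ?m (card (I - B))"
      using less.IH[of "card B - 1" B] finBB cB cI moment_expand[of "I - B"] I(1) by simp
    also have "card (I - B) = Suc j - card B" using card_Diff_subset[OF finBB BI] less.prems by simp
    finally show "(\<Sum>z\<in>I \<rightarrow>\<^sub>E X. (\<Prod>i\<in>I. W (z i)) * (jcum (joint_moment z) B * joint_moment z (I - B))) =
      ?K (card B - 1) * ?m (Suc j - card B)" .
  qed
  also have "\<dots> = (\<Sum>i<j. real (j choose i) * (?K i * ?m (j - i)))"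
    using sum_Min_subsets[OF I less.prems(2), of "\<lambda>c. ?K (c - 1) * ?m (Suc j - c)"] by simp
  finally show ?case
    by (simp add: cumulant_rec.simps[of ?m j] mult.assoc)
qed

text \<open>A termwise comparison; the error can be measured by \<open>T\<close> itself because all
  weights and moments are nonnegative.\<close>

theorem cumulant_rec_approx:
  fixes j :: nat
  assumes W: "\<And>x. x \<in> X \<Longrightarrow> 0 \<le> W x" and p: "\<And>e. 0 \<le> p e" "\<And>e. p e \<le> \<epsilon>" and eps: "\<epsilon> \<le> 1"
  defines "T \<equiv> (\<Sum>z | z \<in> {..j} \<rightarrow>\<^sub>E X \<and> linked {..j} (\<lambda>i. S (z i)). (\<Prod>i\<le>j. W (z i)) * joint_moment z {..j})"
  shows "\<bar>cumulant_rec (\<lambda>i. expectation (\<lambda>\<omega>. poly_value \<omega> ^ i)) j - T\<bar> \<le>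
    2 ^ (Suc j + (Suc j)\<^sup>2) * \<epsilon> * T"
proof -
  let ?I = "{..j}" and ?P = "{..j} \<rightarrow>\<^sub>E X"
  let ?lk = "\<lambda>z. linked ?I (\<lambda>i. S (z i))" and ?w = "\<lambda>z. \<Prod>i\<le>j. W (z i)"
  let ?c = "2 ^ (Suc j + (Suc j)\<^sup>2) * \<epsilon>"
  have finP: "finite ?P" using finX by (auto intro: finite_PiE)
  have T: "T = (\<Sum>z\<in>?P. if ?lk z then ?w z * joint_moment z ?I else 0)"
    unfolding T_def using finP by (simp add: sum.inter_filter[symmetric])
  have "\<bar>cumulant_rec (\<lambda>i. expectation (\<lambda>\<omega>. poly_value \<omega> ^ i)) j - T\<bar> =
      \<bar>\<Sum>z\<in>?P. ?w z * jcum (joint_moment z) ?I - (if ?lk z then ?w z * joint_moment z ?I else 0)\<bar>"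
    unfolding T sum_subtractf using cumulant_rec_expand[of ?I j] by simp
  also have "\<dots> \<le> (\<Sum>z\<in>?P. \<bar>?w z * jcum (joint_moment z) ?I - (if ?lk z then ?w z * joint_moment z ?I else 0)\<bar>)"
    by (rule sum_abs)
  also have "\<dots> \<le> (\<Sum>z\<in>?P. ?c * (if ?lk z then ?w z * joint_moment z ?I else 0))"
  proof (rule sum_mono)
    fix z assume z: "z \<in> ?P"
    have w: "0 \<le> ?w z" using W PiE_mem[OF z] by (intro prod_nonneg) auto
    have jm: "joint_moment z = (\<lambda>B. \<Prod>e\<in>(\<Union>i\<in>B. S (z i)). p e)" by (simp add: joint_moment_def fun_eq_iff)
    show "\<bar>?w z * jcum (joint_moment z) ?I - (if ?lk z then ?w z * joint_moment z ?I else 0)\<bar> \<le>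
        ?c * (if ?lk z then ?w z * joint_moment z ?I else 0)"
    proof (cases "?lk z")
      case True
      have "\<bar>jcum (joint_moment z) ?I - joint_moment z ?I\<bar> \<le> 2 ^ (card ?I + card ?I ^ 2) * \<epsilon> * joint_moment z ?I"
        unfolding jm by (rule jcum_linked_approx[OF finS p eps]) (use True in auto)
      then have "?w z * \<bar>jcum (joint_moment z) ?I - joint_moment z ?I\<bar> \<le> ?w z * (?c * joint_moment z ?I)"
        using w by (intro mult_left_mono) auto
      moreover have "\<bar>?w z * jcum (joint_moment z) ?I - ?w z * joint_moment z ?I\<bar> =
          ?w z * \<bar>jcum (joint_moment z) ?I - joint_moment z ?I\<bar>"
        using w by (simp only: right_diff_distrib[symmetric] abs_mult abs_of_nonneg)
      ultimately show ?thesis using True by (simp only: if_True mult_ac)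
    next
      case False
      have "jcum (joint_moment z) ?I = 0"
        unfolding jm by (rule jcum_not_linked[OF finS p eps]) (use False in auto)
      then show ?thesis using False by simp
    qed
  qed
  also have "\<dots> = ?c * T" by (simp only: T sum_distrib_left)
  finally show ?thesis .
qed

end

section \<open>The random matrix model\<close>

text \<open>The end vertex is kept fixed so that the induction can append a last step.\<close>

lemma sum_pow_mat_column:
  fixes A :: "real mat"
  assumes A: "A \<in> carrier_mat N N" and j: "j < N"
  shows "(\<Sum>i<N. (A ^\<^sub>m q) $$ (i, j)) =
    (\<Sum>x\<in>{..q} \<rightarrow>\<^sub>E {..<N}. if x q = j then \<Prod>t<q. A $$ (x t, x (Suc t)) else 0)"
  using j
proof (induction q arbitrary: j)
  case 0
  have "(\<Sum>i<N. (A ^\<^sub>m 0) $$ (i, j)) = (\<Sum>i<N. if i = j then 1 else 0)"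
    using A 0 by (intro sum.cong) auto
  moreover have "(\<Sum>x\<in>insert 0 {} \<rightarrow>\<^sub>E {..<N}. if x (0::nat) = j then 1 else 0 :: real) =
      (\<Sum>y\<in>{} \<rightarrow>\<^sub>E {..<N}. \<Sum>z<N. if (y(0 := z)) (0::nat) = j then 1 else 0)"
    by (rule sum_PiE_insert) simp
  moreover have "{..0} = insert (0::nat) {}" by auto
  ultimately show ?case using 0 by (simp cong: if_cong)
next
  case (Suc q)
  let ?w = "\<lambda>x. \<Prod>t<q. A $$ (x t, x (Suc t))"
  have fin: "finite ({..q} \<rightarrow>\<^sub>E {..<N})" by (auto intro: finite_PiE)
  have Aq: "A ^\<^sub>m q \<in> carrier_mat N N" using A by simp
  have "(\<Sum>i<N. (A ^\<^sub>m Suc q) $$ (i, j)) = (\<Sum>i<N. \<Sum>k<N. (A ^\<^sub>m q) $$ (i, k) * A $$ (k, j))"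
  proof (rule sum.cong[OF refl])
    fix i assume "i \<in> {..<N}"
    then show "(A ^\<^sub>m Suc q) $$ (i, j) = (\<Sum>k<N. (A ^\<^sub>m q) $$ (i, k) * A $$ (k, j))"
      using A Aq Suc.prems by (simp add: scalar_prod_def atLeast0LessThan)
  qed
  also have "\<dots> = (\<Sum>k<N. (\<Sum>i<N. (A ^\<^sub>m q) $$ (i, k)) * A $$ (k, j))"
    by (subst sum.swap) (simp add: sum_distrib_right)
  also have "\<dots> = (\<Sum>k<N. \<Sum>x | x \<in> {..q} \<rightarrow>\<^sub>E {..<N} \<and> x q = k. ?w x * A $$ (x q, j))"
  proof (rule sum.cong[OF refl])
    fix k assume "k \<in> {..<N}"
    then have "(\<Sum>i<N. (A ^\<^sub>m q) $$ (i, k)) = (\<Sum>x | x \<in> {..q} \<rightarrow>\<^sub>E {..<N} \<and> x q = k. ?w x)"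
      using Suc.IH[of k] fin by (simp add: sum.inter_filter)
    then show "(\<Sum>i<N. (A ^\<^sub>m q) $$ (i, k)) * A $$ (k, j) =
        (\<Sum>x | x \<in> {..q} \<rightarrow>\<^sub>E {..<N} \<and> x q = k. ?w x * A $$ (x q, j))"
      by (simp add: sum_distrib_right)
  qed
  also have "\<dots> = (\<Sum>x\<in>{..q} \<rightarrow>\<^sub>E {..<N}. ?w x * A $$ (x q, j))"
    by (rule sum.group) (use fin in \<open>auto dest: PiE_mem\<close>)
  also have "\<dots> = (\<Sum>y\<in>{..q} \<rightarrow>\<^sub>E {..<N}. \<Sum>z<N. if (y(Suc q := z)) (Suc q) = j
      then \<Prod>t<Suc q. A $$ ((y(Suc q := z)) t, (y(Suc q := z)) (Suc t)) else 0)"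
  proof (rule sum.cong[OF refl])
    fix y
    have "(\<Sum>z<N. if (y(Suc q := z)) (Suc q) = j
      then \<Prod>t<Suc q. A $$ ((y(Suc q := z)) t, (y(Suc q := z)) (Suc t)) else 0) =
      (\<Sum>z<N. if z = j then ?w y * A $$ (y q, j) else 0)"
      by (intro sum.cong refl) (auto intro!: prod.cong)
    then show "?w y * A $$ (y q, j) = (\<Sum>z<N. if (y(Suc q := z)) (Suc q) = j
      then \<Prod>t<Suc q. A $$ ((y(Suc q := z)) t, (y(Suc q := z)) (Suc t)) else 0)"
      using Suc.prems by simp
  qed
  also have "\<dots> = (\<Sum>x\<in>insert (Suc q) {..q} \<rightarrow>\<^sub>E {..<N}. if x (Suc q) = j then \<Prod>t<Suc q. A $$ (x t, x (Suc t)) else 0)"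
    by (rule sum_PiE_insert[symmetric]) simp
  finally show ?case by (simp only: atMost_Suc)
qed

lemma sum_pow_mat:
  fixes A :: "real mat"
  assumes A: "A \<in> carrier_mat N N"
  shows "(\<Sum>i<N. \<Sum>j<N. (A ^\<^sub>m q) $$ (i, j)) =
    (\<Sum>x\<in>{..q} \<rightarrow>\<^sub>E {..<N}. \<Prod>t<q. A $$ (x t, x (Suc t)))"
proof -
  have fin: "finite ({..q} \<rightarrow>\<^sub>E {..<N})" by (auto intro: finite_PiE)
  have "(\<Sum>i<N. \<Sum>j<N. (A ^\<^sub>m q) $$ (i, j)) = (\<Sum>j<N. \<Sum>i<N. (A ^\<^sub>m q) $$ (i, j))"
    by (rule sum.swap)
  also have "\<dots> = (\<Sum>j<N. \<Sum>x | x \<in> {..q} \<rightarrow>\<^sub>E {..<N} \<and> x q = j. \<Prod>t<q. A $$ (x t, x (Suc t)))"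
    using fin by (intro sum.cong refl) (simp add: sum_pow_mat_column[OF A] sum.inter_filter)
  also have "\<dots> = (\<Sum>x\<in>{..q} \<rightarrow>\<^sub>E {..<N}. \<Prod>t<q. A $$ (x t, x (Suc t)))"
    by (rule sum.group) (use fin in \<open>auto dest: PiE_mem\<close>)
  finally show ?thesis .
qed

lemma walk_sum_eq:
  "walk_sum \<psi> \<alpha> q n R a \<omega> =
    (\<Sum>x\<in>{..q} \<rightarrow>\<^sub>E sites n. \<Prod>t<q. weighted_entry \<psi> \<alpha> R a \<omega> (x t) (x (Suc t)))"
proof -
  let ?N = "2 * n + 1" and ?h = "\<lambda>i. int i - int n"
  let ?A = "weighted_adjacency \<psi> \<alpha> n R a \<omega>"
  have A: "?A \<in> carrier_mat ?N ?N" by (simp add: weighted_adjacency_def)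
  have "walk_sum \<psi> \<alpha> q n R a \<omega> = (\<Sum>x\<in>{..q} \<rightarrow>\<^sub>E {..<?N}. \<Prod>t<q. ?A $$ (x t, x (Suc t)))"
    unfolding walk_sum_def by (rule sum_pow_mat[OF A])
  also have "\<dots> = (\<Sum>x\<in>{..q} \<rightarrow>\<^sub>E sites n. \<Prod>t<q. weighted_entry \<psi> \<alpha> R a \<omega> (x t) (x (Suc t)))"
  proof (rule sum.reindex_bij_witness[where j = "\<lambda>x. restrict (?h \<circ> x) {..q}"
        and i = "\<lambda>x. restrict (\<lambda>t. nat (x t + int n)) {..q}"])
    fix x assume x: "x \<in> {..q} \<rightarrow>\<^sub>E {..<?N}"
    have xt: "x t < ?N" if "t \<le> q" for t using PiE_mem[OF x, of t] that by simp
    show "restrict (\<lambda>t. nat (restrict (?h \<circ> x) {..q} t + int n)) {..q} = x"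
    proof
      fix t show "restrict (\<lambda>t. nat (restrict (?h \<circ> x) {..q} t + int n)) {..q} t = x t"
        using PiE_arb[OF x, of t] by (cases "t \<le> q") auto
    qed
    show "restrict (?h \<circ> x) {..q} \<in> {..q} \<rightarrow>\<^sub>E sites n"
    proof (rule restrict_PiE_iff[THEN iffD2], rule ballI)
      fix t assume "t \<in> {..q}"
      then show "(?h \<circ> x) t \<in> sites n" using xt[of t] by auto
    qed
    show "(\<Prod>t<q. weighted_entry \<psi> \<alpha> R a \<omega> (restrict (?h \<circ> x) {..q} t) (restrict (?h \<circ> x) {..q} (Suc t))) =
        (\<Prod>t<q. ?A $$ (x t, x (Suc t)))"
    proof (rule prod.cong[OF refl])
      fix t assume "t \<in> {..<q}"
      then show "weighted_entry \<psi> \<alpha> R a \<omega> (restrict (?h \<circ> x) {..q} t) (restrict (?h \<circ> x) {..q} (Suc t)) =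
          ?A $$ (x t, x (Suc t))"
        using xt[of t] xt[of "Suc t"] by (simp add: weighted_adjacency_def)
    qed
  next
    fix x assume x: "x \<in> {..q} \<rightarrow>\<^sub>E sites n"
    have xt: "- int n \<le> x t" "x t \<le> int n" if "t \<le> q" for t using PiE_mem[OF x, of t] that by simp_all
    show "restrict (?h \<circ> restrict (\<lambda>t. nat (x t + int n)) {..q}) {..q} = x"
    proof
      fix t show "restrict (?h \<circ> restrict (\<lambda>t. nat (x t + int n)) {..q}) {..q} t = x t"
        using PiE_arb[OF x, of t] xt[of t] by (cases "t \<le> q") auto
    qed
    show "restrict (\<lambda>t. nat (x t + int n)) {..q} \<in> {..q} \<rightarrow>\<^sub>E {..<?N}"
    proof (rule restrict_PiE_iff[THEN iffD2], rule ballI)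
      fix t assume "t \<in> {..q}"
      then show "nat (x t + int n) \<in> {..<?N}" using xt[of t] by auto
    qed
  qed
  finally show ?thesis .
qed

lemma prod_image_idempotent:
  fixes f :: "'e \<Rightarrow> real"
  assumes "finite A" "\<And>t. t \<in> A \<Longrightarrow> f (g t) \<in> {0, 1}"
  shows "(\<Prod>t\<in>A. f (g t)) = (\<Prod>e\<in>g ` A. f e)"
  using assms
proof (induction A rule: finite_induct)
  case (insert t A)
  show ?case
  proof (cases "g t \<in> g ` A")
    case True
    then have "(\<Prod>e\<in>g ` A. f e) = f (g t) * (\<Prod>e\<in>g ` A - {g t}. f e)"
      using insert.hyps by (intro prod.remove) auto
    then have "f (g t) * (\<Prod>e\<in>g ` A. f e) = (\<Prod>e\<in>g ` A. f e)"
      using insert.prems[of t] by auto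
    then show ?thesis using True insert by (simp add: insert_absorb)
  next
    case False
    then show ?thesis using insert by simp
  qed
qed simp

section \<open>The walk sum as a polynomial in edge indicators\<close>

context connection_profile
begin

text \<open>A walk that stays in place at some step contributes 0 because of the zero
  diagonal.\<close>

definition proper_walks :: "nat \<Rightarrow> nat \<Rightarrow> (nat \<Rightarrow> int) set" where
  "proper_walks q n = {x \<in> {..q} \<rightarrow>\<^sub>E sites n. \<forall>t<q. x t \<noteq> x (Suc t)}"

definition walk_support :: "nat \<Rightarrow> (nat \<Rightarrow> int) \<Rightarrow> int set set" where
  "walk_support q x = (\<lambda>t. {x t, x (Suc t)}) ` {..<q}"

definition link_weight :: "real \<Rightarrow> int set \<Rightarrow> real" where
  "link_weight R e = 1 + (\<psi> (spread e / R))\<^sup>2"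

definition link_prob :: "nat \<Rightarrow> real \<Rightarrow> real \<Rightarrow> int set \<Rightarrow> real" where
  "link_prob n c R e = c / real (2 * n + 1) * exp (- (\<psi> (spread e / R))\<^sup>2)"

definition walk_weight :: "nat \<Rightarrow> real \<Rightarrow> (nat \<Rightarrow> int) \<Rightarrow> real" where
  "walk_weight q R x = (\<Prod>t<q. link_weight R {x t, x (Suc t)})"

definition site_pairs :: "nat \<Rightarrow> int set set" where
  "site_pairs n = (\<lambda>(i, j). {i, j}) ` edge_pairs n"

lemma link_weight_doubleton:
  "R > 0 \<Longrightarrow> link_weight R {i, j} = 1 + (\<psi> (real_of_int (i - j) / R))\<^sup>2"
  unfolding link_weight_def spread_doubleton
  using psi_abs[of "real_of_int (i - j) / R"] by (simp add: abs_divide)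

lemma doubleton_in_site_pairs:
  "i \<in> sites n \<Longrightarrow> j \<in> sites n \<Longrightarrow> i \<noteq> j \<Longrightarrow> {i, j} \<in> site_pairs n"
proof -
  assume *: "i \<in> sites n" "j \<in> sites n" "i \<noteq> j"
  show ?thesis
  proof (cases "i < j")
    case True
    then have "(i, j) \<in> edge_pairs n" using * by (simp add: edge_pairs_def)
    then show ?thesis unfolding site_pairs_def by (intro image_eqI[of _ _ "(i, j)"]) simp_all
  next
    case False
    then have "(j, i) \<in> edge_pairs n" using * by (simp add: edge_pairs_def)
    then show ?thesis
      unfolding site_pairs_def by (intro image_eqI[of _ _ "(j, i)"]) (simp_all add: insert_commute)
  qed
qed

lemma finite_proper_walks: "finite (proper_walks q n)"
  unfolding proper_walks_def by (rule finite_subset[of _ "{..q} \<rightarrow>\<^sub>E sites n"]) (auto intro: finite_PiE)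

lemma walk_support_subset: "x \<in> proper_walks q n \<Longrightarrow> walk_support q x \<subseteq> site_pairs n"
  unfolding proper_walks_def walk_support_def
  by (auto intro!: doubleton_in_site_pairs simp: PiE_iff)

lemma Min_Max_doubleton: "i < j \<Longrightarrow> Min {i, j} = i" "i < j \<Longrightarrow> Max {i, j} = j" for i j :: int
  by simp_all

text \<open>The random variables are indexed by ordered pairs, the supports of walks consist of
  unordered edges; \<open>Min\<close> and \<open>Max\<close> translate between the two, and
  independence then gives the product rule for expectations.\<close>

lemma ensemble_bernoulli_polynomial:
  assumes ens: "edge_ensemble \<psi> n c R M a" and R: "R > 0"
  shows "bernoulli_polynomial M (proper_walks q n) (walk_support q) (link_prob n c R)
    (\<lambda>e. a (Min e) (Max e)) (site_pairs n)"
proof -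
  interpret prob_space M using ens by (simp add: edge_ensemble_def)
  have ind: "indep_vars (\<lambda>_. borel) (\<lambda>(i, j). a i j) (edge_pairs n)"
    using ens by (simp add: edge_ensemble_def)
  have a01: "a i j \<omega> \<in> {0, 1}" if "(i, j) \<in> edge_pairs n" "\<omega> \<in> space M" for i j \<omega>
    using ens that unfolding edge_ensemble_def by blast
  have ap: "prob {\<omega> \<in> space M. a i j \<omega> = 1} = c / real (2 * n + 1) * exp (- (\<psi> (real_of_int (i - j) / R))\<^sup>2)"
    if "(i, j) \<in> edge_pairs n" for i j
    using ens that unfolding edge_ensemble_def by blast
  have meas: "a i j \<in> borel_measurable M" if "(i, j) \<in> edge_pairs n" for i j
    using ind that by (auto simp: indep_vars_def)
  have lt: "i < j" if "(i, j) \<in> edge_pairs n" for i j using that by (simp add: edge_pairs_def)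
  have int: "integrable M (a i j)" if "(i, j) \<in> edge_pairs n" for i j
  proof (rule integrable_const_bound[where B = 1])
    show "AE \<omega> in M. norm (a i j \<omega>) \<le> 1"
    proof (rule AE_I2)
      fix \<omega> assume "\<omega> \<in> space M"
      from a01[OF that this] show "norm (a i j \<omega>) \<le> 1" by auto
    qed
  qed (rule meas[OF that])
  have exp: "expectation (a i j) = link_prob n c R {i, j}" if ij: "(i, j) \<in> edge_pairs n" for i j
  proof -
    have ev: "{\<omega> \<in> space M. a i j \<omega> = 1} \<in> events" using meas[OF ij] by measurable
    have "expectation (a i j) = expectation (indicator {\<omega> \<in> space M. a i j \<omega> = 1})"
      by (rule Bochner_Integration.integral_cong) (use a01[OF ij] in \<open>auto simp: indicator_def\<close>)
    also have "\<dots> = prob {\<omega> \<in> space M. a i j \<omega> = 1}" using ev by simp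
    also have "\<dots> = link_prob n c R {i, j}"
      unfolding ap[OF ij] link_prob_def spread_doubleton
      using psi_abs[of "real_of_int (i - j) / R"] R by (simp add: abs_divide)
    finally show ?thesis .
  qed
  show ?thesis
  proof
    show "finite (proper_walks q n)" by (rule finite_proper_walks)
    show "finite (walk_support q x)" for x by (simp add: walk_support_def)
    show "walk_support q x \<subseteq> site_pairs n" if "x \<in> proper_walks q n" for x
      by (rule walk_support_subset[OF that])
    show "a (Min e) (Max e) \<omega> \<in> {0, 1}" if e: "e \<in> site_pairs n" and w: "\<omega> \<in> space M" for e \<omega>
    proof -
      obtain i j where ij: "(i, j) \<in> edge_pairs n" "e = {i, j}" using e by (auto simp: site_pairs_def)
      show ?thesis using a01[OF ij(1) w] by (simp only: ij(2) Min_Max_doubleton[OF lt[OF ij(1)]])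
    qed
    show "(\<lambda>\<omega>. a (Min e) (Max e) \<omega>) \<in> borel_measurable M" if e: "e \<in> site_pairs n" for e
    proof -
      obtain i j where ij: "(i, j) \<in> edge_pairs n" "e = {i, j}" using e by (auto simp: site_pairs_def)
      show ?thesis using meas[OF ij(1)] by (simp only: ij(2) Min_Max_doubleton[OF lt[OF ij(1)]])
    qed
    fix T assume T: "finite T" "T \<subseteq> site_pairs n"
    define J where "J = {(i, j) \<in> edge_pairs n. {i, j} \<in> T}"
    have inj: "inj_on (\<lambda>(i, j). {i, j}) J"
    proof (rule inj_on_inverseI[where g = "\<lambda>e. (Min e, Max e)"])
      fix p assume p: "p \<in> J"
      obtain i j where ij: "p = (i, j)" by (cases p)
      then have "i < j" using p lt by (simp add: J_def)
      then show "(Min ((\<lambda>(i, j). {i, j}) p), Max ((\<lambda>(i, j). {i, j}) p)) = p"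
        by (simp only: ij prod.case Min_Max_doubleton)
    qed
    have img: "(\<lambda>(i, j). {i, j}) ` J = T" using T(2) by (auto simp: J_def site_pairs_def)
    have finJ: "finite J" using finite_imageD[OF _ inj] T(1) img by simp
    have JE: "J \<subseteq> edge_pairs n" by (auto simp: J_def)
    have eq: "(\<Prod>e\<in>T. a (Min e) (Max e) \<omega>) = (\<Prod>p\<in>J. (case p of (i, j) \<Rightarrow> a i j) \<omega>)" for \<omega>
      unfolding img[symmetric] prod.reindex[OF inj]
    proof (rule prod.cong[OF refl])
      fix p assume "p \<in> J"
      then have "fst p < snd p" using JE lt by (cases p) auto
      then show "((\<lambda>e. a (Min e) (Max e) \<omega>) \<circ> (\<lambda>(i, j). {i, j})) p = (case p of (i, j) \<Rightarrow> a i j) \<omega>"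
        by (cases p) (simp only: comp_apply prod.case fst_conv snd_conv Min_Max_doubleton)
    qed
    have "expectation (\<lambda>\<omega>. \<Prod>p\<in>J. (case p of (i, j) \<Rightarrow> a i j) \<omega>) = (\<Prod>p\<in>J. expectation ((\<lambda>(i, j). a i j) p))"
      by (rule indep_vars_lebesgue_integral[OF finJ indep_vars_subset[OF ind JE]])
        (use JE int in auto)
    also have "\<dots> = (\<Prod>p\<in>J. link_prob n c R ((\<lambda>(i, j). {i, j}) p))"
      using JE exp by (intro prod.cong refl) auto
    also have "\<dots> = (\<Prod>e\<in>T. link_prob n c R e)"
      unfolding img[symmetric] prod.reindex[OF inj] by simp
    finally show "expectation (\<lambda>\<omega>. \<Prod>e\<in>T. a (Min e) (Max e) \<omega>) = (\<Prod>e\<in>T. link_prob n c R e)"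
      by (simp only: eq)
  qed
qed

lemma walk_sum_bernoulli:
  assumes ens: "edge_ensemble \<psi> n c R M a" and R: "R > 0" and w: "\<omega> \<in> space M"
  shows "walk_sum \<psi> 1 q n R a \<omega> = bernoulli_polynomial.poly_value (proper_walks q n) (walk_weight q R)
    (walk_support q) (\<lambda>e. a (Min e) (Max e)) \<omega>"
proof -
  interpret bernoulli_polynomial M "proper_walks q n" "walk_weight q R" "walk_support q" "link_prob n c R"
    "\<lambda>e. a (Min e) (Max e)" "site_pairs n"
    by (rule ensemble_bernoulli_polynomial[OF ens R])
  let ?b = "\<lambda>e. a (Min e) (Max e) \<omega>"
  have entry: "weighted_entry \<psi> 1 R a \<omega> i j = link_weight R {i, j} * ?b {i, j}" if "i \<noteq> j" for i j
  proof (cases "i < j")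
    case True
    then show ?thesis by (simp add: weighted_entry_def link_weight_doubleton[OF R])
  next
    case False
    then have "j < i" using that by simp
    then show ?thesis
      using link_weight_doubleton[OF R, of j i] by (simp add: weighted_entry_def insert_commute)
  qed
  have "walk_sum \<psi> 1 q n R a \<omega> = (\<Sum>x\<in>proper_walks q n. \<Prod>t<q. weighted_entry \<psi> 1 R a \<omega> (x t) (x (Suc t)))"
    unfolding walk_sum_eq
  proof (rule sum.mono_neutral_right)
    show "\<forall>x\<in>({..q} \<rightarrow>\<^sub>E sites n) - proper_walks q n. (\<Prod>t<q. weighted_entry \<psi> 1 R a \<omega> (x t) (x (Suc t))) = 0"
    proof
      fix x assume "x \<in> ({..q} \<rightarrow>\<^sub>E sites n) - proper_walks q n"
      then obtain t where "t < q" "x t = x (Suc t)" by (auto simp: proper_walks_def)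
      then show "(\<Prod>t<q. weighted_entry \<psi> 1 R a \<omega> (x t) (x (Suc t))) = 0"
        by (intro prod_zero) (auto simp: weighted_entry_def intro!: bexI[of _ t])
    qed
  qed (auto simp: proper_walks_def intro: finite_PiE)
  also have "\<dots> = (\<Sum>x\<in>proper_walks q n. walk_weight q R x * (\<Prod>e\<in>walk_support q x. ?b e))"
  proof (rule sum.cong[OF refl])
    fix x assume x: "x \<in> proper_walks q n"
    have "(\<Prod>t<q. weighted_entry \<psi> 1 R a \<omega> (x t) (x (Suc t))) =
        (\<Prod>t<q. link_weight R {x t, x (Suc t)} * ?b {x t, x (Suc t)})"
      using x by (intro prod.cong refl entry) (auto simp: proper_walks_def)
    also have "\<dots> = walk_weight q R x * (\<Prod>t<q. ?b {x t, x (Suc t)})"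
      by (simp only: walk_weight_def prod.distrib)
    also have "(\<Prod>t<q. ?b {x t, x (Suc t)}) = (\<Prod>e\<in>walk_support q x. ?b e)"
      unfolding walk_support_def
    proof (rule prod_image_idempotent)
      fix t assume "t \<in> {..<q}"
      then have "{x t, x (Suc t)} \<in> site_pairs n" using walk_support_subset[OF x] by (auto simp: walk_support_def)
      then show "?b {x t, x (Suc t)} \<in> {0, 1}" using w by (rule b01)
    qed simp
    finally show "(\<Prod>t<q. weighted_entry \<psi> 1 R a \<omega> (x t) (x (Suc t))) =
      walk_weight q R x * (\<Prod>e\<in>walk_support q x. ?b e)" .
  qed
  finally show ?thesis by (simp only: poly_value_def)
qed

lemma link_weight_nonneg: "0 \<le> link_weight R e" by (simp add: link_weight_def)

text \<open>Grouping the steps by the edge they use raises the link weight to the multiplicity of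
  the edge, while its probability enters only once.\<close>

lemma weight_eq_link_weights:
  fixes x :: "'i \<times> nat \<Rightarrow> int"
  assumes "finite I"
  shows "weight (edge_weight n c R) I l x =
    (\<Prod>i\<in>I. \<Prod>t<l i. link_weight R (edge x (i, t))) * (\<Prod>e\<in>edges I l x. link_prob n c R e)"
proof -
  have "(\<Prod>i\<in>I. \<Prod>t<l i. link_weight R (edge x (i, t))) = (\<Prod>p\<in>steps I l. link_weight R (edge x p))"
    unfolding steps_def using assms by (subst prod.Sigma) auto
  also have "\<dots> = (\<Prod>e\<in>edges I l x. \<Prod>p | p \<in> steps I l \<and> edge x p = e. link_weight R (edge x p))"
    by (rule prod.group[symmetric]) (use assms in \<open>auto simp: edges_def\<close>)
  also have "\<dots> = (\<Prod>e\<in>edges I l x. link_weight R e ^ edge_count I l x e)"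
    by (intro prod.cong refl) (simp add: edge_count_def)
  finally show ?thesis
    by (simp add: weight_def edge_weight_def link_prob_def link_weight_def profile_def prod.distrib[symmetric] mult_ac)
qed

text \<open>A tuple of walks, one function for each index, is the same as one function on the
  points; this identifies the sum of joint moments over linked tuples with
  \<open>link_sum\<close>.\<close>

lemma link_sum_curry:
  assumes fin: "finite I"
  shows "(\<Sum>z | z \<in> I \<rightarrow>\<^sub>E proper_walks q n \<and> linked I (\<lambda>i. walk_support q (z i)).
      (\<Prod>i\<in>I. walk_weight q R (z i)) * (\<Prod>e\<in>(\<Union>i\<in>I. walk_support q (z i)). link_prob n c R e)) =
    link_sum (edge_weight n c R) I (\<lambda>_. q) (sites n)"
proof -
  let ?l = "\<lambda>_. q"
  let ?P = "points I ?l"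
  have mem: "(i, t) \<in> ?P \<longleftrightarrow> i \<in> I \<and> t \<le> q" for i t by (simp add: points_def)
  let ?j = "\<lambda>z. restrict (\<lambda>(i, t). z i t) ?P"
  let ?i = "\<lambda>x. \<lambda>i\<in>I. \<lambda>t\<in>{..q}. x (i, t)"
  have edge: "edge (?j z) (i, t) = {z i t, z i (Suc t)}" if "i \<in> I" "t < q" for z i t
    using that by (simp add: edge_def mem)
  have we: "walk_edges ?l (?j z) i = walk_support q (z i)" if "i \<in> I" for z i
    unfolding walk_edges_def walk_support_def by (intro image_cong refl edge that) simp
  show ?thesis unfolding link_sum_def
  proof (rule sum.reindex_bij_witness[where i = ?i and j = ?j])
    fix z assume "z \<in> {z. z \<in> I \<rightarrow>\<^sub>E proper_walks q n \<and> linked I (\<lambda>i. walk_support q (z i))}"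
    then have z: "z \<in> I \<rightarrow>\<^sub>E proper_walks q n" and lk: "linked I (\<lambda>i. walk_support q (z i))" by auto
    have zi: "z i \<in> {..q} \<rightarrow>\<^sub>E sites n" "\<And>t. t < q \<Longrightarrow> z i t \<noteq> z i (Suc t)" if "i \<in> I" for i
      using PiE_mem[OF z that] by (auto simp: proper_walks_def)
    show "?i (?j z) = z"
    proof
      fix i show "?i (?j z) i = z i"
      proof (cases "i \<in> I")
        case True
        have "(\<lambda>t\<in>{..q}. ?j z (i, t)) = z i"
        proof
          fix t show "(\<lambda>t\<in>{..q}. ?j z (i, t)) t = z i t"
            using PiE_arb[OF zi(1)[OF True], of t] True by (cases "t \<le> q") (auto simp: mem)
        qed
        then show ?thesis using True by simp
      next
        case False
        then show ?thesis using PiE_arb[OF z False] by simp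
      qed
    qed
    have "?j z \<in> ?P \<rightarrow>\<^sub>E sites n"
    proof (rule restrict_PiE_iff[THEN iffD2], rule ballI)
      fix p assume "p \<in> ?P"
      then show "(case p of (i, t) \<Rightarrow> z i t) \<in> sites n"
        using PiE_mem[OF zi(1), of "fst p" "snd p"] by (cases p) (simp add: mem)
    qed
    moreover have "proper I ?l (?j z)"
      unfolding proper_def
    proof
      fix p assume "p \<in> steps I ?l"
      then have "fst p \<in> I" "snd p < q" by (auto simp: steps_def)
      then show "?j z p \<noteq> ?j z (fst p, Suc (snd p))"
        using zi(2)[of "fst p" "snd p"] by (cases p) (simp add: mem)
    qed
    moreover have "linked I (walk_edges ?l (?j z))"
      using linked_cong[of I "walk_edges ?l (?j z)" "\<lambda>i. walk_support q (z i)"] we lk by simp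
    ultimately show "?j z \<in> configs I ?l (sites n)" by (simp add: configs_def)
    have "(\<Prod>i\<in>I. \<Prod>t<q. link_weight R (edge (?j z) (i, t))) = (\<Prod>i\<in>I. walk_weight q R (z i))"
      unfolding walk_weight_def by (intro prod.cong refl arg_cong[where f = "link_weight R"] edge) auto
    moreover have "edges I ?l (?j z) = (\<Union>i\<in>I. walk_support q (z i))"
      unfolding edges_UN using we by simp
    ultimately show "weight (edge_weight n c R) I ?l (?j z) =
      (\<Prod>i\<in>I. walk_weight q R (z i)) * (\<Prod>e\<in>(\<Union>i\<in>I. walk_support q (z i)). link_prob n c R e)"
      by (simp only: weight_eq_link_weights[OF fin])
  next
    fix x assume x: "x \<in> configs I ?l (sites n)"
    then have xE: "x \<in> ?P \<rightarrow>\<^sub>E sites n" and pr: "proper I ?l x" and lk: "linked I (walk_edges ?l x)"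
      by (auto simp: configs_def)
    show ji: "?j (?i x) = x"
    proof
      fix p show "?j (?i x) p = x p"
        using PiE_arb[OF xE, of p] by (cases p) (auto simp: mem restrict_def)
    qed
    have "?i x i \<in> proper_walks q n" if i: "i \<in> I" for i
    proof -
      have "(\<lambda>t\<in>{..q}. x (i, t)) \<in> {..q} \<rightarrow>\<^sub>E sites n"
        by (rule restrict_PiE_iff[THEN iffD2], rule ballI, rule PiE_mem[OF xE]) (use i in \<open>simp add: mem\<close>)
      moreover have "x (i, t) \<noteq> x (i, Suc t)" if "t < q" for t
        using pr i that unfolding proper_def steps_def by (auto dest: bspec[of _ _ "(i, t)"])
      ultimately show ?thesis using i by (simp add: proper_walks_def)
    qed
    moreover have "linked I (\<lambda>i. walk_support q (?i x i))"
      using linked_cong[of I "walk_edges ?l x" "\<lambda>i. walk_support q (?i x i)"] we[of _ "?i x"] lk ji by simp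
    ultimately show "?i x \<in> {z. z \<in> I \<rightarrow>\<^sub>E proper_walks q n \<and> linked I (\<lambda>i. walk_support q (z i))}"
      by auto
  qed
qed

text \<open>The scaling \<open>s\<close> comes out as \<open>s ^ Suc j\<close> by homogeneity of
  cumulants. In the dense regime it will be (N / (cR))^(q - 1), otherwise 1.\<close>

theorem cumulant_walk_sum_approx:
  fixes q j :: nat and s :: real
  assumes ens: "edge_ensemble \<psi> n c R M a" and R: "R > 0" and c: "0 < c" "c \<le> real (2 * n + 1)"
  defines "T \<equiv> link_sum (edge_weight n c R) {..j} (\<lambda>_. q) (sites n)"
  shows "\<bar>cumulant M (Suc j) (\<lambda>\<omega>. s * walk_sum \<psi> 1 q n R a \<omega>) - s ^ Suc j * T\<bar> \<le>
    2 ^ (Suc j + (Suc j)\<^sup>2) * (c / real (2 * n + 1)) * (\<bar>s\<bar> ^ Suc j * T)"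
proof -
  interpret bernoulli_polynomial M "proper_walks q n" "walk_weight q R" "walk_support q" "link_prob n c R"
    "\<lambda>e. a (Min e) (Max e)" "site_pairs n"
    by (rule ensemble_bernoulli_polynomial[OF ens R])
  let ?m = "\<lambda>i. expectation (\<lambda>\<omega>. poly_value \<omega> ^ i)"
  let ?Y = "\<lambda>\<omega>. s * poly_value \<omega>"
  have "cumulant M (Suc j) (\<lambda>\<omega>. s * walk_sum \<psi> 1 q n R a \<omega>) = cumulant M (Suc j) ?Y"
  proof -
    have "expectation (\<lambda>\<omega>. exp (t * (s * walk_sum \<psi> 1 q n R a \<omega>))) = expectation (\<lambda>\<omega>. exp (t * ?Y \<omega>))" for t
      by (rule Bochner_Integration.integral_cong) (simp_all add: walk_sum_bernoulli[OF ens R])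
    then show ?thesis unfolding cumulant_def by simp
  qed
  also have "\<dots> = cumulant_rec (\<lambda>i. expectation (\<lambda>\<omega>. ?Y \<omega> ^ i)) j"
    unfolding cumulant_def
  proof (rule cumulant_eq_cumulant_rec)
    show "?Y \<in> borel_measurable M" using poly_value_measurable by simp
    show "finite (?Y ` space M)"
      using finite_imageI[OF poly_value_finite_range, of "\<lambda>v. s * v"] by (simp add: image_image)
  qed
  also have "\<dots> = s ^ Suc j * cumulant_rec ?m j"
    by (simp add: power_mult_distrib cumulant_rec_scale)
  finally have cum: "cumulant M (Suc j) (\<lambda>\<omega>. s * walk_sum \<psi> 1 q n R a \<omega>) = s ^ Suc j * cumulant_rec ?m j" .
  have T: "T = (\<Sum>z | z \<in> {..j} \<rightarrow>\<^sub>E proper_walks q n \<and> linked {..j} (\<lambda>i. walk_support q (z i)).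
      (\<Prod>i\<le>j. walk_weight q R (z i)) * joint_moment z {..j})"
    unfolding T_def joint_moment_def by (rule link_sum_curry[symmetric]) simp
  have "\<bar>cumulant_rec ?m j - T\<bar> \<le> 2 ^ (Suc j + (Suc j)\<^sup>2) * (c / real (2 * n + 1)) * T"
    unfolding T
  proof (rule cumulant_rec_approx)
    show "0 \<le> walk_weight q R x" for x unfolding walk_weight_def by (intro prod_nonneg) (simp add: link_weight_nonneg)
    show "0 \<le> link_prob n c R e" for e using c by (simp add: link_prob_def)
    show "link_prob n c R e \<le> c / real (2 * n + 1)" for e
      unfolding link_prob_def using c by (intro mult_left_le) auto
    show "c / real (2 * n + 1) \<le> 1" using c by simp
  qed
  then have "\<bar>s\<bar> ^ Suc j * \<bar>cumulant_rec ?m j - T\<bar> \<le> \<bar>s\<bar> ^ Suc j * (2 ^ (Suc j + (Suc j)\<^sup>2) * (c / real (2 * n + 1)) * T)"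
    by (rule mult_left_mono) simp
  moreover have "\<bar>s ^ Suc j * cumulant_rec ?m j - s ^ Suc j * T\<bar> = \<bar>s\<bar> ^ Suc j * \<bar>cumulant_rec ?m j - T\<bar>"
    by (simp only: right_diff_distrib[symmetric] abs_mult power_abs)
  ultimately show ?thesis unfolding cum by (simp only: mult_ac)
qed

end

section \<open>The limiting transitions and the three regimes\<close>

abbreviation "par_n \<equiv> (\<lambda>p :: nat \<times> real \<times> real. fst p)"
abbreviation "par_c \<equiv> (\<lambda>p :: nat \<times> real \<times> real. fst (snd p))"
abbreviation "par_R \<equiv> (\<lambda>p :: nat \<times> real \<times> real. snd (snd p))"

lemma NcR_limit_properties:
  assumes "F \<le> NcR_limit"
  shows "\<forall>\<^sub>F p in F. 0 < par_c p \<and> par_c p \<le> real (2 * par_n p + 1) \<and> 0 < par_R p"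
    "filterlim par_R at_top F"
    "((\<lambda>p. par_R p / real (2 * par_n p + 1)) \<longlongrightarrow> 0) F"
    "((\<lambda>p. par_c p / real (2 * par_n p + 1)) \<longlongrightarrow> 0) F"
proof -
  have le: "F \<le> G" if "G \<in> {
     principal {(n, c, R). 0 < c \<and> c \<le> real (2 * n + 1) \<and> 0 < R},
     filtercomap (\<lambda>(n, c, R). real (2 * n + 1)) at_top,
     filtercomap (\<lambda>(n, c, R). c) at_top,
     filtercomap (\<lambda>(n, c, R). R) at_top,
     filtercomap (\<lambda>(n, c, R). R / real (2 * n + 1)) (nhds 0),
     filtercomap (\<lambda>(n, c, R). c / real (2 * n + 1)) (nhds 0)}" for G
    using assms Inf_lower[OF that] unfolding NcR_limit_def by (rule order_trans)
  have "F \<le> principal {(n, c, R). 0 < c \<and> c \<le> real (2 * n + 1) \<and> 0 < R}" by (rule le) simp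
  then show "\<forall>\<^sub>F p in F. 0 < par_c p \<and> par_c p \<le> real (2 * par_n p + 1) \<and> 0 < par_R p"
    by (simp add: le_principal case_prod_unfold)
  have "F \<le> filtercomap (\<lambda>(n, c, R). R) at_top" by (rule le) simp
  then show "filterlim par_R at_top F" by (simp add: filterlim_iff_le_filtercomap case_prod_unfold)
  have "F \<le> filtercomap (\<lambda>(n, c, R). R / real (2 * n + 1)) (nhds 0)" by (rule le) simp
  then show "((\<lambda>p. par_R p / real (2 * par_n p + 1)) \<longlongrightarrow> 0) F"
    by (simp add: filterlim_iff_le_filtercomap case_prod_unfold)
  have "F \<le> filtercomap (\<lambda>(n, c, R). c / real (2 * n + 1)) (nhds 0)" by (rule le) simp
  then show "((\<lambda>p. par_c p / real (2 * par_n p + 1)) \<longlongrightarrow> 0) F"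
    by (simp add: filterlim_iff_le_filtercomap case_prod_unfold)
qed

lemma (in connection_profile) Xi_dense_eq_lead_sum:
  assumes "1 \<le> q"
  shows "Xi_dense \<psi> q (Suc j) = lead_sum profile_int {..j} (\<lambda>_. q)"
proof -
  have "V_int \<psi> = profile_int"
    by (simp add: fun_eq_iff V_int_def profile_int_def profile_def)
  moreover have "cum_seqs (Suc j) u = bounded_seqs (Suc j - 1) u (Suc j - 1)" for u
    by (simp add: cum_seqs_def bounded_seqs_def)
  ultimately have "Xi_dense \<psi> q (Suc j) = hypertree_sum profile_int q (Suc j)"
    unfolding Xi_dense_def hypertree_sum_def by simp
  then show ?thesis
    using lead_sum_eq_hypertree_sum[of q "Suc j" profile_int] assms by (simp add: lessThan_Suc_atMost)
qed

text \<open>The approximation error is bounded by a constant times c / N times the quantity that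
  converges, hence it vanishes; limits of the normalised sums over linked walks are therefore limits
  of the cumulants.\<close>

lemma (in connection_profile) cumulant_limit:
  fixes M :: "nat \<Rightarrow> real \<Rightarrow> real \<Rightarrow> 'w measure"
    and a :: "nat \<Rightarrow> real \<Rightarrow> real \<Rightarrow> int \<Rightarrow> int \<Rightarrow> 'w \<Rightarrow> real"
  assumes ensemble: "\<And>n c R. 0 < c \<Longrightarrow> c \<le> real (2 * n + 1) \<Longrightarrow> 0 < R \<Longrightarrow>
                     edge_ensemble \<psi> n c R (M n c R) (a n c R)"
    and F: "F \<le> NcR_limit" and s: "\<forall>\<^sub>F p in F. 0 \<le> s p"
    and lim: "((\<lambda>p. s p ^ Suc j * sparse_limit.total_sum \<psi> par_n par_c par_R {..j} (\<lambda>_. q) p) \<longlongrightarrow> L) F"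
  shows "((\<lambda>p. 1 / (par_c p * par_R p) * cumulant (M (par_n p) (par_c p) (par_R p)) (Suc j)
      (\<lambda>\<omega>. s p * walk_sum \<psi> 1 q (par_n p) (par_R p) (a (par_n p) (par_c p) (par_R p)) \<omega>)) \<longlongrightarrow> L) F"
proof -
  note props = NcR_limit_properties[OF F]
  interpret sparse_limit \<psi> F par_n par_c par_R
  proof
    show "\<forall>\<^sub>F p in F. 0 < par_c p" using props(1) by eventually_elim simp
  qed (fact props)+
  let ?T = "total_sum {..j} (\<lambda>_. q)" and ?K = "2 ^ (Suc j + (Suc j)\<^sup>2) :: real"
  let ?C = "\<lambda>p. 1 / (par_c p * par_R p) * cumulant (M (par_n p) (par_c p) (par_R p)) (Suc j)
      (\<lambda>\<omega>. s p * walk_sum \<psi> 1 q (par_n p) (par_R p) (a (par_n p) (par_c p) (par_R p)) \<omega>)"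
  have "((\<lambda>p. ?C p - s p ^ Suc j * ?T p) \<longlongrightarrow> 0) F"
  proof (rule Lim_null_comparison)
    show "\<forall>\<^sub>F p in F. norm (?C p - s p ^ Suc j * ?T p) \<le>
        ?K * (par_c p / real (2 * par_n p + 1)) * (s p ^ Suc j * ?T p)"
      using props(1) s
    proof eventually_elim
      case (elim p)
      let ?cR = "par_c p * par_R p"
      let ?L = "link_sum (edge_weight (par_n p) (par_c p) (par_R p)) {..j} (\<lambda>_. q) (sites (par_n p))"
      let ?cum = "cumulant (M (par_n p) (par_c p) (par_R p)) (Suc j)
        (\<lambda>\<omega>. s p * walk_sum \<psi> 1 q (par_n p) (par_R p) (a (par_n p) (par_c p) (par_R p)) \<omega>)"
      have cR: "?cR > 0" using elim by simp
      have ens: "edge_ensemble \<psi> (par_n p) (par_c p) (par_R p) (M (par_n p) (par_c p) (par_R p)) (a (par_n p) (par_c p) (par_R p))"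
        using elim by (intro ensemble) auto
      have "\<bar>?cum - s p ^ Suc j * ?L\<bar> \<le> ?K * (par_c p / real (2 * par_n p + 1)) * (\<bar>s p\<bar> ^ Suc j * ?L)"
        by (rule cumulant_walk_sum_approx[OF ens]) (use elim in auto)
      then have "\<bar>?cum - s p ^ Suc j * ?L\<bar> / ?cR \<le> ?K * (par_c p / real (2 * par_n p + 1)) * (\<bar>s p\<bar> ^ Suc j * ?L) / ?cR"
        using cR by (intro divide_right_mono) auto
      moreover have "norm (?C p - s p ^ Suc j * ?T p) = \<bar>?cum - s p ^ Suc j * ?L\<bar> / ?cR"
      proof -
        have "?C p - s p ^ Suc j * ?T p = (?cum - s p ^ Suc j * ?L) / ?cR"
          by (simp add: total_sum_def diff_divide_distrib)
        then show ?thesis using cR by (simp only: real_norm_def abs_divide abs_of_pos)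
      qed
      ultimately show ?case using elim by (simp only: total_sum_def times_divide_eq_right abs_of_nonneg)
    qed
    have "((\<lambda>p. ?K * (par_c p / real (2 * par_n p + 1)) * (s p ^ Suc j * ?T p)) \<longlongrightarrow> ?K * 0 * L) F"
      by (intro tendsto_mult tendsto_const props(4) lim)
    then show "((\<lambda>p. ?K * (par_c p / real (2 * par_n p + 1)) * (s p ^ Suc j * ?T p)) \<longlongrightarrow> 0) F"
      by (simp only: mult_zero_right mult_zero_left)
  qed
  from tendsto_add[OF this lim] show ?thesis by simp
qed

theorem theorem2p2:
  fixes \<psi> :: "real \<Rightarrow> real"
    and q k :: nat
    and M :: "nat \<Rightarrow> real \<Rightarrow> real \<Rightarrow> 'w measure"
    and a :: "nat \<Rightarrow> real \<Rightarrow> real \<Rightarrow> int \<Rightarrow> int \<Rightarrow> 'w \<Rightarrow> real"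
  assumes even: "\<And>x. \<psi> (- x) = \<psi> x"
    and continuous: "continuous_on UNIV \<psi>"
    and positive: "\<And>x. 0 < \<psi> x"
    and mono: "mono_on {0..} \<psi>"
    and integrable_exp: "integrable lborel (\<lambda>t. exp (- (\<psi> t)\<^sup>2))"
    and finite_V: "\<And>m::nat. integrable lborel (\<lambda>s. (1 + (\<psi> s)\<^sup>2) ^ m * exp (- (\<psi> s)\<^sup>2))"
    and ensemble: "\<And>n c R. 0 < c \<Longrightarrow> c \<le> real (2 * n + 1) \<Longrightarrow> 0 < R \<Longrightarrow>
                     edge_ensemble \<psi> n c R (M n c R) (a n c R)"
    and q: "1 \<le> q"
    and k: "1 \<le> k"
  shows
    "((\<lambda>(n, c, R). 1 / (c * R) *
          cumulant (M n c R) k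
            (\<lambda>\<omega>. real (2 * n + 1) ^ (q - 1) / (c * R) ^ (q - 1) * walk_sum \<psi> 1 q n R (a n c R) \<omega>))
        \<longlongrightarrow> Xi_dense \<psi> q k) NcR_limit_dense
     \<and> (\<forall>s>0. \<exists>\<Xi>::real.
          ((\<lambda>(n, c, R). 1 / (c * R) *
              cumulant (M n c R) k (walk_sum \<psi> 1 q n R (a n c R)))
            \<longlongrightarrow> \<Xi>) (NcR_limit_fixed s))
     \<and> ((\<lambda>(n, c, R). 1 / (c * R) *
          cumulant (M n c R) k (walk_sum \<psi> 1 q n R (a n c R)))
        \<longlongrightarrow> 2 ^ (k - 1) * V_int \<psi> (k * q)) NcR_limit_dilute"
proof -
  interpret connection_profile \<psi>
    by standard (fact even continuous positive mono integrable_exp finite_V)+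
  obtain j where j: "k = Suc j" using k by (cases k) auto
  let ?I = "{..j}" and ?l = "\<lambda>_::nat. q"
  have I: "finite ?I" "?I \<noteq> {}" "\<forall>i\<in>?I. 1 \<le> ?l i" using q by auto
  have sparse: "sparse_limit \<psi> F par_n par_c par_R" if F: "F \<le> NcR_limit" for F
  proof -
    note props = NcR_limit_properties[OF F]
    show ?thesis
    proof
      show "\<forall>\<^sub>F p in F. 0 < par_c p" using props(1) by eventually_elim simp
    qed (fact props)+
  qed
  have unscaled: "((\<lambda>(n, c, R). 1 / (c * R) * cumulant (M n c R) k (walk_sum \<psi> 1 q n R (a n c R))) \<longlongrightarrow> L) F"
    if "F \<le> NcR_limit" and "((\<lambda>p. sparse_limit.total_sum \<psi> par_n par_c par_R ?I ?l p) \<longlongrightarrow> L) F" for F L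
    using cumulant_limit[where s = "\<lambda>_. 1" and j = j and q = q and L = L and M = M and a = a, OF ensemble that(1)] that(2)
    by (simp add: case_prod_unfold j)
  have dens: "link_density = (\<lambda>p. par_c p * par_R p / real (2 * par_n p + 1))"
    by (simp add: link_density_def case_prod_unfold)
  have dense: "((\<lambda>(n, c, R). 1 / (c * R) * cumulant (M n c R) k
      (\<lambda>\<omega>. real (2 * n + 1) ^ (q - 1) / (c * R) ^ (q - 1) * walk_sum \<psi> 1 q n R (a n c R) \<omega>))
      \<longlongrightarrow> Xi_dense \<psi> q k) NcR_limit_dense"
  proof -
    let ?s = "\<lambda>p. real (2 * par_n p + 1) ^ (q - 1) / (par_c p * par_R p) ^ (q - 1)"
    have F: "NcR_limit_dense \<le> NcR_limit" by (simp add: NcR_limit_dense_def)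
    interpret S: sparse_limit \<psi> NcR_limit_dense par_n par_c par_R by (rule sparse[OF F])
    have "NcR_limit_dense \<le> filtercomap link_density at_top" by (simp add: NcR_limit_dense_def)
    then have d: "filterlim (\<lambda>p. par_c p * par_R p / real (2 * par_n p + 1)) at_top NcR_limit_dense"
      by (simp only: filterlim_iff_le_filtercomap dens)
    \<comment> \<open>This is the exponent k (q - 1), so the k-th power of the scaling is exactly
      the inverse power of the link density that normalises the maximal trees.\<close>
    have top: "top_edges ?I ?l - 1 = (q - 1) * Suc j" by (simp add: top_edges_def)
    have eq: "?s p ^ Suc j * S.total_sum ?I ?l p = S.total_sum ?I ?l p /
        (par_c p * par_R p / real (2 * par_n p + 1)) ^ (top_edges ?I ?l - 1)" for p
      unfolding top power_mult by (simp only: power_divide divide_divide_eq_right times_divide_eq_left times_divide_eq_right mult.commute)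
    have lim: "((\<lambda>p. ?s p ^ Suc j * S.total_sum ?I ?l p) \<longlongrightarrow> lead_sum profile_int ?I ?l) NcR_limit_dense"
      unfolding eq by (rule S.total_sum_dense[OF I d])
    have s: "\<forall>\<^sub>F p in NcR_limit_dense. 0 \<le> ?s p"
      using NcR_limit_properties(1)[OF F] by eventually_elim auto
    show ?thesis
      using cumulant_limit[where s = ?s and j = j and q = q and M = M and a = a, OF ensemble F s lim]
      by (simp add: case_prod_unfold j Xi_dense_eq_lead_sum[OF q])
  qed
  have fixed: "\<exists>\<Xi>::real. ((\<lambda>(n, c, R). 1 / (c * R) * cumulant (M n c R) k (walk_sum \<psi> 1 q n R (a n c R)))
      \<longlongrightarrow> \<Xi>) (NcR_limit_fixed s)" if s: "s > 0" for s
  proof -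
    have F: "NcR_limit_fixed s \<le> NcR_limit" by (simp add: NcR_limit_fixed_def)
    interpret S: sparse_limit \<psi> "NcR_limit_fixed s" par_n par_c par_R by (rule sparse[OF F])
    have "NcR_limit_fixed s \<le> principal {p. link_density p = s}" by (simp add: NcR_limit_fixed_def)
    then have "\<forall>\<^sub>F p in NcR_limit_fixed s. par_c p * par_R p / real (2 * par_n p + 1) = s"
      by (simp add: le_principal dens)
    \<comment> \<open>The limit is a polynomial in \<open>s\<close>: a pattern with v vertices
      contributes its value times s^(v - 2).\<close>
    from unscaled[OF F S.total_sum_fixed[OF I this s]] show ?thesis by blast
  qed
  have "((\<lambda>(n, c, R). 1 / (c * R) * cumulant (M n c R) k (walk_sum \<psi> 1 q n R (a n c R)))
        \<longlongrightarrow> 2 ^ (k - 1) * V_int \<psi> (k * q)) NcR_limit_dilute"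
  proof -
    have F: "NcR_limit_dilute \<le> NcR_limit" by (simp add: NcR_limit_dilute_def)
    interpret S: sparse_limit \<psi> NcR_limit_dilute par_n par_c par_R by (rule sparse[OF F])
    have "NcR_limit_dilute \<le> filtercomap link_density (nhds 0)" by (simp add: NcR_limit_dilute_def)
    then have d: "((\<lambda>p. par_c p * par_R p / real (2 * par_n p + 1)) \<longlongrightarrow> 0) NcR_limit_dilute"
      by (simp only: filterlim_iff_le_filtercomap dens)
    have "2 ^ (card ?I - 1) * profile_int (\<Sum>i\<in>?I. ?l i) = 2 ^ (k - 1) * V_int \<psi> (k * q)"
      by (simp add: j V_int_def profile_int_def profile_def)
    then show ?thesis using unscaled[OF F S.total_sum_dilute[OF I d]] by simp
  qed
  with dense fixed show ?thesis by blast
qed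

end
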